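(* Let $\Omega\subset\mathbb{R}^N$ be an open Lipschitz domain, let $1<p<N$, and let one of the following hold: (i) $\mu=0$, $0<s<p<N$, $p\le r<\frac{p(N-s)}{N-p}$; (ii) $\mu>0$, $\frac{N\mu(r-p)}{p^2}<s<\mu+p<N$, $p\le r<\min\{\frac{pN}{N-p},\frac{p(N-s)}{N-\mu-p}\}$; (iii) $\mu<0$, $0<s<\mu+p<N$, $p\le r<\frac{p(N-s)}{N-\mu-p}$. Then $$W^{1,p}_\mu(\Omega)\cap L^p(\Omega)\hookrightarrow L^r\Big(\Omega,\frac{dx}{|x|^s}\Big)$$ is a compact embedding.
   Context: $N\ge2$. $W^{1,p}_\mu(\Omega)$ is the completion of $C_0^\infty(\Omega)$ with respect to the norm $\|u\|:=\big(\int_\Omega\frac{|\nabla u|^p}{|x|^\mu}dx\big)^{1/p}$, and $L^r(\Omega,\frac{dx}{|x|^s})$ is the completion of $C_0^\infty(\Omega)$ with respect to the norm $\big(\int_\Omega\frac{|u|^r}{|x|^s}dx\big)^{1/r}$. The space $W^{1,p}_\mu(\Omega)\cap L^p(\Omega)$ carries the norm $\|u\|+\lambda\big(\int_\Omega|u|^pdx\big)^{1/p}$, where $\lambda>0$ is fixed. *)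

theory Defs
  imports "HOL-Analysis.Analysis"
begin

section \<open>Lipschitz domains\<close>

text \<open>
  Possibly unbounded. Near each boundary point, and up to a rigid motion, the set is the open
  region above the graph of a Lipschitz function; the unit vector \<open>e\<close> is the vertical direction,
  so \<open>x - (e \<bullet> x) *\<^sub>R e\<close> are the horizontal coordinates of \<open>x\<close>.
  The radius and the Lipschitz constant may depend on the boundary point.
\<close>

definition lipschitz_domain :: "'a::euclidean_space set \<Rightarrow> bool" where
  "lipschitz_domain \<Omega> \<longleftrightarrow>
     open \<Omega> \<and> connected \<Omega> \<and> \<Omega> \<noteq> {} \<and>
     (\<forall>z\<in>frontier \<Omega>. \<exists>e \<rho> L g.
        norm e = 1 \<and> \<rho> > 0 \<and> L-lipschitz_on {y. e \<bullet> y = 0} g \<and>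
        \<Omega> \<inter> ball z \<rho> = {x \<in> ball z \<rho>. g (x - (e \<bullet> x) *\<^sub>R e) < e \<bullet> x})"

section \<open>Test functions\<close>

primrec Ck :: "nat \<Rightarrow> ('a::euclidean_space \<Rightarrow> real) \<Rightarrow> bool" where
  "Ck 0 f \<longleftrightarrow> continuous_on UNIV f"
| "Ck (Suc k) f \<longleftrightarrow>
     (\<forall>x. f differentiable (at x)) \<and> (\<forall>v. Ck k (\<lambda>x. frechet_derivative f (at x) v))"

text \<open>Test functions on \<open>\<Omega>\<close> are taken to be extended by zero to the whole space.\<close>

definition C0_inf :: "'a::euclidean_space set \<Rightarrow> ('a \<Rightarrow> real) set" where
  "C0_inf \<Omega> =
     {f. (\<forall>k. Ck k f) \<and> compact (closure {x. f x \<noteq> 0}) \<and> closure {x. f x \<noteq> 0} \<subseteq> \<Omega>}"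

definition grad :: "('a::euclidean_space \<Rightarrow> real) \<Rightarrow> 'a \<Rightarrow> 'a" where
  "grad f x = (THE D. GDERIV f x :> D)"

section \<open>Completions of the test functions\<close>

text \<open>
  The completion of \<open>C0_inf \<Omega>\<close> with respect to a norm \<open>nrm\<close> is realised as a space of functions:
  a function \<open>u\<close> belongs to it if it is the pointwise a.e. limit on \<open>\<Omega>\<close> of a \<open>nrm\<close>-Cauchy sequence
  of test functions, and its norm is the limit of the norms along such a sequence. Functions that
  agree a.e. on \<open>\<Omega>\<close> represent the same element; values outside \<open>\<Omega>\<close> are irrelevant.

  For the weighted gradient norm with \<open>p > 1\<close> and \<open>\<mu> + p < N\<close>, Hardy's inequality bounds the
  \<open>L\<^sup>p\<close> norm with weight \<open>|x| powr - (\<mu> + p)\<close> by the gradient norm. Hence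
  every Cauchy sequence has an a.e. convergent subsequence, and two Cauchy sequences have the same
  a.e. limit iff their difference tends to zero in norm, so this is the abstract completion. For
  the weighted Lebesgue norm with exponent \<open>r \<ge> 1\<close> and weight exponent \<open>s < N\<close> the same holds by
  completeness of the weighted Lebesgue space, and the completion is that space.
\<close>

definition norm_Cauchy :: "(('a \<Rightarrow> real) \<Rightarrow> real) \<Rightarrow> (nat \<Rightarrow> 'a \<Rightarrow> real) \<Rightarrow> bool" where
  "norm_Cauchy nrm \<phi> \<longleftrightarrow>
     (\<forall>\<epsilon>>0. \<exists>M. \<forall>m\<ge>M. \<forall>n\<ge>M. nrm (\<lambda>x. \<phi> m x - \<phi> n x) < \<epsilon>)"

definition approximates ::
  "'a::euclidean_space set \<Rightarrow> (('a \<Rightarrow> real) \<Rightarrow> real) \<Rightarrow> (nat \<Rightarrow> 'a \<Rightarrow> real) \<Rightarrow> ('a \<Rightarrow> real) \<Rightarrow> bool"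
  where
  "approximates \<Omega> nrm \<phi> u \<longleftrightarrow>
     (\<forall>n. \<phi> n \<in> C0_inf \<Omega>) \<and> norm_Cauchy nrm \<phi> \<and>
     (AE x in lebesgue_on \<Omega>. (\<lambda>n. \<phi> n x) \<longlonglongrightarrow> u x)"

definition completion ::
  "'a::euclidean_space set \<Rightarrow> (('a \<Rightarrow> real) \<Rightarrow> real) \<Rightarrow> ('a \<Rightarrow> real) set" where
  "completion \<Omega> nrm = {u. \<exists>\<phi>. approximates \<Omega> nrm \<phi> u}"

definition completion_norm ::
  "'a::euclidean_space set \<Rightarrow> (('a \<Rightarrow> real) \<Rightarrow> real) \<Rightarrow> ('a \<Rightarrow> real) \<Rightarrow> real" where
  "completion_norm \<Omega> nrm u =
     (THE l. \<exists>\<phi>. approximates \<Omega> nrm \<phi> u \<and> (\<lambda>n. nrm (\<phi> n)) \<longlonglongrightarrow> l)"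

section \<open>The function spaces\<close>

definition grad_norm :: "real \<Rightarrow> real \<Rightarrow> 'a::euclidean_space set \<Rightarrow> ('a \<Rightarrow> real) \<Rightarrow> real" where
  "grad_norm p \<mu> \<Omega> u =
     (LINT x|lebesgue_on \<Omega>. norm (grad u x) powr p / norm x powr \<mu>) powr (1 / p)"

definition weighted_norm :: "real \<Rightarrow> real \<Rightarrow> 'a::euclidean_space set \<Rightarrow> ('a \<Rightarrow> real) \<Rightarrow> real" where
  "weighted_norm r s \<Omega> u =
     (LINT x|lebesgue_on \<Omega>. \<bar>u x\<bar> powr r / norm x powr s) powr (1 / r)"

definition W1p :: "real \<Rightarrow> real \<Rightarrow> 'a::euclidean_space set \<Rightarrow> ('a \<Rightarrow> real) set" where
  "W1p p \<mu> \<Omega> = completion \<Omega> (grad_norm p \<mu> \<Omega>)"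

definition W1p_norm :: "real \<Rightarrow> real \<Rightarrow> 'a::euclidean_space set \<Rightarrow> ('a \<Rightarrow> real) \<Rightarrow> real" where
  "W1p_norm p \<mu> \<Omega> = completion_norm \<Omega> (grad_norm p \<mu> \<Omega>)"

definition weighted_Lr :: "real \<Rightarrow> real \<Rightarrow> 'a::euclidean_space set \<Rightarrow> ('a \<Rightarrow> real) set" where
  "weighted_Lr r s \<Omega> = completion \<Omega> (weighted_norm r s \<Omega>)"

definition weighted_Lr_norm :: "real \<Rightarrow> real \<Rightarrow> 'a::euclidean_space set \<Rightarrow> ('a \<Rightarrow> real) \<Rightarrow> real" where
  "weighted_Lr_norm r s \<Omega> = completion_norm \<Omega> (weighted_norm r s \<Omega>)"

definition Lp :: "real \<Rightarrow> 'a::euclidean_space set \<Rightarrow> ('a \<Rightarrow> real) set" where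
  "Lp p \<Omega> = {u \<in> borel_measurable (lebesgue_on \<Omega>).
               integrable (lebesgue_on \<Omega>) (\<lambda>x. \<bar>u x\<bar> powr p)}"

definition Lp_norm :: "real \<Rightarrow> 'a::euclidean_space set \<Rightarrow> ('a \<Rightarrow> real) \<Rightarrow> real" where
  "Lp_norm p \<Omega> u = (LINT x|lebesgue_on \<Omega>. \<bar>u x\<bar> powr p) powr (1 / p)"

section \<open>Compact embeddings\<close>

definition compact_embedding ::
  "('a \<Rightarrow> real) set \<Rightarrow> (('a \<Rightarrow> real) \<Rightarrow> real) \<Rightarrow> ('a \<Rightarrow> real) set \<Rightarrow> (('a \<Rightarrow> real) \<Rightarrow> real) \<Rightarrow> bool"
  where
  "compact_embedding X nX Y nY \<longleftrightarrow>
     X \<subseteq> Y \<and>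
     (\<exists>C. \<forall>u\<in>X. nY u \<le> C * nX u) \<and>
     (\<forall>u B. (\<forall>n::nat. u n \<in> X \<and> nX (u n) \<le> B) \<longrightarrow>
        (\<exists>k v. strict_mono k \<and> v \<in> Y \<and> (\<lambda>n. nY (\<lambda>x. u (k n) x - v x)) \<longlonglongrightarrow> 0))"

end

theory Submission
  imports Defs "HOL-Probability.Probability_Measure" "HOL-Complex_Analysis.Great_Picard"
    "HOL-Real_Asymp.Real_Asymp"
begin

text \<open>\<^bold>\<open>Why the embedding is compact.\<close> Write \<open>N\<close> for the dimension. Test functions are extended by
  zero, and the estimates are carried out on the whole space. Let \<open>u\<close> be bounded in both norms.

  \<^bold>\<open>One local inequality.\<close> Let \<open>avg t u x\<close> be the mean of \<open>u\<close> over the cell of \<open>x\<close> in the grid of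
  mesh \<open>t\<close>. The means at meshes \<open>t\<close> and \<open>t / 2\<close> differ at \<open>x\<close> by at most a constant times
  \<open>t powr (1 - N / p)\<close> times the \<open>L\<^sup>p\<close> norm of the gradient over a cube of edge \<open>2 * t\<close> around \<open>x\<close>. Such
  a bound also controls the \<open>L\<^sup>p\<close> norm of the difference by Fubini, hence every \<open>L\<^sup>r\<close> norm with
  \<open>r \<ge> p\<close>, with the factor \<open>t powr \<alpha>\<close> for \<open>\<alpha> = N / r + 1 - N / p\<close>. Since \<open>r\<close> is below the Sobolev
  exponent, \<open>\<alpha> > 0\<close>, and the geometric series over all halvings of \<open>t\<close> bounds \<open>u - avg t u\<close> in
  \<open>L\<^sup>r\<close> (lemma \<open>Lp_le_avg_error\<close>). This replaces the Sobolev, Gagliardo--Nirenberg and Rellich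
  theorems: with \<open>t\<close> chosen suitably it bounds norms, and with \<open>t\<close> small it says that \<open>u\<close> is, up to a
  small error, determined by countably many numbers.

  \<^bold>\<open>Summation over annuli.\<close> Both weights are essentially constant on \<open>\<rho> \<le> norm x < 2 * \<rho>\<close>. For
  small \<open>\<rho>\<close> take \<open>t\<close> proportional to \<open>\<rho>\<close>; Hardy's inequality controls \<open>u\<close> itself, and the weighted
  \<open>L\<^sup>r\<close> norm over the annulus is at most a multiple of a positive power of \<open>\<rho>\<close>, because \<open>r\<close> is below
  \<open>p * (N - s) / (N - \<mu> - p)\<close>. For large \<open>\<rho>\<close> the \<open>L\<^sup>p\<close> norm controls \<open>u\<close>. If \<open>\<mu> > 0\<close>, the \<open>L\<^sup>p\<close>
  norm of the gradient may be as large as \<open>\<rho> powr (\<mu> / p)\<close> there, and a mesh proportional to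
  \<open>\<rho> powr (- \<mu> / p)\<close> balances the two norms; the resulting bound decays in
  \<open>\<rho>\<close> precisely if \<open>s > N * \<mu> * (r - p) / p\<^sup>2\<close>. If \<open>\<mu> \<le> 0\<close>, a constant mesh does, and
  \<open>s > 0\<close> suffices. The annuli therefore sum up geometrically, uniformly on bounded sets
  (lemmas \<open>bound_near_origin\<close>, \<open>bound_near_infinity\<close>).

  \<^bold>\<open>Compactness.\<close> From a bounded sequence, a diagonal choice extracts a subsequence along which all
  means over all cells of all meshes \<open>1 / 2 ^ m\<close> converge. The tails near the origin and near infinity
  are uniformly small, and between them the local inequality with small mesh turns convergence of
  the means into the Cauchy property in \<open>L\<^sup>r\<close> (lemma \<open>compactness\<close>).

  \<^bold>\<open>The completions.\<close> Difference quotients show that the gradient norm is closable, so that the norm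
  of an element of \<open>W1p p \<mu> \<Omega>\<close> does not depend on the approximating sequence
  (lemmas \<open>grad_lower_semicontinuous\<close>, \<open>W1p_representative\<close>). A sequence of test functions that
  converges to \<open>u\<close> in the gradient norm need not converge in the weighted \<open>L\<^sup>r\<close> norm, since nothing
  controls it near infinity. Multiplication by a Gaussian repairs this, keeps the functions smooth and
  does not enlarge supports; letting the Gaussian widen shows that \<open>u\<close> lies in the completion
  \<open>weighted_Lr r s \<Omega>\<close> (lemma \<open>gaussian_approximation\<close>).\<close>

section \<open>Norm bounds in Lebesgue spaces\<close>

text \<open>Bounding a norm by a relation avoids roots of extended reals and includes the finiteness of the
  norm, which a real-valued norm would hide behind the default value of divergent integrals.\<close>

definition Lp_le :: "real \<Rightarrow> 'a measure \<Rightarrow> ('a \<Rightarrow> real) \<Rightarrow> real \<Rightarrow> bool" where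
  "Lp_le p M f F \<longleftrightarrow> f \<in> borel_measurable M \<and> 0 \<le> F \<and>
     (\<integral>\<^sup>+x. ennreal (\<bar>f x\<bar> powr p) \<partial>M) \<le> ennreal (F powr p)"

lemma Lp_leD:
  assumes "Lp_le p M f F"
  shows "f \<in> borel_measurable M" "0 \<le> F" "(\<integral>\<^sup>+x. ennreal (\<bar>f x\<bar> powr p) \<partial>M) \<le> ennreal (F powr p)"
  using assms by (auto simp: Lp_le_def)

lemma Lp_le_weaken: "Lp_le p M f F \<Longrightarrow> F \<le> G \<Longrightarrow> 0 \<le> p \<Longrightarrow> Lp_le p M f G"
  unfolding Lp_le_def
  by (elim conjE, intro conjI) (assumption, linarith, erule order_trans, intro ennreal_leI powr_mono2)

lemma Lp_le_mono:
  assumes "Lp_le p M g G" "f \<in> borel_measurable M" "AE x in M. \<bar>f x\<bar> \<le> \<bar>g x\<bar>" "0 \<le> p"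
  shows "Lp_le p M f G"
proof -
  have "(\<integral>\<^sup>+x. ennreal (\<bar>f x\<bar> powr p) \<partial>M) \<le> (\<integral>\<^sup>+x. ennreal (\<bar>g x\<bar> powr p) \<partial>M)"
    using assms(3) by (intro nn_integral_mono_AE) (auto intro!: ennreal_leI powr_mono2 assms(4) elim!: eventually_mono)
  then show ?thesis using assms(1,2) by (auto simp: Lp_le_def)
qed

lemma Lp_le_zero: "f \<in> borel_measurable M \<Longrightarrow> AE x in M. f x = 0 \<Longrightarrow> Lp_le p M f 0"
  unfolding Lp_le_def
  by (subst nn_integral_cong_AE[where v="\<lambda>_. 0"]) (auto elim!: eventually_mono)

lemma Lp_le_scale:
  assumes "Lp_le p M f F"
  shows "Lp_le p M (\<lambda>x. c * f x) (\<bar>c\<bar> * F)"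
proof -
  have [measurable]: "f \<in> borel_measurable M" using assms by (simp add: Lp_le_def)
  have "(\<integral>\<^sup>+x. ennreal (\<bar>c * f x\<bar> powr p) \<partial>M) = (\<integral>\<^sup>+x. ennreal (\<bar>c\<bar> powr p) * ennreal (\<bar>f x\<bar> powr p) \<partial>M)"
    by (intro nn_integral_cong) (simp add: abs_mult powr_mult ennreal_mult)
  also have "\<dots> = ennreal (\<bar>c\<bar> powr p) * (\<integral>\<^sup>+x. ennreal (\<bar>f x\<bar> powr p) \<partial>M)"
    by (intro nn_integral_cmult) simp
  also have "\<dots> \<le> ennreal (\<bar>c\<bar> powr p) * ennreal (F powr p)"
    using assms by (intro mult_left_mono) (auto simp: Lp_le_def)
  also have "\<dots> = ennreal ((\<bar>c\<bar> * F) powr p)"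
    using assms by (simp add: Lp_le_def powr_mult ennreal_mult)
  finally show ?thesis using assms by (auto simp: Lp_le_def)
qed

lemma Lp_le_minus_iff: "Lp_le p M (\<lambda>x. - f x) F \<longleftrightarrow> Lp_le p M f F"
  by (auto simp: Lp_le_def)

lemma Lp_le_minus_commute: "Lp_le p M (\<lambda>x. f x - g x) F \<longleftrightarrow> Lp_le p M (\<lambda>x. g x - f x) F"
  using Lp_le_minus_iff[of p M "\<lambda>x. f x - g x" F] by simp

lemma ennreal_le_limit:
  fixes a :: ennreal and b :: "nat \<Rightarrow> real"
  assumes "\<And>n. a \<le> ennreal (b n)" "b \<longlonglongrightarrow> c"
  shows "a \<le> ennreal c"
  by (rule LIMSEQ_le_const[OF tendsto_ennrealI[OF assms(2)]]) (use assms(1) in auto)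

lemma Lp_le_closed:
  assumes "\<And>e. e > 0 \<Longrightarrow> Lp_le p M f (F + e)" "0 < p"
  shows "Lp_le p M f F"
proof -
  have F: "0 \<le> F"
    using assms(1) by (meson Lp_leD(2) field_le_epsilon)
  have "(\<integral>\<^sup>+x. ennreal (\<bar>f x\<bar> powr p) \<partial>M) \<le> ennreal ((F + 0) powr p)"
  proof (rule ennreal_le_limit)
    show "(\<integral>\<^sup>+x. ennreal (\<bar>f x\<bar> powr p) \<partial>M) \<le> ennreal ((F + inverse (real (Suc n))) powr p)" for n
      using assms(1)[of "inverse (real (Suc n))"] by (simp add: Lp_le_def)
    show "(\<lambda>n. (F + inverse (real (Suc n))) powr p) \<longlonglongrightarrow> (F + 0) powr p"
      using F assms(2) by (intro tendsto_powr2 tendsto_add tendsto_const LIMSEQ_inverse_real_of_nat)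
         (auto intro!: always_eventually)
  qed
  with F assms(1)[of 1] show ?thesis by (simp add: Lp_le_def)
qed

lemma powr_convex_nonneg:
  fixes p t x y :: real
  assumes p: "1 \<le> p" and t: "0 \<le> t" "t \<le> 1" and xy: "0 \<le> x" "0 \<le> y"
  shows "(t * x + (1 - t) * y) powr p \<le> t * x powr p + (1 - t) * y powr p"
proof -
  have pow: "s powr p \<le> s" if "0 \<le> s" "s \<le> 1" for s :: real
    using that p powr_mono'[of 1 p s] by (cases "s = 0") auto
  consider "x = 0" | "y = 0" | "x > 0" "y > 0" using xy by linarith
  then show ?thesis
  proof cases
    case 1
    then show ?thesis using pow[of "1 - t"] t xy p
      by (simp add: powr_mult mult_right_mono)
  next
    case 2
    then show ?thesis using pow[of t] t xy p
      by (simp add: powr_mult mult_right_mono)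
  next
    case 3
    then show ?thesis
      using powr_convex[OF p] t by (auto simp: convex_on_alt)
  qed
qed

text \<open>Convexity of the power, with the weights \<open>F / (F + G)\<close> and \<open>G / (F + G)\<close> that make Minkowski's
  inequality below an equality in the extremal case.\<close>

lemma powr_add_le_weighted:
  fixes p a b F G :: real
  assumes p: "1 \<le> p" and "0 \<le> a" "0 \<le> b" and F: "0 < F" and G: "0 < G"
  shows "(a + b) powr p \<le> (F + G) powr (p - 1) * (F powr (1 - p) * a powr p + G powr (1 - p) * b powr p)"
proof -
  define t where "t = F / (F + G)"
  have t: "0 \<le> t" "t \<le> 1" "1 - t = G / (F + G)" using F G by (auto simp: t_def field_simps)
  have "(F + G) * t = F" "(F + G) * (1 - t) = G"
    unfolding t(3) using F G by (simp_all add: t_def)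
  then have eq: "(a + b) = (F + G) * (t * (a / F) + (1 - t) * (b / G))"
    unfolding distrib_left mult.assoc[symmetric] using F G by simp
  have "(a + b) powr p = (F + G) powr p * (t * (a / F) + (1 - t) * (b / G)) powr p"
    unfolding eq using F G t assms by (subst powr_mult) auto
  also have "\<dots> \<le> (F + G) powr p * (t * (a / F) powr p + (1 - t) * (b / G) powr p)"
    using assms t by (intro mult_left_mono powr_convex_nonneg) auto
  also have "\<dots> = (F + G) powr (p - 1) * (F * (a / F) powr p + G * (b / G) powr p)"
  proof -
    have 1: "(F + G) powr p = (F + G) powr (p - 1) * (F + G)" using F G by (simp add: powr_diff)
    have 2: "(F + G) * t = F" "(F + G) * (1 - t) = G"
      unfolding t(3) using F G by (simp_all add: t_def)
    have "(F + G) * (t * X + (1 - t) * Y) = F * X + G * Y" for X Y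
      unfolding distrib_left mult.assoc[symmetric] 2 ..
    then show ?thesis unfolding 1 mult.assoc by simp
  qed
  also have "\<dots> = (F + G) powr (p - 1) * (F powr (1 - p) * a powr p + G powr (1 - p) * b powr p)"
    using F G assms by (simp add: powr_diff powr_divide)
  finally show ?thesis .
qed

text \<open>Minkowski's inequality, by integrating the weighted convexity inequality. That inequality needs
  positive bounds, so both are first enlarged by \<open>e / 2\<close>.\<close>

lemma Lp_le_add:
  assumes f: "Lp_le p M f F" and g: "Lp_le p M g G" and p: "1 \<le> p"
  shows "Lp_le p M (\<lambda>x. f x + g x) (F + G)"
proof -
  note [measurable] = Lp_leD(1)[OF f] Lp_leD(1)[OF g]
  have strict: "Lp_le p M (\<lambda>x. f x + g x) (F' + G')"
    if F: "0 < F'" "Lp_le p M f F'" and G: "0 < G'" "Lp_le p M g G'" for F' G'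
  proof -
    let ?a = "(F' + G') powr (p - 1) * F' powr (1 - p)"
    let ?b = "(F' + G') powr (p - 1) * G' powr (1 - p)"
    have "(\<integral>\<^sup>+x. ennreal (\<bar>f x + g x\<bar> powr p) \<partial>M) \<le>
      (\<integral>\<^sup>+x. ennreal ?a * ennreal (\<bar>f x\<bar> powr p) + ennreal ?b * ennreal (\<bar>g x\<bar> powr p) \<partial>M)"
    proof (intro nn_integral_mono)
      fix x
      have "\<bar>f x + g x\<bar> powr p \<le> (\<bar>f x\<bar> + \<bar>g x\<bar>) powr p"
        using p by (intro powr_mono2) auto
      also have "\<dots> \<le> ?a * \<bar>f x\<bar> powr p + ?b * \<bar>g x\<bar> powr p"
        using powr_add_le_weighted[OF p, of "\<bar>f x\<bar>" "\<bar>g x\<bar>" F' G'] F G by (simp add: algebra_simps)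
      finally show "ennreal (\<bar>f x + g x\<bar> powr p) \<le> ennreal ?a * ennreal (\<bar>f x\<bar> powr p) + ennreal ?b * ennreal (\<bar>g x\<bar> powr p)"
        by (simp add: ennreal_mult[symmetric] ennreal_plus[symmetric] del: ennreal_plus)
    qed
    also have "\<dots> = ennreal ?a * (\<integral>\<^sup>+x. ennreal (\<bar>f x\<bar> powr p) \<partial>M) + ennreal ?b * (\<integral>\<^sup>+x. ennreal (\<bar>g x\<bar> powr p) \<partial>M)"
      by (simp add: nn_integral_add nn_integral_cmult)
    also have "\<dots> \<le> ennreal ?a * ennreal (F' powr p) + ennreal ?b * ennreal (G' powr p)"
      by (intro add_mono mult_left_mono Lp_leD(3) F G) auto
    also have "\<dots> = ennreal (?a * F' powr p + ?b * G' powr p)"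
      by (simp add: ennreal_mult[symmetric] ennreal_plus[symmetric] del: ennreal_plus)
    also have "?a * F' powr p + ?b * G' powr p = (F' + G') powr p"
    proof -
      have "F' powr (1 - p) * F' powr p = F'" "G' powr (1 - p) * G' powr p = G'"
        using F G by (simp_all add: powr_add[symmetric])
      then have "?a * F' powr p + ?b * G' powr p = (F' + G') powr (p - 1) * (F' + G')"
        unfolding mult.assoc distrib_left by simp
      also have "\<dots> = (F' + G') powr (p - 1) * (F' + G') powr 1" using F G by simp
      also have "\<dots> = (F' + G') powr p" using F G by (subst powr_add[symmetric]) simp
      finally show ?thesis .
    qed
    finally show ?thesis using F G by (auto simp: Lp_le_def)
  qed
  show ?thesis
  proof (rule Lp_le_closed)
    fix e :: real assume "e > 0"
    then have "Lp_le p M (\<lambda>x. f x + g x) ((F + e/2) + (G + e/2))"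
      using p f g by (intro strict Lp_le_weaken[OF f] Lp_le_weaken[OF g] add_nonneg_pos) (auto simp: Lp_le_def)
    then show "Lp_le p M (\<lambda>x. f x + g x) (F + G + e)" by (simp add: algebra_simps)
  qed (use p in auto)
qed

lemma Lp_le_diff:
  assumes f: "Lp_le p M f F" and g: "Lp_le p M g G" and p: "1 \<le> p"
  shows "Lp_le p M (\<lambda>x. f x - g x) (F + G)"
  using Lp_le_add[OF f _ p, of "\<lambda>x. - g x" G] g by (simp add: Lp_le_minus_iff)

lemma Lp_le_triangle:
  assumes "Lp_le p M (\<lambda>x. f x - g x) F" "Lp_le p M (\<lambda>x. g x - h x) G" "1 \<le> p"
  shows "Lp_le p M (\<lambda>x. f x - h x) (F + G)"
  using Lp_le_add[OF assms] by simp

lemma Lp_le_sum: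
  assumes "\<And>i. i \<in> I \<Longrightarrow> Lp_le p M (f i) (F i)" "1 \<le> p"
  shows "Lp_le p M (\<lambda>x. \<Sum>i\<in>I. f i x) (\<Sum>i\<in>I. F i)"
  using assms(1)
proof (induction I rule: infinite_finite_induct)
  case (insert i I)
  then show ?case by (auto intro!: Lp_le_add assms(2))
qed (auto intro!: Lp_le_zero)

text \<open>Fatou's lemma, the way in which every bound below passes from test functions to limits.\<close>

lemma Lp_le_Fatou:
  assumes f: "\<And>n. Lp_le p M (f n) (F n)" and F: "F \<longlonglongrightarrow> G"
    and lim: "AE x in M. (\<lambda>n. f n x) \<longlonglongrightarrow> g x" and g: "g \<in> borel_measurable M" and p: "0 < p"
  shows "Lp_le p M g G"
proof -
  note [measurable] = Lp_leD(1)[OF f]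
  have "(\<integral>\<^sup>+x. ennreal (\<bar>g x\<bar> powr p) \<partial>M) = (\<integral>\<^sup>+x. liminf (\<lambda>n. ennreal (\<bar>f n x\<bar> powr p)) \<partial>M)"
  proof (intro nn_integral_cong_AE, use lim in eventually_elim)
    case (elim x)
    have "(\<lambda>n. ennreal (\<bar>f n x\<bar> powr p)) \<longlonglongrightarrow> ennreal (\<bar>g x\<bar> powr p)"
      using elim p by (intro tendsto_ennrealI tendsto_powr2 tendsto_rabs) auto
    then show ?case by (intro lim_imp_Liminf[symmetric]) auto
  qed
  also have "\<dots> \<le> liminf (\<lambda>n. \<integral>\<^sup>+x. ennreal (\<bar>f n x\<bar> powr p) \<partial>M)"
    by (intro nn_integral_liminf) simp
  also have "\<dots> \<le> liminf (\<lambda>n. ennreal (F n powr p))"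
    by (intro Liminf_mono always_eventually allI Lp_leD(3)[OF f])
  also have "\<dots> = ennreal (G powr p)"
  proof (rule lim_imp_Liminf)
    show "(\<lambda>n. ennreal (F n powr p)) \<longlonglongrightarrow> ennreal (G powr p)"
      using Lp_leD(2)[OF f] p F by (intro tendsto_ennrealI tendsto_powr2) auto
  qed simp
  finally show ?thesis
    using g LIMSEQ_le_const[OF F] Lp_leD(2)[OF f] by (auto simp: Lp_le_def)
qed

text \<open>The sum of the \<open>p\<close>-th powers of the norms is finite, hence the series of the \<open>p\<close>-th powers of the
  functions converges almost everywhere.\<close>

lemma Lp_le_AE_tendsto_zero:
  assumes f: "\<And>n. Lp_le p M (f n) ((1/2)^n)" and p: "1 \<le> p"
  shows "AE x in M. (\<lambda>n. f n x) \<longlonglongrightarrow> 0"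
proof -
  note [measurable] = Lp_leD(1)[OF f]
  have le: "((1/2)^n) powr p \<le> (1/2::real)^n" for n
    using powr_mono'[of 1 p "(1/2)^n"] p by (simp add: power_le_one)
  have "(\<integral>\<^sup>+x. (\<Sum>n. ennreal (\<bar>f n x\<bar> powr p)) \<partial>M) = (\<Sum>n. \<integral>\<^sup>+x. ennreal (\<bar>f n x\<bar> powr p) \<partial>M)"
    by (intro nn_integral_suminf) simp
  also have "\<dots> \<le> (\<Sum>n. ennreal ((1/2)^n))"
    by (intro suminf_le allI) (auto intro!: order_trans[OF Lp_leD(3)[OF f] ennreal_leI] le)
  also have "\<dots> = ennreal (\<Sum>n. (1/2)^n)"
    by (intro suminf_ennreal_eq summable_sums) (auto intro!: summable_geometric)
  also have "\<dots> < \<infinity>" by simp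
  finally have "AE x in M. (\<Sum>n. ennreal (\<bar>f n x\<bar> powr p)) \<noteq> \<infinity>"
    by (intro nn_integral_PInf_AE) auto
  then show ?thesis
  proof eventually_elim
    case (elim x)
    then have "summable (\<lambda>n. \<bar>f n x\<bar> powr p)"
      by (intro summable_suminf_not_top) auto
    then have "(\<lambda>n. \<bar>f n x\<bar> powr p) \<longlonglongrightarrow> 0" by (rule summable_LIMSEQ_zero)
    then have "(\<lambda>n. (\<bar>f n x\<bar> powr p) powr (1/p)) \<longlonglongrightarrow> 0 powr (1/p)"
      using p by (intro tendsto_powr2) auto
    then show ?case using p by (simp add: powr_powr tendsto_rabs_zero_iff)
  qed
qed

lemma Lp_le_fast_AE_tendsto:
  assumes "\<And>n. Lp_le p M (\<lambda>x. f n x - g x) ((1/2)^n)" "1 \<le> p"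
  shows "AE x in M. (\<lambda>n. f n x) \<longlonglongrightarrow> g x"
  using Lp_le_AE_tendsto_zero[OF assms] by eventually_elim (simp add: LIM_zero_iff)

text \<open>Riesz--Fischer: the weighted Lebesgue spaces are complete, and a Cauchy sequence has an
  almost everywhere convergent subsequence. The factor \<open>(1/4)^n\<close> leaves room for the factor
  \<open>2^n\<close> that turns decay of the increments into summability.\<close>

lemma Lp_le_complete:
  assumes cau: "\<And>e. e > 0 \<Longrightarrow> \<exists>N::nat. \<forall>m\<ge>N. \<forall>n\<ge>N. Lp_le p M (\<lambda>x. f m x - f n x) e"
    and f[measurable]: "\<And>n. f n \<in> borel_measurable M" and p: "1 \<le> p"
  obtains g k where "g \<in> borel_measurable M" "strict_mono k" "AE x in M. (\<lambda>n. f (k n) x) \<longlonglongrightarrow> g x"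
    "\<And>e. e > 0 \<Longrightarrow> \<exists>N. \<forall>n\<ge>N. Lp_le p M (\<lambda>x. f n x - g x) e"
proof -
  have "\<forall>i. \<exists>N::nat. \<forall>m\<ge>N. \<forall>n\<ge>N. Lp_le p M (\<lambda>x. f m x - f n x) ((1/4)^i)"
    using cau by simp
  then obtain N where N: "\<And>i m n. m \<ge> N i \<Longrightarrow> n \<ge> N i \<Longrightarrow> Lp_le p M (\<lambda>x. f m x - f n x) ((1/4)^i)"
    by metis
  define k where "k = rec_nat (N 0) (\<lambda>i l. max (Suc l) (N (Suc i)))"
  have k_Suc: "k (Suc i) = max (Suc (k i)) (N (Suc i))" for i by (simp add: k_def)
  have k0: "k 0 = N 0" by (simp add: k_def)
  have mono: "strict_mono k" by (simp add: strict_mono_Suc_iff k_Suc less_max_iff_disj)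
  have kN: "k i \<ge> N i" for i by (cases i) (auto simp: k_Suc k0)
  have step: "Lp_le p M (\<lambda>x. 2 ^ i * (f (k (Suc i)) x - f (k i) x)) ((1/2)^i)" for i
  proof -
    have "Lp_le p M (\<lambda>x. f (k (Suc i)) x - f (k i) x) ((1/4)^i)"
      using kN[of i] strict_monoD[OF mono, of i "Suc i"] by (intro N) auto
    moreover have "(2::real) ^ i * (1/4)^i = (2 * (1/4))^i" by (rule power_mult_distrib[symmetric])
    ultimately show ?thesis
      using Lp_le_scale[of p M "\<lambda>x. f (k (Suc i)) x - f (k i) x" "(1/4)^i" "2^i"] by simp
  qed
  have "AE x in M. (\<lambda>i. 2 ^ i * (f (k (Suc i)) x - f (k i) x)) \<longlonglongrightarrow> 0"
    by (rule Lp_le_AE_tendsto_zero[OF step p])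
  then have "AE x in M. convergent (\<lambda>n. f (k n) x)"
  proof eventually_elim
    case (elim x)
    then have "Bseq (\<lambda>i. 2 ^ i * (f (k (Suc i)) x - f (k i) x))"
      by (intro convergent_imp_Bseq convergentI)
    then obtain K where K: "\<And>n. \<bar>2 ^ n * (f (k (Suc n)) x - f (k n) x)\<bar> \<le> K"
      unfolding Bseq_def real_norm_def by blast
    have "summable (\<lambda>n. f (k (Suc n)) x - f (k n) x)"
    proof (rule summable_comparison_test[OF _ summable_mult[OF summable_geometric[of "1/2"], of K]])
      show "\<exists>N. \<forall>n\<ge>N. norm (f (k (Suc n)) x - f (k n) x) \<le> K * (1/2)^n"
      proof (intro exI allI impI)
        fix n
        have "2 ^ n * \<bar>f (k (Suc n)) x - f (k n) x\<bar> \<le> K" using K[of n] by (simp add: abs_mult)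
        then show "norm (f (k (Suc n)) x - f (k n) x) \<le> K * (1/2)^n"
          by (simp add: power_divide pos_le_divide_eq mult.commute)
      qed
    qed simp
    then have "convergent (\<lambda>n. f (k n) x - f (k 0) x)"
      by (simp add: summable_iff_convergent sum_lessThan_telescope[of "\<lambda>n. f (k n) x"])
    then show ?case by (simp add: convergent_diff_const_right_iff)
  qed
  then have lim: "AE x in M. (\<lambda>n. f (k n) x) \<longlonglongrightarrow> lim (\<lambda>n. f (k n) x)"
    by eventually_elim (simp add: convergent_LIMSEQ_iff)
  define g where "g x = lim (\<lambda>n. f (k n) x)" for x
  have g[measurable]: "g \<in> borel_measurable M" unfolding g_def by measurable
  show thesis
  proof
    show "g \<in> borel_measurable M" "strict_mono k" by fact+
    show "AE x in M. (\<lambda>n. f (k n) x) \<longlonglongrightarrow> g x" using lim by (simp add: g_def)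
    fix e :: real assume "e > 0"
    from cau[OF this] obtain N' where N': "\<And>m n. m \<ge> N' \<Longrightarrow> n \<ge> N' \<Longrightarrow> Lp_le p M (\<lambda>x. f m x - f n x) e" by blast
    have "Lp_le p M (\<lambda>x. f n x - g x) e" if "n \<ge> N'" for n
    proof (rule Lp_le_Fatou[where F="\<lambda>_. e" and f="\<lambda>m x. f n x - f (k (m + N')) x"])
      show "Lp_le p M (\<lambda>x. f n x - f (k (m + N')) x) e" for m
        using that seq_suble[OF mono, of "m + N'"] by (intro N') linarith+
      show "AE x in M. (\<lambda>m. f n x - f (k (m + N')) x) \<longlonglongrightarrow> f n x - g x"
        using lim unfolding g_def
        by eventually_elim (rule tendsto_diff[OF tendsto_const LIMSEQ_ignore_initial_segment])
    qed (use p in auto)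
    then show "\<exists>N. \<forall>n\<ge>N. Lp_le p M (\<lambda>x. f n x - g x) e" by blast
  qed
qed

lemma (in prob_space) powr_jensen:
  fixes g :: "'a \<Rightarrow> real"
  assumes g: "integrable M g" and p: "1 \<le> p"
  shows "ennreal (\<bar>\<integral>x. g x \<partial>M\<bar> powr p) \<le> (\<integral>\<^sup>+x. ennreal (\<bar>g x\<bar> powr p) \<partial>M)"
proof (cases "(\<integral>\<^sup>+x. ennreal (\<bar>g x\<bar> powr p) \<partial>M) = \<infinity>")
  case False
  note [measurable] = borel_measurable_integrable[OF g]
  have int: "integrable M (\<lambda>x. \<bar>g x\<bar> powr p)"
    using False by (intro integrableI_nonneg) (auto simp: top.not_eq_extremum)
  have "convex_on UNIV (\<lambda>x::real. \<bar>x\<bar> powr p)"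
  proof (intro convex_onI)
    fix t x y :: real assume t: "0 < t" "t < 1"
    have "\<bar>(1 - t) *\<^sub>R x + t *\<^sub>R y\<bar> powr p \<le> (t * \<bar>y\<bar> + (1 - t) * \<bar>x\<bar>) powr p"
      using t p abs_triangle_ineq[of "(1-t)*x" "t*y"] by (intro powr_mono2) (auto simp: abs_mult)
    also have "\<dots> \<le> t * \<bar>y\<bar> powr p + (1 - t) * \<bar>x\<bar> powr p"
      using t p by (intro powr_convex_nonneg) auto
    finally show "\<bar>(1 - t) *\<^sub>R x + t *\<^sub>R y\<bar> powr p \<le> (1 - t) * \<bar>x\<bar> powr p + t * \<bar>y\<bar> powr p" by simp
  qed simp
  then have "\<bar>\<integral>x. g x \<partial>M\<bar> powr p \<le> (\<integral>x. \<bar>g x\<bar> powr p \<partial>M)"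
    using jensens_inequality[OF g, of UNIV 0 0 "\<lambda>x. \<bar>x\<bar> powr p"] int by simp
  then show ?thesis by (subst nn_integral_eq_integral[OF int]) (auto intro!: ennreal_leI)
qed simp

section \<open>Power weights, segments and scaling\<close>

text \<open>At the origin \<open>powr\<close> returns \<open>0\<close> for every exponent, so the weight vanishes there even for
  \<open>q \<le> 0\<close>; a single point does not matter.\<close>

definition pow_lborel :: "real \<Rightarrow> 'a::euclidean_space measure" where
  "pow_lborel q = density lborel (\<lambda>x. ennreal (norm x powr (- q)))"

lemma sets_pow_lborel[simp, measurable_cong]: "sets (pow_lborel q) = sets borel"
  and space_pow_lborel[simp]: "space (pow_lborel q) = UNIV"
  by (simp_all add: pow_lborel_def)

lemma nn_integral_pow_lborel:
  "f \<in> borel_measurable borel \<Longrightarrow> (\<integral>\<^sup>+x. f x \<partial>pow_lborel q) = (\<integral>\<^sup>+x. ennreal (norm x powr (- q)) * f x \<partial>lborel)"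
  unfolding pow_lborel_def by (subst nn_integral_density) auto

lemma AE_pow_lborel: "AE x in lborel. P x \<Longrightarrow> AE x in pow_lborel q. P x"
  unfolding pow_lborel_def by (subst AE_density) (auto elim!: eventually_mono)

lemma AE_pow_lborel_nonzero: "AE x in pow_lborel q. x \<noteq> 0"
  by (intro AE_pow_lborel AE_lborel_singleton)

lemma borel_measurable_pow_lborel: "borel_measurable (pow_lborel q) = borel_measurable borel"
  by (intro measurable_cong_sets) auto

text \<open>For type \<^typ>\<open>real\<close> this is Lebesgue measure on the unit interval, used to parametrise segments; in
  general it is a probability measure over which Jensen's inequality turns means into \<open>p\<close>-th powers.\<close>

definition unit_cube :: "'a::euclidean_space measure" where
  "unit_cube = density lborel (\<lambda>x. ennreal (indicator (cbox 0 One) x))"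

lemma sets_unit_cube[simp, measurable_cong]: "sets unit_cube = sets borel"
  and space_unit_cube[simp]: "space unit_cube = UNIV"
  by (simp_all add: unit_cube_def)

lemma nn_integral_unit_cube:
  "f \<in> borel_measurable borel \<Longrightarrow> (\<integral>\<^sup>+x. f x \<partial>unit_cube) = (\<integral>\<^sup>+x. ennreal (indicator (cbox 0 One) x) * f x \<partial>lborel)"
  unfolding unit_cube_def by (subst nn_integral_density) auto

lemma AE_unit_cube: "AE x in unit_cube. x \<in> cbox 0 One"
  unfolding unit_cube_def by (subst AE_density) (auto simp: indicator_def)

interpretation unit_cube: prob_space "unit_cube :: 'a::euclidean_space measure"
proof
  have "emeasure (unit_cube :: 'a measure) (space unit_cube) = emeasure lborel (cbox 0 One :: 'a set)"
    unfolding unit_cube_def by (subst emeasure_density) (auto simp: nn_integral_indicator ennreal_indicator)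
  also have "\<dots> = 1" by (subst emeasure_lborel_cbox) (auto simp: inner_sum_left_Basis)
  finally show "emeasure (unit_cube :: 'a measure) (space unit_cube) = 1" .
qed

lemma integrable_unit_cube_continuous:
  fixes f :: "'a::euclidean_space \<Rightarrow> real"
  assumes "continuous_on UNIV f"
  shows "integrable unit_cube f"
proof -
  have "set_integrable lborel (cbox 0 One) f"
    by (rule borel_integrable_compact[OF compact_cbox, unfolded set_integrable_def[symmetric]])
       (use assms continuous_on_subset in blast)
  then show ?thesis
    unfolding unit_cube_def set_integrable_def using borel_measurable_continuous_onI[OF assms]
    by (subst integrable_real_density) (auto simp: indicator_def)
qed

definition C1 :: "('a::euclidean_space \<Rightarrow> real) \<Rightarrow> bool" where
  "C1 f \<longleftrightarrow> (\<forall>x. GDERIV f x :> grad f x) \<and> continuous_on UNIV (grad f)"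

lemma GDERIV_unique: "GDERIV f x :> D \<Longrightarrow> GDERIV f x :> E \<Longrightarrow> D = E"
  unfolding gderiv_def by (metis has_derivative_unique inner_commute vector_eq_ldot)

lemma grad_eqI: "GDERIV f x :> D \<Longrightarrow> grad f x = D"
  unfolding grad_def using GDERIV_unique by blast

lemma C1I:
  assumes "\<And>x. GDERIV f x :> D x" "continuous_on UNIV D"
  shows "C1 f" "grad f = D"
  using assms grad_eqI[OF assms(1)] by (auto simp: C1_def fun_eq_iff cong: continuous_on_cong)

lemma C1_diff:
  assumes "C1 f" "C1 g"
  shows "C1 (\<lambda>x. f x - g x)" "grad (\<lambda>x. f x - g x) = (\<lambda>x. grad f x - grad g x)"
proof -
  have "\<And>x. GDERIV (\<lambda>x. f x - g x) x :> grad f x - grad g x"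
    using assms by (intro GDERIV_diff) (auto simp: C1_def)
  moreover have "continuous_on UNIV (\<lambda>x. grad f x - grad g x)"
    using assms by (intro continuous_on_diff) (auto simp: C1_def)
  ultimately show "C1 (\<lambda>x. f x - g x)" "grad (\<lambda>x. f x - g x) = (\<lambda>x. grad f x - grad g x)"
    by (rule C1I)+
qed

lemma C1_has_derivative: "C1 f \<Longrightarrow> (f has_derivative (\<lambda>h. h \<bullet> grad f x)) (at x)"
  by (auto simp: C1_def gderiv_def)

lemma C1_continuous: "C1 f \<Longrightarrow> continuous_on UNIV f"
  by (meson C1_has_derivative continuous_at_imp_continuous_on has_derivative_continuous)

lemma C1_measurable: "C1 f \<Longrightarrow> f \<in> borel_measurable borel"
  by (rule borel_measurable_continuous_onI[OF C1_continuous])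

lemma C1_grad_measurable: "C1 f \<Longrightarrow> grad f \<in> borel_measurable borel"
  by (rule borel_measurable_continuous_onI) (simp add: C1_def)

text \<open>Fundamental theorem of calculus along the segment, followed by Jensen's inequality. Hardy's
  inequality, closability and the estimate on cubes all come from integrating this over families
  of segments.\<close>

lemma segment_powr_le:
  fixes f :: "'a::euclidean_space \<Rightarrow> real"
  assumes f: "C1 f" and p: "1 \<le> p"
  shows "ennreal (\<bar>f b - f a\<bar> powr p) \<le>
    ennreal (norm (b - a) powr p) * (\<integral>\<^sup>+t. ennreal (norm (grad f (a + t *\<^sub>R (b - a))) powr p) \<partial>(unit_cube :: real measure))"
proof -
  define h where "h t = (b - a) \<bullet> grad f (a + t *\<^sub>R (b - a))" for t :: real
  have cg: "continuous_on UNIV (\<lambda>t::real. grad f (a + t *\<^sub>R (b - a)))"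
  proof (rule continuous_on_compose2[of UNIV "grad f"])
    show "continuous_on UNIV (grad f)" using f by (simp add: C1_def)
    show "continuous_on UNIV (\<lambda>t::real. a + t *\<^sub>R (b - a))" by (intro continuous_intros)
  qed simp
  then have cont: "continuous_on UNIV h"
    unfolding h_def by (intro continuous_on_inner continuous_on_const)
  have [measurable]: "(\<lambda>t::real. grad f (a + t *\<^sub>R (b - a))) \<in> borel_measurable borel"
    by (intro borel_measurable_continuous_onI cg)
  have "(\<integral>t. indicator {0..1} t *\<^sub>R h t \<partial>lborel) = f (a + 1 *\<^sub>R (b - a)) - f (a + 0 *\<^sub>R (b - a))"
  proof (rule integral_FTC_Icc)
    fix t :: real
    have "((\<lambda>t. f (a + t *\<^sub>R (b - a))) has_derivative (\<lambda>s. (s *\<^sub>R (b - a)) \<bullet> grad f (a + t *\<^sub>R (b - a)))) (at t within {0..1})"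
      by (rule has_derivative_compose[OF _ C1_has_derivative[OF f]]) (auto intro!: derivative_eq_intros)
    then show "((\<lambda>t. f (a + t *\<^sub>R (b - a))) has_vector_derivative h t) (at t within {0..1})"
      by (simp add: has_vector_derivative_def h_def)
  qed (use cont continuous_on_subset in auto)
  then have "f b - f a = (\<integral>t. h t \<partial>unit_cube)"
    unfolding unit_cube_def using borel_measurable_continuous_onI[OF cont]
    by (subst integral_density) (auto simp: indicator_def)
  then have "ennreal (\<bar>f b - f a\<bar> powr p) \<le> (\<integral>\<^sup>+t. ennreal (\<bar>h t\<bar> powr p) \<partial>unit_cube)"
    using unit_cube.powr_jensen[OF integrable_unit_cube_continuous[OF cont] p] by simp
  also have "\<dots> \<le> (\<integral>\<^sup>+t. ennreal (norm (b - a) powr p) * ennreal (norm (grad f (a + t *\<^sub>R (b - a))) powr p) \<partial>(unit_cube::real measure))"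
  proof (intro nn_integral_mono)
    fix t
    have "\<bar>h t\<bar> powr p \<le> (norm (b - a) * norm (grad f (a + t *\<^sub>R (b - a)))) powr p"
      unfolding h_def using p by (intro powr_mono2 Cauchy_Schwarz_ineq2) auto
    then show "ennreal (\<bar>h t\<bar> powr p) \<le> ennreal (norm (b - a) powr p) * ennreal (norm (grad f (a + t *\<^sub>R (b - a))) powr p)"
      by (simp add: powr_mult ennreal_mult[symmetric])
  qed
  also have "\<dots> = ennreal (norm (b - a) powr p) * (\<integral>\<^sup>+t. ennreal (norm (grad f (a + t *\<^sub>R (b - a))) powr p) \<partial>(unit_cube :: real measure))"
    by (intro nn_integral_cmult) measurable
  finally show ?thesis .
qed

lemma nn_integral_lborel_affine:
  fixes F :: "'a::euclidean_space \<Rightarrow> ennreal" and c :: real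
  assumes [measurable]: "F \<in> borel_measurable borel" and c: "0 < c"
  shows "(\<integral>\<^sup>+x. F (t + c *\<^sub>R x) \<partial>lborel) = ennreal (c powr (- real DIM('a))) * (\<integral>\<^sup>+x. F x \<partial>lborel)"
proof -
  have "(\<integral>\<^sup>+x. F x \<partial>lborel) = (\<integral>\<^sup>+x. F x \<partial>density (distr lborel borel (\<lambda>x. t + c *\<^sub>R x)) (\<lambda>_. \<bar>c\<bar>^DIM('a)))"
    using lborel_affine[of c t] c by simp
  also have "\<dots> = ennreal (c ^ DIM('a)) * (\<integral>\<^sup>+x. F (t + c *\<^sub>R x) \<partial>lborel)"
    using c by (simp add: nn_integral_density nn_integral_distr nn_integral_cmult)
  finally have "ennreal (c powr (- real DIM('a))) * (\<integral>\<^sup>+x. F x \<partial>lborel)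
     = ennreal (c powr (- real DIM('a)) * c ^ DIM('a)) * (\<integral>\<^sup>+x. F (t + c *\<^sub>R x) \<partial>lborel)"
    using c by (simp add: ennreal_mult mult.assoc)
  also have "c powr (- real DIM('a)) * c ^ DIM('a) = 1"
    using c by (simp add: powr_minus powr_realpow field_simps)
  finally show ?thesis by simp
qed

lemma nn_integral_pow_lborel_scale:
  fixes F :: "'a::euclidean_space \<Rightarrow> ennreal"
  assumes [measurable]: "F \<in> borel_measurable borel" and c: "0 < c"
  shows "(\<integral>\<^sup>+x. F (c *\<^sub>R x) \<partial>pow_lborel q) = ennreal (c powr (q - real DIM('a))) * (\<integral>\<^sup>+x. F x \<partial>pow_lborel q)"
proof -
  have "(\<integral>\<^sup>+x. F (c *\<^sub>R x) \<partial>pow_lborel q) = (\<integral>\<^sup>+x. ennreal (norm x powr (- q)) * F (c *\<^sub>R x) \<partial>lborel)"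
    by (intro nn_integral_pow_lborel) measurable
  also have "\<dots> = (\<integral>\<^sup>+x. (ennreal (c powr q) * (ennreal (norm (c *\<^sub>R x) powr (- q)) * F (c *\<^sub>R x))) \<partial>lborel)"
  proof (intro nn_integral_cong)
    fix x :: 'a
    have "norm x powr (- q) = c powr q * norm (c *\<^sub>R x) powr (- q)"
      using c by (simp add: powr_mult mult.assoc[symmetric] powr_add[symmetric])
    then show "ennreal (norm x powr (- q)) * F (c *\<^sub>R x) = ennreal (c powr q) * (ennreal (norm (c *\<^sub>R x) powr (- q)) * F (c *\<^sub>R x))"
      by (simp add: ennreal_mult mult.assoc)
  qed
  also have "\<dots> = ennreal (c powr q) * (\<integral>\<^sup>+x. ennreal (norm (c *\<^sub>R x) powr (- q)) * F (c *\<^sub>R x) \<partial>lborel)"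
    by (intro nn_integral_cmult) measurable
  also have "\<dots> = ennreal (c powr q) * (ennreal (c powr (- real DIM('a))) * (\<integral>\<^sup>+x. ennreal (norm x powr (- q)) * F x \<partial>lborel))"
    using nn_integral_lborel_affine[of "\<lambda>x. ennreal (norm x powr (- q)) * F x" c 0] c by simp
  also have "\<dots> = ennreal (c powr (q - real DIM('a))) * (\<integral>\<^sup>+x. F x \<partial>pow_lborel q)"
    by (simp add: nn_integral_pow_lborel mult.assoc[symmetric] ennreal_mult[symmetric] powr_add[symmetric])
  finally show ?thesis .
qed

lemma Lp_le_pow_lborel_scale:
  fixes f :: "'a::euclidean_space \<Rightarrow> real"
  assumes f: "Lp_le p (pow_lborel q) f F" and c: "0 < c" and p: "0 < p"
  shows "Lp_le p (pow_lborel q) (\<lambda>x. f (c *\<^sub>R x)) (c powr ((q - real DIM('a)) / p) * F)"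
proof -
  have [measurable]: "f \<in> borel_measurable borel" using Lp_leD(1)[OF f] by (simp add: borel_measurable_pow_lborel)
  have "(\<integral>\<^sup>+x. ennreal (\<bar>f (c *\<^sub>R x)\<bar> powr p) \<partial>pow_lborel q) \<le> ennreal (c powr (q - real DIM('a))) * ennreal (F powr p)"
    using nn_integral_pow_lborel_scale[of "\<lambda>x. ennreal (\<bar>f x\<bar> powr p)" c q] c Lp_leD(3)[OF f]
    by (simp add: mult_left_mono)
  also have "\<dots> = ennreal ((c powr ((q - real DIM('a)) / p) * F) powr p)"
    using Lp_leD(2)[OF f] p by (simp add: powr_mult powr_powr ennreal_mult)
  finally show ?thesis using Lp_leD(2)[OF f] by (auto simp: Lp_le_def)
qed

text \<open>The dilation by \<open>2\<close> maps each dyadic shell to the next one and multiplies its measure by the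
  factor \<open>2 powr (N - q) > 1\<close>, so the shells sum up like a geometric series.\<close>

lemma emeasure_pow_lborel_ball_finite:
  fixes q R :: real
  assumes q: "q < real DIM('a::euclidean_space)" and R: "0 < R"
  shows "emeasure (pow_lborel q :: 'a measure) (ball 0 R) < \<infinity>"
proof -
  define I where "I n = (\<integral>\<^sup>+x. indicator {x. R / 2 ^ n \<le> norm x \<and> norm x < R} x \<partial>(pow_lborel q :: 'a measure))" for n :: nat
  define \<theta> where "\<theta> = 2 powr (q - real DIM('a))"
  have \<theta>: "0 < \<theta>" "\<theta> < 1" using q by (auto simp: \<theta>_def powr_less_one)
  define c where "c = max (R powr (-q)) ((R/2) powr (-q)) * measure lborel (ball (0::'a) R)"
  have c0: "0 \<le> c" unfolding c_def by (intro mult_nonneg_nonneg) (auto simp: le_max_iff_disj)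
  have "I 1 \<le> (\<integral>\<^sup>+x. ennreal (max (R powr (-q)) ((R/2) powr (-q))) * indicator (ball (0::'a) R) x \<partial>lborel)"
    unfolding I_def
  proof (subst nn_integral_pow_lborel, simp, intro nn_integral_mono)
    fix x :: 'a
    have "norm x powr (-q) \<le> max (R powr (-q)) ((R/2) powr (-q))" if "R / 2 \<le> norm x" "norm x < R"
    proof (cases "q \<ge> 0")
      case True
      then have "norm x powr (-q) \<le> (R/2) powr (-q)"
        using that R by (intro powr_mono2') auto
      then show ?thesis by simp
    next
      case False
      then have "norm x powr (-q) \<le> R powr (-q)"
        using that R by (intro powr_mono2) auto
      then show ?thesis by simp
    qed
    then show "ennreal (norm x powr (-q)) * indicator {x. R / 2 ^ 1 \<le> norm x \<and> norm x < R} x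
      \<le> ennreal (max (R powr (-q)) ((R/2) powr (-q))) * indicator (ball (0::'a) R) x"
      by (auto simp: indicator_def intro!: ennreal_leI)
  qed
  also have "\<dots> = ennreal c"
    unfolding c_def using emeasure_lborel_ball_finite[of "0::'a" R]
    by (subst nn_integral_cmult_indicator)
      (auto simp: emeasure_eq_ennreal_measure ennreal_mult top.not_eq_extremum le_max_iff_disj)
  finally have I1: "I 1 \<le> ennreal c" .
  have bound: "I n \<le> ennreal (c / (1 - \<theta>))" for n
  proof (induction n)
    case 0
    have empty: "{x::'a. R / 2 ^ 0 \<le> norm x \<and> norm x < R} = {}" by auto
    have "I 0 = 0" unfolding I_def empty by simp
    then show ?case by simp
  next
    case (Suc n)
    have "I (Suc n) \<le> (\<integral>\<^sup>+x. indicator {x. R / 2 ^ 1 \<le> norm x \<and> norm x < R} x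
       + indicator {x. R / 2 ^ n \<le> norm x \<and> norm x < R} (2 *\<^sub>R x) \<partial>(pow_lborel q :: 'a measure))"
      unfolding I_def by (intro nn_integral_mono) (auto simp: indicator_def field_simps)
    also have "\<dots> = I 1 + (\<integral>\<^sup>+x. indicator {x. R / 2 ^ n \<le> norm x \<and> norm x < R} (2 *\<^sub>R x) \<partial>(pow_lborel q :: 'a measure))"
      unfolding I_def by (intro nn_integral_add) measurable
    also have "(\<integral>\<^sup>+x. indicator {x. R / 2 ^ n \<le> norm x \<and> norm x < R} (2 *\<^sub>R x) \<partial>(pow_lborel q :: 'a measure)) = ennreal \<theta> * I n"
      unfolding I_def \<theta>_def by (rule nn_integral_pow_lborel_scale) auto
    also have "I 1 + ennreal \<theta> * I n \<le> ennreal c + ennreal \<theta> * ennreal (c / (1 - \<theta>))"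
      by (intro add_mono mult_left_mono I1 Suc) auto
    also have "\<dots> = ennreal (c + \<theta> * (c / (1 - \<theta>)))"
      using \<theta> c0 by (simp add: ennreal_mult[symmetric] ennreal_plus[symmetric] del: ennreal_plus)
    also have "c + \<theta> * (c / (1 - \<theta>)) = c / (1 - \<theta>)" using \<theta> by (simp add: field_simps)
    finally show ?case .
  qed
  have "emeasure (pow_lborel q :: 'a measure) (ball 0 R) = emeasure (pow_lborel q :: 'a measure) (\<Union>n. {x. R / 2 ^ n \<le> norm x \<and> norm x < R})"
  proof (rule emeasure_eq_AE)
    show "AE x in pow_lborel q. (x \<in> ball 0 R) = (x \<in> (\<Union>n. {x::'a. R / 2 ^ n \<le> norm x \<and> norm x < R}))"
      using AE_pow_lborel_nonzero
    proof eventually_elim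
      case (elim x)
      have "(\<lambda>n. R / 2 ^ n) \<longlonglongrightarrow> 0" by real_asymp
      then have "\<forall>\<^sub>F n in sequentially. R / 2 ^ n < norm x"
        using elim by (intro order_tendstoD) auto
      then obtain n where "R / 2 ^ n < norm x" by (auto simp: eventually_sequentially)
      then show ?case by (auto intro!: exI[of _ n])
    qed
  qed auto
  also have "\<dots> = (SUP n. emeasure (pow_lborel q :: 'a measure) {x. R / 2 ^ n \<le> norm x \<and> norm x < R})"
  proof (rule SUP_emeasure_incseq[symmetric])
    show "incseq (\<lambda>n. {x::'a. R / 2 ^ n \<le> norm x \<and> norm x < R})"
      using R by (intro incseq_SucI) (auto simp: field_simps intro: order_trans[rotated])
  qed auto
  also have "\<dots> \<le> ennreal (c / (1 - \<theta>))"
    using bound unfolding I_def by (intro SUP_least) simp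
  finally show ?thesis using ennreal_less_top le_less_trans by (metis infinity_ennreal_def)
qed

lemma Lp_le_bounded_support:
  fixes f :: "'a::euclidean_space \<Rightarrow> real"
  assumes f: "continuous_on UNIV f" "\<And>x. R \<le> norm x \<Longrightarrow> f x = 0" and q: "q < real DIM('a)" and p: "0 < p"
  obtains F where "Lp_le p (pow_lborel q) f F"
proof -
  have [measurable]: "f \<in> borel_measurable borel" by (intro borel_measurable_continuous_onI f)
  have "bounded (f ` cball 0 R)"
    using f by (intro compact_imp_bounded compact_continuous_image compact_cball) (blast intro: continuous_on_subset)
  then obtain B where B: "\<And>x. norm x \<le> R \<Longrightarrow> \<bar>f x\<bar> \<le> B"
    unfolding bounded_iff by (metis imageI mem_cball_0 real_norm_def)
  define R' where "R' = max R 1"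
  obtain m where m: "0 \<le> m" "emeasure (pow_lborel q :: 'a measure) (ball 0 R') = ennreal m"
    using emeasure_pow_lborel_ball_finite[OF q, of R'] by (metis R'_def ennreal_cases less_irrefl infinity_ennreal_def less_max_iff_disj zero_less_one)
  have "(\<integral>\<^sup>+x. ennreal (\<bar>f x\<bar> powr p) \<partial>pow_lborel q) \<le> (\<integral>\<^sup>+x. ennreal (\<bar>B\<bar> powr p) * indicator (ball (0::'a) R') x \<partial>pow_lborel q)"
  proof (intro nn_integral_mono)
    fix x :: 'a
    show "ennreal (\<bar>f x\<bar> powr p) \<le> ennreal (\<bar>B\<bar> powr p) * indicator (ball 0 R') x"
    proof (cases "R \<le> norm x")
      case False
      then show ?thesis using B[of x] p by (auto simp: R'_def intro!: ennreal_leI powr_mono2)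
    qed (use f in auto)
  qed
  also have "\<dots> = ennreal (\<bar>B\<bar> powr p * m)"
    using m by (subst nn_integral_cmult_indicator) (simp_all add: ennreal_mult)
  also have "\<dots> = ennreal ((\<bar>B\<bar> * m powr (1/p)) powr p)"
    using m p by (simp add: powr_mult powr_powr)
  finally show thesis
    by (intro that[of "\<bar>B\<bar> * m powr (1/p)"]) (auto simp: Lp_le_def)
qed

section \<open>Hardy's inequality and closability of the gradient norm\<close>

lemma sigma_finite_pow_lborel: "sigma_finite_measure (pow_lborel q)"
  unfolding pow_lborel_def
  by (subst sigma_finite_measure.sigma_finite_iff_density_finite[OF lborel.sigma_finite_measure_axioms]) auto

text \<open>Integrates the segment inequality over starting points \<open>x\<close>, the end point being \<open>x + b x\<close>. By
  Fubini it suffices to bound the contribution of each intermediate point of the segments.\<close>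

lemma displacement_powr_le:
  fixes f :: "'a::euclidean_space \<Rightarrow> real" and b :: "'a \<Rightarrow> 'a"
  assumes f: "C1 f" and p: "1 \<le> p" and b[measurable]: "b \<in> borel_measurable borel"
    and H: "\<And>t::real. 0 \<le> t \<Longrightarrow> t \<le> 1 \<Longrightarrow>
      (\<integral>\<^sup>+x. ennreal (norm (b x) powr p * norm (grad f (x + t *\<^sub>R b x)) powr p) \<partial>pow_lborel q) \<le> H"
  shows "(\<integral>\<^sup>+x. ennreal (\<bar>f (x + b x) - f x\<bar> powr p) \<partial>pow_lborel q) \<le> H"
proof -
  interpret W: sigma_finite_measure "pow_lborel q :: 'a measure" by (rule sigma_finite_pow_lborel)
  interpret pair_sigma_finite "pow_lborel q :: 'a measure" "unit_cube :: real measure" ..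
  note [measurable] = C1_measurable[OF f] C1_grad_measurable[OF f]
  let ?g = "\<lambda>x (t::real). ennreal (norm (b x) powr p * norm (grad f (x + t *\<^sub>R b x)) powr p)"
  have "(\<integral>\<^sup>+x. ennreal (\<bar>f (x + b x) - f x\<bar> powr p) \<partial>pow_lborel q) \<le> (\<integral>\<^sup>+x. (\<integral>\<^sup>+t. ?g x t \<partial>unit_cube) \<partial>pow_lborel q)"
  proof (rule nn_integral_mono)
    fix x :: 'a
    have "(\<integral>\<^sup>+t. ?g x t \<partial>unit_cube) = ennreal (norm (b x) powr p) * (\<integral>\<^sup>+t. ennreal (norm (grad f (x + t *\<^sub>R b x)) powr p) \<partial>(unit_cube::real measure))"
      by (subst nn_integral_cmult[symmetric]) (simp_all add: ennreal_mult)
    then show "ennreal (\<bar>f (x + b x) - f x\<bar> powr p) \<le> (\<integral>\<^sup>+t. ?g x t \<partial>unit_cube)"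
      using segment_powr_le[OF f p, of "x + b x" x] by simp
  qed
  also have "\<dots> = (\<integral>\<^sup>+t. (\<integral>\<^sup>+x. ?g x t \<partial>pow_lborel q) \<partial>unit_cube)"
    by (rule Fubini'[symmetric]) measurable
  also have "\<dots> \<le> (\<integral>\<^sup>+t. H \<partial>(unit_cube :: real measure))"
    using AE_unit_cube by (intro nn_integral_mono_AE) (auto elim!: eventually_mono intro!: H)
  also have "\<dots> = H" by (simp add: unit_cube.emeasure_space_1[simplified])
  finally show ?thesis .
qed

definition C1c :: "('a::euclidean_space \<Rightarrow> real) \<Rightarrow> bool" where
  "C1c f \<longleftrightarrow> C1 f \<and> (\<exists>R. \<forall>x. R \<le> norm x \<longrightarrow> f x = 0)"

lemma C1c_diff: "C1c f \<Longrightarrow> C1c g \<Longrightarrow> C1c (\<lambda>x. f x - g x)"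
proof -
  assume f: "C1c f" and g: "C1c g"
  then obtain R S where "\<And>x. R \<le> norm x \<Longrightarrow> f x = 0" "\<And>x. S \<le> norm x \<Longrightarrow> g x = 0"
    unfolding C1c_def by blast
  then have "\<forall>x. max R S \<le> norm x \<longrightarrow> f x - g x = 0" by simp
  then show ?thesis using f g C1_diff(1)[of f g] unfolding C1c_def by blast
qed

lemma C1c_grad_support:
  assumes "C1c f"
  obtains R where "\<And>x. R \<le> norm x \<Longrightarrow> grad f x = 0"
proof -
  obtain R where R: "\<And>x. R \<le> norm x \<Longrightarrow> f x = 0" using assms by (auto simp: C1c_def)
  have "grad f x = 0" if "R + 1 \<le> norm x" for x
  proof (rule grad_eqI)
    have "open {x :: 'a. R < norm x}" by (rule open_Collect_less) (simp_all add: continuous_on_norm_id)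
    then have "(f has_derivative (\<lambda>_. 0)) (at x)"
      using that R by (rule_tac has_derivative_transform_within_open[OF has_derivative_const]) auto
    then show "GDERIV f x :> 0" by (simp add: gderiv_def)
  qed
  then show thesis by (rule that)
qed

lemma C1c_Lp_le:
  fixes f :: "'a::euclidean_space \<Rightarrow> real"
  assumes "C1c f" "q < real DIM('a)" "0 < p"
  obtains F where "Lp_le p (pow_lborel q) f F"
  using assms Lp_le_bounded_support[of f _ q p] C1_continuous unfolding C1c_def by metis

lemma C1c_grad_Lp_le:
  fixes f :: "'a::euclidean_space \<Rightarrow> real"
  assumes "C1c f" "q < real DIM('a)" "0 < p"
  obtains F where "Lp_le p (pow_lborel q) (\<lambda>x. norm (grad f x)) F"
proof -
  obtain R where "\<And>x. R \<le> norm x \<Longrightarrow> grad f x = 0" using C1c_grad_support[OF assms(1)] by blast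
  moreover have "continuous_on UNIV (\<lambda>x. norm (grad f x))"
    using assms(1) by (auto simp: C1c_def C1_def intro!: continuous_on_norm)
  ultimately show thesis using Lp_le_bounded_support[of "\<lambda>x. norm (grad f x)" R q p] assms that by auto
qed

text \<open>The displacement \<open>b x = x\<close> moves \<open>x\<close> to \<open>2 * x\<close>. The factor \<open>norm x powr p\<close> turns the weight
  exponent \<open>p + \<mu>\<close> into \<open>\<mu>\<close>, and the dilations by \<open>1 + t\<close> do not increase the integral since
  \<open>\<mu> < N\<close>.\<close>

lemma Lp_le_dilation_diff:
  fixes f :: "'a::euclidean_space \<Rightarrow> real"
  assumes f: "C1 f" and p: "1 \<le> p" and \<mu>: "\<mu> < real DIM('a)"
    and G: "Lp_le p (pow_lborel \<mu>) (\<lambda>x. norm (grad f x)) G"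
  shows "Lp_le p (pow_lborel (p + \<mu>)) (\<lambda>x. f (2 *\<^sub>R x) - f x) G"
proof -
  note [measurable] = C1_measurable[OF f] C1_grad_measurable[OF f]
  have "(\<integral>\<^sup>+x. ennreal (\<bar>f (x + x) - f x\<bar> powr p) \<partial>pow_lborel (p + \<mu>)) \<le> ennreal (G powr p)"
  proof (rule displacement_powr_le[OF f p])
    fix t :: real assume t: "0 \<le> t" "t \<le> 1"
    have "(\<integral>\<^sup>+x. ennreal (norm x powr p * norm (grad f (x + t *\<^sub>R x)) powr p) \<partial>pow_lborel (p + \<mu>))
       = (\<integral>\<^sup>+x. ennreal (norm (grad f ((1 + t) *\<^sub>R x)) powr p) \<partial>pow_lborel \<mu>)"
    proof (subst (1 2) nn_integral_pow_lborel, measurable, intro nn_integral_cong)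
      fix x :: 'a
      have "norm x powr (- (p + \<mu>)) * norm x powr p = norm x powr (- \<mu>)"
        by (simp add: powr_add[symmetric])
      then show "ennreal (norm x powr (- (p + \<mu>))) * ennreal (norm x powr p * norm (grad f (x + t *\<^sub>R x)) powr p)
        = ennreal (norm x powr (- \<mu>)) * ennreal (norm (grad f ((1 + t) *\<^sub>R x)) powr p)"
        by (simp add: ennreal_mult[symmetric] mult.assoc[symmetric] scaleR_left_distrib)
    qed
    also have "\<dots> = ennreal ((1 + t) powr (\<mu> - real DIM('a))) * (\<integral>\<^sup>+x. ennreal (norm (grad f x) powr p) \<partial>pow_lborel \<mu>)"
      using t by (intro nn_integral_pow_lborel_scale[of "\<lambda>x. ennreal (norm (grad f x) powr p)"]) auto
    also have "\<dots> \<le> ennreal 1 * ennreal (G powr p)"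
      using t \<mu> Lp_leD(3)[OF G] powr_mono2'[of "\<mu> - real DIM('a)" 1 "1 + t"] by (intro mult_mono ennreal_leI) auto
    finally show "(\<integral>\<^sup>+x. ennreal (norm x powr p * norm (grad f (x + t *\<^sub>R x)) powr p) \<partial>pow_lborel (p + \<mu>)) \<le> ennreal (G powr p)"
      by simp
  qed auto
  then show ?thesis using Lp_leD(2)[OF G] by (auto simp: Lp_le_def scaleR_2)
qed

text \<open>Let \<open>\<theta>\<close> be the factor by which the dilation \<open>f (2 * x)\<close> changes the weighted norm; it is below
  \<open>1\<close> since \<open>p + \<mu> < N\<close>. The triangle inequality improves a bound \<open>F\<close> for the norm of \<open>f\<close>
  to \<open>\<theta> * F + G\<close>. Iterating from any finite bound leads to the fixed point \<open>G / (1 - \<theta>)\<close>.\<close>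

lemma Hardy:
  fixes f :: "'a::euclidean_space \<Rightarrow> real"
  assumes f: "C1c f" and p: "1 \<le> p" and \<mu>: "p + \<mu> < real DIM('a)"
    and G: "Lp_le p (pow_lborel \<mu>) (\<lambda>x. norm (grad f x)) G"
  shows "Lp_le p (pow_lborel (p + \<mu>)) f (G / (1 - 2 powr ((p + \<mu> - real DIM('a)) / p)))"
proof -
  define \<theta> where "\<theta> = 2 powr ((p + \<mu> - real DIM('a)) / p)"
  have \<theta>: "0 < \<theta>" "\<theta> < 1" using \<mu> p by (auto simp: \<theta>_def powr_less_one divide_neg_pos)
  have d: "Lp_le p (pow_lborel (p + \<mu>)) (\<lambda>x. f (2 *\<^sub>R x) - f x) G"
    using f p \<mu> G by (intro Lp_le_dilation_diff) (auto simp: C1c_def)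
  obtain F where F: "Lp_le p (pow_lborel (p + \<mu>)) f F" using C1c_Lp_le[OF f \<mu>, of p] p by auto
  define a where "a n = \<theta> ^ n * F + G * (1 - \<theta> ^ n) / (1 - \<theta>)" for n
  have "Lp_le p (pow_lborel (p + \<mu>)) f (a n)" for n
  proof (induction n)
    case (Suc n)
    have "Lp_le p (pow_lborel (p + \<mu>)) (\<lambda>x. f (2 *\<^sub>R x)) (\<theta> * a n)"
      unfolding \<theta>_def using p by (intro Lp_le_pow_lborel_scale Suc) auto
    from Lp_le_diff[OF this d p] have "Lp_le p (pow_lborel (p + \<mu>)) f (\<theta> * a n + G)" by simp
    also have "\<theta> * a n + G = a (Suc n)"
      using \<theta> unfolding a_def by (simp add: divide_simps) (simp add: algebra_simps)
    finally show ?case .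
  qed (use F in \<open>simp add: a_def\<close>)
  moreover have "a \<longlonglongrightarrow> 0 * F + G * (1 - 0) / (1 - \<theta>)"
    unfolding a_def using \<theta>
    by (intro tendsto_add tendsto_mult tendsto_divide tendsto_diff tendsto_const LIMSEQ_power_zero) auto
  ultimately show ?thesis
    unfolding \<theta>_def[symmetric] using p Lp_leD(1)[OF F]
    by (rule_tac Lp_le_Fatou[where f="\<lambda>_. f" and F=a]) auto
qed

lemma AE_lborel_translate:
  fixes P :: "'a::euclidean_space \<Rightarrow> bool"
  assumes [measurable]: "Measurable.pred borel P" and P: "AE x in lborel. P x"
  shows "AE x in lborel. P (x + v)"
proof -
  have "AE x in distr lborel borel ((+) v). P x" unfolding lborel_distr_plus by (rule P)
  then show ?thesis by (subst (asm) AE_distr_iff) (auto simp: add.commute)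
qed

text \<open>Away from the ball of radius \<open>2 * h\<close>, the weight changes at most by the factor \<open>2 powr \<bar>\<mu>\<bar>\<close> along a
  step of length \<open>h\<close>. This allows a translation argument although the weight is not invariant.\<close>

lemma Lp_le_difference_quotient:
  fixes f :: "'a::euclidean_space \<Rightarrow> real"
  assumes f: "C1 f" and p: "1 \<le> p" and h: "0 < h" and v: "norm v \<le> 1"
    and G: "Lp_le p (pow_lborel \<mu>) (\<lambda>x. norm (grad f x)) G"
  shows "Lp_le p (pow_lborel \<mu>) (\<lambda>x. if 2 * h \<le> norm x then (f (x + h *\<^sub>R v) - f x) / h else 0) (2 powr (\<bar>\<mu>\<bar> / p) * G)"
proof -
  note [measurable] = C1_measurable[OF f] C1_grad_measurable[OF f]
  define b where "b x = (if 2 * h \<le> norm x then h *\<^sub>R v else 0)" for x :: 'a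
  have [measurable]: "b \<in> borel_measurable borel" unfolding b_def by measurable
  have G0: "0 \<le> G" by (rule Lp_leD[OF G])
  have "(\<integral>\<^sup>+x. ennreal (\<bar>f (x + b x) - f x\<bar> powr p) \<partial>pow_lborel \<mu>) \<le> ennreal (h powr p * 2 powr \<bar>\<mu>\<bar> * G powr p)"
  proof (rule displacement_powr_le[OF f p])
    fix t :: real assume t: "0 \<le> t" "t \<le> 1"
    have le: "norm x powr (- \<mu>) * (norm (b x) powr p * norm (grad f (x + t *\<^sub>R b x)) powr p)
      \<le> h powr p * 2 powr \<bar>\<mu>\<bar> * (norm ((t * h) *\<^sub>R v + 1 *\<^sub>R x) powr (- \<mu>) * norm (grad f ((t * h) *\<^sub>R v + 1 *\<^sub>R x)) powr p)" for x
    proof (cases "2 * h \<le> norm x")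
      case True
      define y where "y = x + (t * h) *\<^sub>R v"
      have "norm ((t * h) *\<^sub>R v) \<le> 1 * h * 1"
        using t h v by (simp only: norm_scaleR abs_mult) (intro mult_mono, auto)
      then have "norm ((t * h) *\<^sub>R v) \<le> norm x / 2" using True by simp
      then have y: "norm x \<le> 2 * norm y" "norm y \<le> 2 * norm x"
        unfolding y_def using norm_triangle_ineq2[of x "- ((t * h) *\<^sub>R v)"] norm_triangle_ineq[of x "(t * h) *\<^sub>R v"]
        by (simp, simp)
      have x0: "norm x > 0" "norm y > 0" using True h y by linarith+
      have "norm x powr (- \<mu>) \<le> 2 powr \<bar>\<mu>\<bar> * norm y powr (- \<mu>)"
      proof (cases "\<mu> \<ge> 0")
        case True
        have "norm x powr (- \<mu>) \<le> (norm y / 2) powr (- \<mu>)" using y x0 True by (intro powr_mono2') auto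
        also have "\<dots> = 2 powr \<bar>\<mu>\<bar> * norm y powr (- \<mu>)" using True x0 by (simp add: powr_divide powr_minus field_simps)
        finally show ?thesis .
      next
        case False
        have "norm x powr (- \<mu>) \<le> (2 * norm y) powr (- \<mu>)" using y x0 False by (intro powr_mono2) auto
        also have "\<dots> = 2 powr \<bar>\<mu>\<bar> * norm y powr (- \<mu>)" using False x0 by (simp add: powr_mult)
        finally show ?thesis .
      qed
      moreover have "norm (b x) powr p \<le> h powr p"
        using True h v p by (intro powr_mono2) (auto simp: b_def mult_left_le)
      ultimately have "norm x powr (- \<mu>) * (norm (b x) powr p * norm (grad f y) powr p)
        \<le> (2 powr \<bar>\<mu>\<bar> * norm y powr (- \<mu>)) * (h powr p * norm (grad f y) powr p)"
        by (intro mult_mono mult_right_mono) auto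
      moreover have "x + t *\<^sub>R b x = y" "(t * h) *\<^sub>R v + 1 *\<^sub>R x = y" using True by (auto simp: b_def y_def)
      ultimately show ?thesis by (simp add: mult_ac)
    qed (use p in \<open>simp add: b_def\<close>)
    have "(\<integral>\<^sup>+x. ennreal (norm (b x) powr p * norm (grad f (x + t *\<^sub>R b x)) powr p) \<partial>pow_lborel \<mu>)
      = (\<integral>\<^sup>+x. ennreal (norm x powr (- \<mu>) * (norm (b x) powr p * norm (grad f (x + t *\<^sub>R b x)) powr p)) \<partial>lborel)"
      by (subst nn_integral_pow_lborel) (auto simp: ennreal_mult)
    also have "\<dots> \<le> (\<integral>\<^sup>+x. ennreal (h powr p * 2 powr \<bar>\<mu>\<bar>) * ennreal (norm ((t * h) *\<^sub>R v + 1 *\<^sub>R x) powr (- \<mu>) * norm (grad f ((t * h) *\<^sub>R v + 1 *\<^sub>R x)) powr p) \<partial>lborel)"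
      using le by (intro nn_integral_mono) (simp add: ennreal_mult'[symmetric] ennreal_leI)
    also have "\<dots> = ennreal (h powr p * 2 powr \<bar>\<mu>\<bar>) * (\<integral>\<^sup>+x. ennreal (norm ((t * h) *\<^sub>R v + 1 *\<^sub>R x) powr (- \<mu>) * norm (grad f ((t * h) *\<^sub>R v + 1 *\<^sub>R x)) powr p) \<partial>lborel)"
      by (intro nn_integral_cmult) measurable
    also have "(\<integral>\<^sup>+x. ennreal (norm ((t * h) *\<^sub>R v + 1 *\<^sub>R x) powr (- \<mu>) * norm (grad f ((t * h) *\<^sub>R v + 1 *\<^sub>R x)) powr p) \<partial>lborel)
      = (\<integral>\<^sup>+x. ennreal (norm x powr (- \<mu>) * norm (grad f x) powr p) \<partial>lborel)"
      by (subst nn_integral_lborel_affine[of "\<lambda>x. ennreal (norm x powr (- \<mu>) * norm (grad f x) powr p)" 1]) auto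
    also have "\<dots> = (\<integral>\<^sup>+x. ennreal (norm (grad f x) powr p) \<partial>pow_lborel \<mu>)"
      by (subst nn_integral_pow_lborel) (auto simp: ennreal_mult)
    also have "ennreal (h powr p * 2 powr \<bar>\<mu>\<bar>) * \<dots> \<le> ennreal (h powr p * 2 powr \<bar>\<mu>\<bar>) * ennreal (G powr p)"
      using Lp_leD(3)[OF G] by (intro mult_left_mono) auto
    finally show "(\<integral>\<^sup>+x. ennreal (norm (b x) powr p * norm (grad f (x + t *\<^sub>R b x)) powr p) \<partial>pow_lborel \<mu>)
      \<le> ennreal (h powr p * 2 powr \<bar>\<mu>\<bar> * G powr p)"
      by (simp add: ennreal_mult)
  qed measurable
  also have "h powr p * 2 powr \<bar>\<mu>\<bar> * G powr p = (h * (2 powr (\<bar>\<mu>\<bar> / p) * G)) powr p"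
    using h G0 p by (simp add: powr_mult powr_powr)
  finally have "Lp_le p (pow_lborel \<mu>) (\<lambda>x. f (x + b x) - f x) (h * (2 powr (\<bar>\<mu>\<bar> / p) * G))"
    using h G0 by (auto simp: Lp_le_def)
  from Lp_le_scale[OF this, of "1 / h"] h
  have "Lp_le p (pow_lborel \<mu>) (\<lambda>x. (f (x + b x) - f x) / h) (2 powr (\<bar>\<mu>\<bar> / p) * G)" by simp
  moreover have "(\<lambda>x. (f (x + b x) - f x) / h) = (\<lambda>x. if 2 * h \<le> norm x then (f (x + h *\<^sub>R v) - f x) / h else 0)"
    by (auto simp: b_def)
  ultimately show ?thesis by simp
qed

text \<open>Unlike gradients, difference quotients converge pointwise with the functions; so their bounds pass
  to the limit in \<open>n\<close> first, and afterwards the step tends to zero. The crude constant is harmless: the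
  lemma serves to show that a limit norm is zero.\<close>

lemma grad_lower_semicontinuous:
  fixes f :: "'a::euclidean_space \<Rightarrow> real" and \<psi> :: "nat \<Rightarrow> 'a \<Rightarrow> real"
  assumes f: "C1 f" and \<psi>: "\<And>n. C1 (\<psi> n)" and p: "1 \<le> p"
    and lim: "AE x in lborel. (\<lambda>n. \<psi> n x) \<longlonglongrightarrow> f x"
    and G: "\<And>n. Lp_le p (pow_lborel \<mu>) (\<lambda>x. norm (grad (\<psi> n) x)) G"
  shows "Lp_le p (pow_lborel \<mu>) (\<lambda>x. norm (grad f x)) (real DIM('a) * (2 powr (\<bar>\<mu>\<bar> / p) * G))"
proof -
  note [measurable] = C1_measurable[OF f] C1_grad_measurable[OF f] C1_measurable[OF \<psi>]
  have *: "Lp_le p (pow_lborel \<mu>) (\<lambda>x. grad f x \<bullet> v) (2 powr (\<bar>\<mu>\<bar> / p) * G)" if v: "v \<in> Basis" for v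
  proof -
    define h where "h k = inverse (real (Suc k))" for k
    have h: "0 < h k" for k by (simp add: h_def)
    have h0: "h \<longlonglongrightarrow> 0" unfolding h_def by (rule LIMSEQ_inverse_real_of_nat)
    have Q: "Lp_le p (pow_lborel \<mu>) (\<lambda>x. if 2 * h k \<le> norm x then (f (x + h k *\<^sub>R v) - f x) / h k else 0) (2 powr (\<bar>\<mu>\<bar> / p) * G)" for k
    proof (rule Lp_le_Fatou)
      show "Lp_le p (pow_lborel \<mu>) (\<lambda>x. if 2 * h k \<le> norm x then (\<psi> n (x + h k *\<^sub>R v) - \<psi> n x) / h k else 0) (2 powr (\<bar>\<mu>\<bar> / p) * G)" for n
        using v by (intro Lp_le_difference_quotient \<psi> p h G) auto
      have "AE x in lborel. (\<lambda>n. \<psi> n (x + h k *\<^sub>R v)) \<longlonglongrightarrow> f (x + h k *\<^sub>R v)"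
        by (intro AE_lborel_translate[of "\<lambda>x. (\<lambda>n. \<psi> n x) \<longlonglongrightarrow> f x"] lim) measurable
      then have "AE x in lborel. (\<lambda>n. if 2 * h k \<le> norm x then (\<psi> n (x + h k *\<^sub>R v) - \<psi> n x) / h k else 0)
        \<longlonglongrightarrow> (if 2 * h k \<le> norm x then (f (x + h k *\<^sub>R v) - f x) / h k else 0)"
        using lim
      proof eventually_elim
        case (elim x)
        show ?case
        proof (cases "2 * h k \<le> norm x")
          case True
          have "(\<lambda>n. (\<psi> n (x + h k *\<^sub>R v) - \<psi> n x) / h k) \<longlonglongrightarrow> (f (x + h k *\<^sub>R v) - f x) / h k"
            using h[of k] by (intro tendsto_divide tendsto_diff elim tendsto_const) auto
          with True show ?thesis by simp
        qed simp
      qed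
      then show "AE x in pow_lborel \<mu>. (\<lambda>n. if 2 * h k \<le> norm x then (\<psi> n (x + h k *\<^sub>R v) - \<psi> n x) / h k else 0)
        \<longlonglongrightarrow> (if 2 * h k \<le> norm x then (f (x + h k *\<^sub>R v) - f x) / h k else 0)"
        by (rule AE_pow_lborel)
    qed (use p in \<open>auto simp: borel_measurable_pow_lborel\<close>)
    show ?thesis
    proof (rule Lp_le_Fatou[OF Q tendsto_const])
      show "AE x in pow_lborel \<mu>. (\<lambda>k. if 2 * h k \<le> norm x then (f (x + h k *\<^sub>R v) - f x) / h k else 0) \<longlonglongrightarrow> grad f x \<bullet> v"
        using AE_pow_lborel_nonzero
      proof eventually_elim
        case (elim x)
        have "((\<lambda>t. f (x + t *\<^sub>R v)) has_derivative (\<lambda>s. (s *\<^sub>R v) \<bullet> grad f (x + 0 *\<^sub>R v))) (at (0::real))"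
          by (rule has_derivative_compose[OF _ C1_has_derivative[OF f]]) (auto intro!: derivative_eq_intros)
        then have "((\<lambda>t. f (x + t *\<^sub>R v)) has_field_derivative (grad f x \<bullet> v)) (at 0)"
          by (simp add: has_field_derivative_def mult_commute_abs inner_commute)
        then have "((\<lambda>t. (f (x + t *\<^sub>R v) - f x) / t) \<longlongrightarrow> grad f x \<bullet> v) (at 0)"
          by (simp add: has_field_derivative_iff)
        then have "(\<lambda>k. (f (x + h k *\<^sub>R v) - f x) / h k) \<longlonglongrightarrow> grad f x \<bullet> v"
          by (rule filterlim_compose) (use h0 h[THEN less_imp_neq, symmetric] in \<open>auto simp: filterlim_at\<close>)
        moreover have 2: "(\<lambda>k. 2 * h k) \<longlonglongrightarrow> 2 * 0" by (intro tendsto_mult tendsto_const h0)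
        have "\<forall>\<^sub>F k in sequentially. 2 * h k < norm x"
          by (rule order_tendstoD(2)[OF 2]) (use elim in simp)
        then have "\<forall>\<^sub>F k in sequentially. (f (x + h k *\<^sub>R v) - f x) / h k
           = (if 2 * h k \<le> norm x then (f (x + h k *\<^sub>R v) - f x) / h k else 0)"
          by eventually_elim auto
        ultimately show ?case by (rule Lim_transform_eventually)
      qed
    qed (use p in \<open>auto simp: borel_measurable_pow_lborel\<close>)
  qed
  have "Lp_le p (pow_lborel \<mu>) (\<lambda>x. \<Sum>v\<in>Basis. \<bar>grad f x \<bullet> v\<bar>) (\<Sum>v\<in>(Basis::'a set). 2 powr (\<bar>\<mu>\<bar> / p) * G)"
  proof (rule Lp_le_sum)
    show "Lp_le p (pow_lborel \<mu>) (\<lambda>x. \<bar>grad f x \<bullet> v\<bar>) (2 powr (\<bar>\<mu>\<bar> / p) * G)" if "v \<in> Basis" for v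
      using p by (intro Lp_le_mono[OF *[OF that]]) (auto simp: borel_measurable_pow_lborel)
  qed fact
  then have "Lp_le p (pow_lborel \<mu>) (\<lambda>x. \<Sum>v\<in>Basis. \<bar>grad f x \<bullet> v\<bar>) (real DIM('a) * (2 powr (\<bar>\<mu>\<bar> / p) * G))" by simp
  then show ?thesis
    using p norm_le_l1[where 'a='a] by (rule_tac Lp_le_mono) (auto simp: borel_measurable_pow_lborel sum_nonneg intro!: always_eventually order_trans[OF norm_le_l1])
qed

section \<open>Averages over small cubes\<close>

text \<open>The lower corner of the grid cell of mesh \<open>t\<close> that contains \<open>x\<close>. Means over cells,
  unlike means over translates of a cube, leave only countably many numbers for each mesh in a
  dyadic sequence, as the diagonal argument requires.\<close>

definition corner :: "real \<Rightarrow> 'a::euclidean_space \<Rightarrow> 'a" where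
  "corner t x = (\<Sum>b\<in>Basis. (t * of_int \<lfloor>x \<bullet> b / t\<rfloor>) *\<^sub>R b)"

definition nbhd :: "real \<Rightarrow> 'a::euclidean_space \<Rightarrow> 'a set" where
  "nbhd t x = cbox (x - t *\<^sub>R One) (x + t *\<^sub>R One)"

definition avg :: "real \<Rightarrow> ('a::euclidean_space \<Rightarrow> real) \<Rightarrow> 'a \<Rightarrow> real" where
  "avg t f x = (\<integral>z. f (corner t x + t *\<^sub>R z) \<partial>unit_cube)"

lemma nbhd_borel[measurable]: "nbhd t x \<in> sets borel"
  by (simp add: nbhd_def)

lemma mem_nbhd: "y \<in> nbhd t x \<longleftrightarrow> (\<forall>b\<in>Basis. \<bar>y \<bullet> b - x \<bullet> b\<bar> \<le> t)"
  by (auto simp: nbhd_def mem_box inner_simps abs_le_iff)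

lemma nbhd_sym: "y \<in> nbhd t x \<longleftrightarrow> x \<in> nbhd t y"
  by (auto simp: mem_nbhd abs_minus_commute)

lemma nbhd_mono: "s \<le> t \<Longrightarrow> nbhd s x \<subseteq> nbhd t x"
  by (auto simp: mem_nbhd) (meson order_trans)

lemma convex_nbhd: "convex (nbhd t x)"
  by (simp add: nbhd_def convex_box)

lemma norm_nbhd:
  fixes x :: "'a::euclidean_space"
  assumes "y \<in> nbhd t x"
  shows "norm (y - x) \<le> real DIM('a) * t"
proof -
  have "norm (y - x) \<le> (\<Sum>b\<in>Basis. \<bar>(y - x) \<bullet> b\<bar>)" by (rule norm_le_l1)
  also have "\<dots> \<le> (\<Sum>b\<in>(Basis::'a set). t)"
    using assms by (intro sum_mono) (auto simp: mem_nbhd inner_diff_left)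
  finally show ?thesis by simp
qed

lemma emeasure_nbhd:
  fixes x :: "'a::euclidean_space"
  assumes "0 < t"
  shows "emeasure lborel (nbhd t x) = ennreal ((2 * t) powr real DIM('a))"
proof -
  have "emeasure lborel (nbhd t x) = (\<Prod>b\<in>(Basis::'a set). 2 * t)"
    unfolding nbhd_def using assms by (subst emeasure_lborel_cbox) (auto simp: inner_simps)
  then show ?thesis using assms by (simp add: powr_realpow)
qed

lemma corner_inner: "b \<in> Basis \<Longrightarrow> corner t x \<bullet> b = t * of_int \<lfloor>x \<bullet> b / t\<rfloor>"
  unfolding corner_def by (simp add: inner_sum_left_Basis)

lemma corner_bounds:
  assumes "0 < t" "b \<in> Basis"
  shows "corner t x \<bullet> b \<le> x \<bullet> b" "x \<bullet> b \<le> corner t x \<bullet> b + t"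
proof -
  have "t * of_int \<lfloor>x \<bullet> b / t\<rfloor> \<le> t * (x \<bullet> b / t)" "t * (x \<bullet> b / t) \<le> t * (of_int \<lfloor>x \<bullet> b / t\<rfloor> + 1)"
    using assms(1) by (intro mult_left_mono; linarith)+
  then show "corner t x \<bullet> b \<le> x \<bullet> b" "x \<bullet> b \<le> corner t x \<bullet> b + t"
    using assms unfolding corner_inner[OF assms(2)] by (simp_all add: distrib_left)
qed

lemma corner_in_nbhd:
  assumes t: "0 < t" and z: "z \<in> cbox 0 One"
  shows "corner t x + t *\<^sub>R z \<in> nbhd t x"
  unfolding mem_nbhd
proof
  fix b :: 'a assume b: "b \<in> Basis"
  then have "0 \<le> t * (z \<bullet> b)" "t * (z \<bullet> b) \<le> t" using z t by (auto simp: mem_box mult_left_le)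
  then show "\<bar>(corner t x + t *\<^sub>R z) \<bullet> b - x \<bullet> b\<bar> \<le> t"
    using corner_bounds[OF t b, of x] by (auto simp: inner_simps abs_le_iff)
qed

lemma corner_measurable[measurable]: "corner t \<in> borel_measurable borel"
  unfolding corner_def by measurable

lemma avg_measurable[measurable]:
  assumes [measurable]: "f \<in> borel_measurable borel"
  shows "avg t f \<in> borel_measurable borel"
  unfolding avg_def by measurable

lemma nn_integral_unit_cube_affine_le:
  fixes F :: "'a::euclidean_space \<Rightarrow> ennreal"
  assumes [measurable]: "F \<in> borel_measurable borel" and \<kappa>: "0 < \<kappa>"
    and S: "S \<in> sets borel" "\<And>z. z \<in> cbox 0 One \<Longrightarrow> c + \<kappa> *\<^sub>R z \<in> S"
  shows "(\<integral>\<^sup>+z. F (c + \<kappa> *\<^sub>R z) \<partial>unit_cube) \<le> ennreal (\<kappa> powr (- real DIM('a))) * (\<integral>\<^sup>+y. indicator S y * F y \<partial>lborel)"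
proof -
  note [measurable] = S(1)
  have "(\<integral>\<^sup>+z. F (c + \<kappa> *\<^sub>R z) \<partial>unit_cube) \<le> (\<integral>\<^sup>+z. indicator S (c + \<kappa> *\<^sub>R z) * F (c + \<kappa> *\<^sub>R z) \<partial>lborel)"
    by (subst nn_integral_unit_cube) (auto intro!: nn_integral_mono simp: indicator_def S(2))
  also have "\<dots> = ennreal (\<kappa> powr (- real DIM('a))) * (\<integral>\<^sup>+y. indicator S y * F y \<partial>lborel)"
    using \<kappa> by (intro nn_integral_lborel_affine[of "\<lambda>y. indicator S y * F y"]) auto
  finally show ?thesis .
qed

lemma (in prob_space) powr_jensen':
  fixes g :: "'a \<Rightarrow> real"
  assumes "1 \<le> p"
  shows "ennreal (\<bar>\<integral>x. g x \<partial>M\<bar> powr p) \<le> (\<integral>\<^sup>+x. ennreal (\<bar>g x\<bar> powr p) \<partial>M)"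
  by (cases "integrable M g") (use powr_jensen assms in \<open>auto simp: not_integrable_integral_eq\<close>)

text \<open>Jensen's inequality, with the cell enlarged to a neighbourhood \<open>nbhd t x\<close>. The relation
  \<open>y \<in> nbhd t x\<close> is symmetric, which is what the use of Fubini below requires.\<close>

lemma avg_powr_le:
  fixes f :: "'a::euclidean_space \<Rightarrow> real"
  assumes [measurable]: "f \<in> borel_measurable borel" and t: "0 < t" and p: "1 \<le> p"
  shows "ennreal (\<bar>avg t f x\<bar> powr p) \<le>
    ennreal (t powr (- real DIM('a))) * (\<integral>\<^sup>+y. indicator (nbhd t x) y * ennreal (\<bar>f y\<bar> powr p) \<partial>lborel)"
proof -
  have "ennreal (\<bar>avg t f x\<bar> powr p) \<le> (\<integral>\<^sup>+z. ennreal (\<bar>f (corner t x + t *\<^sub>R z)\<bar> powr p) \<partial>unit_cube)"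
    unfolding avg_def by (rule unit_cube.powr_jensen'[OF p])
  also have "\<dots> \<le> ennreal (t powr (- real DIM('a))) * (\<integral>\<^sup>+y. indicator (nbhd t x) y * ennreal (\<bar>f y\<bar> powr p) \<partial>lborel)"
    using t by (intro nn_integral_unit_cube_affine_le[of "\<lambda>y. ennreal (\<bar>f y\<bar> powr p)"])
      (auto simp: corner_in_nbhd)
  finally show ?thesis .
qed

text \<open>The point with relative position \<open>z\<close> in the large cell is joined to the one with the same relative
  position in the small cell. At time \<open>\<tau>\<close> these segments trace out a cube with edge at least
  \<open>t / 2\<close> inside \<open>nbhd t x\<close>, so a change of variables costs at most \<open>(t / 2) powr (- N)\<close>.\<close>

lemma avg_halving_powr_le:
  fixes f :: "'a::euclidean_space \<Rightarrow> real"
  assumes f: "C1 f" and t: "0 < t" and p: "1 \<le> p"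
  shows "ennreal (\<bar>avg (t / 2) f x - avg t f x\<bar> powr p) \<le>
    ennreal ((2 * real DIM('a) * t) powr p * (t / 2) powr (- real DIM('a))) *
      (\<integral>\<^sup>+y. indicator (nbhd t x) y * ennreal (norm (grad f y) powr p) \<partial>lborel)"
proof -
  note [measurable] = C1_measurable[OF f] C1_grad_measurable[OF f]
  interpret pair_sigma_finite "unit_cube :: 'a measure" "unit_cube :: real measure" ..
  define a where "a = corner t x"
  define a' where "a' = corner (t / 2) x"
  let ?I = "\<integral>\<^sup>+y. indicator (nbhd t x) y * ennreal (norm (grad f y) powr p) \<partial>lborel"
  let ?g = "\<lambda>z \<tau>::real. ennreal (norm (grad f ((a + t *\<^sub>R z) + \<tau> *\<^sub>R ((a' + (t/2) *\<^sub>R z) - (a + t *\<^sub>R z)))) powr p)"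
  have ends: "a + t *\<^sub>R z \<in> nbhd t x" "a' + (t/2) *\<^sub>R z \<in> nbhd t x" if "z \<in> cbox 0 One" for z
    using corner_in_nbhd[OF t that, of x] corner_in_nbhd[of "t/2" z x] that t nbhd_mono[of "t/2" t x]
    by (auto simp: a_def a'_def)
  have cont: "continuous_on UNIV (\<lambda>z. f (c + s *\<^sub>R z))" for c s
    by (intro continuous_on_compose2[OF C1_continuous[OF f]] continuous_on_add continuous_on_const continuous_on_scaleR continuous_on_id) auto
  have int: "integrable unit_cube (\<lambda>z. f (c + s *\<^sub>R z))" for c s
    by (rule integrable_unit_cube_continuous[OF cont])
  have "avg (t / 2) f x - avg t f x = (\<integral>z. f (a' + (t/2) *\<^sub>R z) - f (a + t *\<^sub>R z) \<partial>unit_cube)"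
    unfolding avg_def a_def a'_def by (intro Bochner_Integration.integral_diff[symmetric] int)
  then have "ennreal (\<bar>avg (t / 2) f x - avg t f x\<bar> powr p)
    \<le> (\<integral>\<^sup>+z. ennreal (\<bar>f (a' + (t/2) *\<^sub>R z) - f (a + t *\<^sub>R z)\<bar> powr p) \<partial>unit_cube)"
    using unit_cube.powr_jensen'[OF p, of "\<lambda>z. f (a' + (t/2) *\<^sub>R z) - f (a + t *\<^sub>R z)"] by simp
  also have "\<dots> \<le> (\<integral>\<^sup>+z. ennreal ((2 * real DIM('a) * t) powr p) * (\<integral>\<^sup>+\<tau>. ?g z \<tau> \<partial>unit_cube) \<partial>unit_cube)"
  proof (intro nn_integral_mono_AE, use AE_unit_cube in eventually_elim)
    case (elim z)
    have "norm ((a' + (t/2) *\<^sub>R z) - (a + t *\<^sub>R z)) \<le> norm ((a' + (t/2) *\<^sub>R z) - x) + norm ((a + t *\<^sub>R z) - x)"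
      using norm_triangle_ineq4[of "(a' + (t/2) *\<^sub>R z) - x" "(a + t *\<^sub>R z) - x"] by simp
    also have "\<dots> \<le> 2 * real DIM('a) * t"
      using norm_nbhd[OF ends(1)[OF elim]] norm_nbhd[OF ends(2)[OF elim]] by simp
    finally have "norm ((a' + (t/2) *\<^sub>R z) - (a + t *\<^sub>R z)) powr p \<le> (2 * real DIM('a) * t) powr p"
      using p by (intro powr_mono2) auto
    then show ?case
      by (intro order_trans[OF segment_powr_le[OF f p]] mult_right_mono ennreal_leI) auto
  qed
  also have "\<dots> = ennreal ((2 * real DIM('a) * t) powr p) * (\<integral>\<^sup>+z. (\<integral>\<^sup>+\<tau>. ?g z \<tau> \<partial>unit_cube) \<partial>unit_cube)"
    by (intro nn_integral_cmult) measurable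
  also have "(\<integral>\<^sup>+z. (\<integral>\<^sup>+\<tau>. ?g z \<tau> \<partial>unit_cube) \<partial>unit_cube) = (\<integral>\<^sup>+\<tau>. (\<integral>\<^sup>+z. ?g z \<tau> \<partial>unit_cube) \<partial>unit_cube)"
    by (rule Fubini'[symmetric]) measurable
  also have "\<dots> \<le> (\<integral>\<^sup>+\<tau>. ennreal ((t / 2) powr (- real DIM('a))) * ?I \<partial>(unit_cube :: real measure))"
  proof (intro nn_integral_mono_AE, use AE_unit_cube[where 'a=real] in eventually_elim)
    case (elim \<tau>)
    then have \<tau>: "0 \<le> \<tau>" "\<tau> \<le> 1" by auto
    \<comment> \<open>The edge of the cube that the segments reach at time \<open>\<tau>\<close>.\<close>
    define \<kappa> where "\<kappa> = t * (1 - \<tau> / 2)"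
    have \<kappa>: "t / 2 \<le> \<kappa>" "0 < \<kappa>" using \<tau> t by (auto simp: \<kappa>_def field_simps intro: add_strict_increasing)
    have eq: "(a + t *\<^sub>R z) + \<tau> *\<^sub>R ((a' + (t/2) *\<^sub>R z) - (a + t *\<^sub>R z)) = (a + \<tau> *\<^sub>R (a' - a)) + \<kappa> *\<^sub>R z" for z
      by (simp add: \<kappa>_def algebra_simps) (simp add: scaleR_add_left[symmetric])
    have "(\<integral>\<^sup>+z. ?g z \<tau> \<partial>unit_cube) \<le> ennreal (\<kappa> powr (- real DIM('a))) * ?I"
      unfolding eq
    proof (rule nn_integral_unit_cube_affine_le[of "\<lambda>y. ennreal (norm (grad f y) powr p)"])
      fix z :: 'a assume z: "z \<in> cbox 0 One"
      have "(a + t *\<^sub>R z) + \<tau> *\<^sub>R ((a' + (t/2) *\<^sub>R z) - (a + t *\<^sub>R z))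
        = (1 - \<tau>) *\<^sub>R (a + t *\<^sub>R z) + \<tau> *\<^sub>R (a' + (t/2) *\<^sub>R z)" by (simp add: algebra_simps)
      also have "\<dots> \<in> nbhd t x" using \<tau> ends[OF z] by (intro convexD[OF convex_nbhd]) auto
      finally show "(a + \<tau> *\<^sub>R (a' - a)) + \<kappa> *\<^sub>R z \<in> nbhd t x" unfolding eq .
    qed (use \<kappa> in auto)
    also have "\<dots> \<le> ennreal ((t / 2) powr (- real DIM('a))) * ?I"
      using \<kappa> t by (intro mult_right_mono ennreal_leI powr_mono2') auto
    finally show ?case .
  qed
  also have "\<dots> = ennreal ((t / 2) powr (- real DIM('a))) * ?I" by (simp add: unit_cube.emeasure_space_1[simplified])
  finally show ?thesis by (simp add: mult_left_mono ennreal_mult mult.assoc)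
qed

text \<open>The gain from \<open>L\<^sup>p\<close> to \<open>L\<^sup>r\<close>: the pointwise bound controls the supremum of \<open>g\<close>, and
  integrating it (Fubini) controls its \<open>L\<^sup>p\<close> norm.\<close>

lemma Lp_le_of_nbhd_bound:
  fixes g :: "'a::euclidean_space \<Rightarrow> real" and h :: "'a \<Rightarrow> real"
  assumes [measurable]: "g \<in> borel_measurable borel" "h \<in> borel_measurable borel" "A \<in> sets borel" "A' \<in> sets borel"
    and t: "0 < t" and p: "1 \<le> p" "p \<le> r" and K: "0 \<le> K"
    and sub: "\<And>x. x \<in> A \<Longrightarrow> nbhd t x \<subseteq> A'"
    and g: "\<And>x. x \<in> A \<Longrightarrow> ennreal (\<bar>g x\<bar> powr p) \<le> ennreal K * (\<integral>\<^sup>+y. indicator (nbhd t x) y * ennreal (\<bar>h y\<bar> powr p) \<partial>lborel)"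
    and H: "Lp_le p lborel (\<lambda>y. indicator A' y * h y) H"
  shows "Lp_le r lborel (\<lambda>x. indicator A x * g x) (K powr (1 / p) * (2 * t) powr (real DIM('a) / r) * H)"
proof -
  have H0: "0 \<le> H" by (rule Lp_leD[OF H])
  \<comment> \<open>\<open>T\<close> bounds the supremum of \<open>\<bar>g x\<bar> powr p\<close>; it is interpolated with the integral of \<open>\<bar>g x\<bar> powr p\<close>.\<close>
  define T where "T = K * H powr p"
  have T0: "0 \<le> T" using K by (simp add: T_def)
  have H': "(\<integral>\<^sup>+y. indicator A' y * ennreal (\<bar>h y\<bar> powr p) \<partial>lborel) \<le> ennreal (H powr p)"
  proof -
    have "(\<lambda>y. indicator A' y * ennreal (\<bar>h y\<bar> powr p)) = (\<lambda>y. ennreal (\<bar>indicator A' y * h y\<bar> powr p))"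
      using p by (auto simp: fun_eq_iff indicator_def)
    then show ?thesis using Lp_leD(3)[OF H] by simp
  qed
  have N: "(\<lambda>(x :: 'a, y). indicator (nbhd t x) y :: ennreal) \<in> borel_measurable (borel \<Otimes>\<^sub>M borel)"
  proof -
    have "(\<lambda>(x :: 'a, y). indicator (nbhd t x) y :: ennreal) = (\<lambda>z. indicator {z. \<forall>b\<in>Basis. \<bar>snd z \<bullet> b - fst z \<bullet> b\<bar> \<le> t} (z :: 'a \<times> 'a))"
      by (auto simp: fun_eq_iff indicator_def mem_nbhd)
    also have "\<dots> \<in> borel_measurable (borel \<Otimes>\<^sub>M borel)" by measurable
    finally show ?thesis .
  qed
  note [measurable] = N[unfolded split_beta']
  have sup: "\<bar>g x\<bar> powr p \<le> T" if x: "x \<in> A" for x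
  proof -
    have "(\<integral>\<^sup>+y. indicator (nbhd t x) y * ennreal (\<bar>h y\<bar> powr p) \<partial>lborel) \<le> (\<integral>\<^sup>+y. indicator A' y * ennreal (\<bar>h y\<bar> powr p) \<partial>lborel)"
      using sub[OF x] by (intro nn_integral_mono) (auto simp: indicator_def)
    then have "ennreal (\<bar>g x\<bar> powr p) \<le> ennreal T"
      using K by (intro order_trans[OF g[OF x]]) (auto simp: T_def ennreal_mult intro!: mult_left_mono order_trans[OF _ H'])
    then show ?thesis using T0 by (simp add: ennreal_le_iff)
  qed
  have "(\<integral>\<^sup>+x. ennreal (\<bar>indicator A x * g x\<bar> powr r) \<partial>lborel)
    \<le> (\<integral>\<^sup>+x. ennreal (T powr (r / p - 1)) * (indicator A x * ennreal (\<bar>g x\<bar> powr p)) \<partial>lborel)"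
  proof (intro nn_integral_mono)
    fix x
    have "\<bar>g x\<bar> powr r \<le> T powr (r / p - 1) * \<bar>g x\<bar> powr p" if "x \<in> A"
    proof -
      have "\<bar>g x\<bar> powr r = (\<bar>g x\<bar> powr p) powr (r / p - 1) * \<bar>g x\<bar> powr p"
        using p by (simp add: powr_powr powr_add[symmetric] field_simps)
      also have "\<dots> \<le> T powr (r / p - 1) * \<bar>g x\<bar> powr p"
        using p sup[OF that] by (intro mult_right_mono powr_mono2) auto
      finally show ?thesis .
    qed
    then show "ennreal (\<bar>indicator A x * g x\<bar> powr r) \<le> ennreal (T powr (r / p - 1)) * (indicator A x * ennreal (\<bar>g x\<bar> powr p))"
      by (auto simp: indicator_def ennreal_mult[symmetric] intro!: ennreal_leI)
  qed
  also have "\<dots> = ennreal (T powr (r / p - 1)) * (\<integral>\<^sup>+x. indicator A x * ennreal (\<bar>g x\<bar> powr p) \<partial>lborel)"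
    by (intro nn_integral_cmult) measurable
  also have "(\<integral>\<^sup>+x. indicator A x * ennreal (\<bar>g x\<bar> powr p) \<partial>lborel)
    \<le> (\<integral>\<^sup>+x. ennreal K * (\<integral>\<^sup>+y. indicator (nbhd t x) y * (indicator A' y * ennreal (\<bar>h y\<bar> powr p)) \<partial>lborel) \<partial>lborel)"
  proof (intro nn_integral_mono)
    fix x
    show "indicator A x * ennreal (\<bar>g x\<bar> powr p) \<le> ennreal K * (\<integral>\<^sup>+y. indicator (nbhd t x) y * (indicator A' y * ennreal (\<bar>h y\<bar> powr p)) \<partial>lborel)"
    proof (cases "x \<in> A")
      case True
      have "(\<integral>\<^sup>+y. indicator (nbhd t x) y * ennreal (\<bar>h y\<bar> powr p) \<partial>lborel)
        = (\<integral>\<^sup>+y. indicator (nbhd t x) y * (indicator A' y * ennreal (\<bar>h y\<bar> powr p)) \<partial>lborel)"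
        using sub[OF True] by (intro nn_integral_cong) (auto simp: indicator_def)
      then show ?thesis using g[OF True] True by simp
    qed simp
  qed
  also have "\<dots> = ennreal K * (\<integral>\<^sup>+x. (\<integral>\<^sup>+y. indicator (nbhd t x) y * (indicator A' y * ennreal (\<bar>h y\<bar> powr p)) \<partial>lborel) \<partial>lborel)"
    by (intro nn_integral_cmult) measurable
  also have "(\<integral>\<^sup>+x. (\<integral>\<^sup>+y. indicator (nbhd t x) y * (indicator A' y * ennreal (\<bar>h y\<bar> powr p)) \<partial>lborel) \<partial>lborel)
    = (\<integral>\<^sup>+y. (\<integral>\<^sup>+x. indicator (nbhd t x) y * (indicator A' y * ennreal (\<bar>h y\<bar> powr p)) \<partial>lborel) \<partial>lborel)"
    by (rule lborel_pair.Fubini'[symmetric]) measurable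
  also have "\<dots> = (\<integral>\<^sup>+y. ennreal ((2 * t) powr real DIM('a)) * (indicator A' y * ennreal (\<bar>h y\<bar> powr p)) \<partial>lborel)"
  proof (intro nn_integral_cong)
    fix y :: 'a
    have "(\<integral>\<^sup>+x. indicator (nbhd t x) y * (indicator A' y * ennreal (\<bar>h y\<bar> powr p)) \<partial>lborel)
      = (\<integral>\<^sup>+x. (indicator A' y * ennreal (\<bar>h y\<bar> powr p)) * indicator (nbhd t y) x \<partial>lborel)"
      using nbhd_sym[of _ t y] by (intro nn_integral_cong) (auto simp: indicator_def)
    also have "\<dots> = (indicator A' y * ennreal (\<bar>h y\<bar> powr p)) * emeasure lborel (nbhd t y)"
      by (intro nn_integral_cmult_indicator) (simp add: nbhd_def)
    finally show "(\<integral>\<^sup>+x. indicator (nbhd t x) y * (indicator A' y * ennreal (\<bar>h y\<bar> powr p)) \<partial>lborel)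
      = ennreal ((2 * t) powr real DIM('a)) * (indicator A' y * ennreal (\<bar>h y\<bar> powr p))"
      by (simp only: emeasure_nbhd[OF t] mult.commute)
  qed
  also have "\<dots> = ennreal ((2 * t) powr real DIM('a)) * (\<integral>\<^sup>+y. indicator A' y * ennreal (\<bar>h y\<bar> powr p) \<partial>lborel)"
    by (intro nn_integral_cmult) measurable
  also have "\<dots> \<le> ennreal ((2 * t) powr real DIM('a)) * ennreal (H powr p)"
    by (intro mult_left_mono H') simp
  also have "ennreal (T powr (r / p - 1)) * (ennreal K * (ennreal ((2 * t) powr real DIM('a)) * ennreal (H powr p)))
    = ennreal (T powr (r / p - 1) * T powr 1 * (2 * t) powr real DIM('a))"
    using K T0 by (simp add: ennreal_mult[symmetric] T_def mult_ac)
  also have "T powr (r / p - 1) * T powr 1 * (2 * t) powr real DIM('a) = (K powr (1 / p) * (2 * t) powr (real DIM('a) / r) * H) powr r"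
    using K H0 p t unfolding powr_add[symmetric] by (simp add: T_def powr_mult powr_powr)
  finally show ?thesis
    using H0 by (auto simp: Lp_le_def mult_left_mono)
qed

lemma Lp_le_avg:
  fixes f :: "'a::euclidean_space \<Rightarrow> real"
  assumes f: "f \<in> borel_measurable borel" and A: "A \<in> sets borel" "A' \<in> sets borel"
    and t: "0 < t" and p: "1 \<le> p" "p \<le> r" and sub: "\<And>x. x \<in> A \<Longrightarrow> nbhd t x \<subseteq> A'"
    and F: "Lp_le p lborel (\<lambda>y. indicator A' y * f y) F"
  shows "Lp_le r lborel (\<lambda>x. indicator A x * avg t f x)
    (2 powr (real DIM('a) / r) * t powr (real DIM('a) / r - real DIM('a) / p) * F)"
proof -
  have "Lp_le r lborel (\<lambda>x. indicator A x * avg t f x)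
    ((t powr (- real DIM('a))) powr (1 / p) * (2 * t) powr (real DIM('a) / r) * F)"
    by (rule Lp_le_of_nbhd_bound[OF avg_measurable[OF f] f A t p _ sub avg_powr_le[OF f t p(1)] F]) auto
  also have "(t powr (- real DIM('a))) powr (1 / p) * (2 * t) powr (real DIM('a) / r)
    = 2 powr (real DIM('a) / r) * t powr (real DIM('a) / r - real DIM('a) / p)"
  proof -
    have "(t powr (- real DIM('a))) powr (1 / p) * t powr (real DIM('a) / r) = t powr (real DIM('a) / r - real DIM('a) / p)"
      unfolding powr_powr powr_add[symmetric] by (simp add: algebra_simps)
    then show ?thesis using t by (simp add: powr_mult)
  qed
  finally show ?thesis .
qed

definition Poincare_const :: "real \<Rightarrow> real \<Rightarrow> real \<Rightarrow> real" where
  "Poincare_const N p r = 2 * N * 2 powr (N / p) * 2 powr (N / r) / (1 - 2 powr (- (N / r + 1 - N / p)))"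

text \<open>Subcritical Poincare--Sobolev inequality. Every halving of the mesh gains the factor
  \<open>q = 2 powr (- \<alpha>) < 1\<close>, and the means converge to \<open>f\<close> by continuity.\<close>

lemma Lp_le_avg_error:
  fixes f :: "'a::euclidean_space \<Rightarrow> real"
  defines "N \<equiv> real DIM('a)"
  assumes f: "C1 f" and A[measurable]: "A \<in> sets borel" "A' \<in> sets borel"
    and t: "0 < t" and p: "1 \<le> p" "p \<le> r" and sub: "\<And>x. x \<in> A \<Longrightarrow> nbhd t x \<subseteq> A'"
    and \<alpha>: "0 < N / r + 1 - N / p"
    and G: "Lp_le p lborel (\<lambda>y. indicator A' y * norm (grad f y)) G"
  shows "Lp_le r lborel (\<lambda>x. indicator A x * (f x - avg t f x)) (Poincare_const N p r * t powr (N / r + 1 - N / p) * G)"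
proof -
  define \<alpha> where "\<alpha> = N / r + 1 - N / p"
  define c where "c = 2 * N * 2 powr (N / p) * 2 powr (N / r)"
  note [measurable] = C1_measurable[OF f] C1_grad_measurable[OF f]
  have G0: "0 \<le> G" by (rule Lp_leD[OF G])
  have c0: "0 \<le> c" by (simp add: c_def N_def)
  have \<alpha>0: "0 < \<alpha>" using \<alpha> by (simp add: \<alpha>_def)
  define q where "q = 2 powr (- \<alpha>)"
  have q: "0 < q" "q < 1" using \<alpha>0 by (auto simp: q_def powr_less_one)
  define s where "s i = t / 2 ^ i" for i :: nat
  have s0: "0 < s i" for i using t by (simp add: s_def)
  have st: "s i \<le> t" for i using t by (simp add: s_def field_simps)
  have step: "Lp_le r lborel (\<lambda>x. indicator A x * (avg (s (Suc i)) f x - avg (s i) f x)) (c * t powr \<alpha> * G * q ^ i)" for i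
  proof -
    have "Lp_le r lborel (\<lambda>x. indicator A x * (avg (s i / 2) f x - avg (s i) f x))
      (((2 * N * s i) powr p * (s i / 2) powr (- N)) powr (1 / p) * (2 * s i) powr (N / r) * G)"
      unfolding N_def
    proof (rule Lp_le_of_nbhd_bound[where h="\<lambda>y. norm (grad f y)"])
      show "nbhd (s i) x \<subseteq> A'" if "x \<in> A" for x
        using sub[OF that] nbhd_mono[OF st] by blast
      show "ennreal (\<bar>avg (s i / 2) f x - avg (s i) f x\<bar> powr p) \<le>
        ennreal ((2 * real DIM('a) * s i) powr p * (s i / 2) powr (- real DIM('a))) *
        (\<integral>\<^sup>+y. indicator (nbhd (s i) x) y * ennreal (\<bar>norm (grad f y)\<bar> powr p) \<partial>lborel)" for x
        using avg_halving_powr_le[OF f s0 p(1)] by simp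
    qed (use s0 p G in auto)
    also have "((2 * N * s i) powr p * (s i / 2) powr (- N)) powr (1 / p) * (2 * s i) powr (N / r) * G = c * s i powr \<alpha> * G"
    proof -
      have "((2 * N * s i) powr p * (s i / 2) powr (- N)) powr (1 / p) = (2 * N * s i) * (s i / 2) powr (- N / p)"
        using s0[of i] p by (simp add: powr_mult powr_powr N_def)
      also have "\<dots> * (2 * s i) powr (N / r) = c * (s i * s i powr (- N / p) * s i powr (N / r))"
        using s0[of i] by (simp add: c_def powr_mult powr_divide powr_minus field_simps)
      also have "s i * s i powr (- N / p) * s i powr (N / r) = s i powr 1 * s i powr (- N / p) * s i powr (N / r)"
        using s0[of i] by simp
      also have "\<dots> = s i powr \<alpha>"
        unfolding powr_add[symmetric] \<alpha>_def by (simp add: algebra_simps)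
      finally show ?thesis by simp
    qed
    also have "s i powr \<alpha> = t powr \<alpha> * q ^ i"
      using t by (simp add: s_def q_def powr_divide powr_minus powr_powr powr_realpow[symmetric] powr_mult mult.commute field_simps flip: powr_realpow)
    also have "c * (t powr \<alpha> * q ^ i) * G = c * t powr \<alpha> * G * q ^ i" by simp
    finally show ?thesis by (simp add: s_def mult.commute)
  qed
  have tele: "Lp_le r lborel (\<lambda>x. indicator A x * (avg (s m) f x - avg t f x)) (c * t powr \<alpha> * G * (1 / (1 - q)))" for m
  proof -
    have "Lp_le r lborel (\<lambda>x. \<Sum>i<m. indicator A x * (avg (s (Suc i)) f x - avg (s i) f x)) (\<Sum>i<m. c * t powr \<alpha> * G * q ^ i)"
      using p by (intro Lp_le_sum step) auto
    moreover have "(\<Sum>i<m. indicator A x * (avg (s (Suc i)) f x - avg (s i) f x)) = indicator A x * (avg (s m) f x - avg t f x)" for x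
      using sum_lessThan_telescope[of "\<lambda>i. avg (s i) f x" m] by (simp add: sum_distrib_left[symmetric] s_def)
    moreover have "(\<Sum>i<m. c * t powr \<alpha> * G * q ^ i) \<le> c * t powr \<alpha> * G * (1 / (1 - q))"
    proof -
      have "(\<Sum>i<m. q ^ i) \<le> (\<Sum>i. q ^ i)" using q by (intro sum_le_suminf summable_geometric) auto
      also have "\<dots> = 1 / (1 - q)" using q by (intro suminf_geometric) auto
      finally show ?thesis unfolding sum_distrib_left[symmetric] using c0 G0 by (intro mult_left_mono) auto
    qed
    ultimately show ?thesis using p by (auto intro: Lp_le_weaken)
  qed
  have conv: "(\<lambda>m. avg (s m) f x) \<longlonglongrightarrow> f x" for x
  proof (rule LIMSEQ_I)
    fix e :: real assume "0 < e"
    then obtain d where d: "d > 0" "\<And>y. dist y x < d \<Longrightarrow> dist (f y) (f x) < e / 2"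
      using C1_continuous[OF f] unfolding continuous_on_iff by (metis UNIV_I half_gt_zero)
    have "(\<lambda>m. N * s m) \<longlonglongrightarrow> 0" unfolding s_def by real_asymp
    then have "\<forall>\<^sub>F m in sequentially. N * s m < d" using d by (intro order_tendstoD(2))
    then obtain M where M: "\<And>m. M \<le> m \<Longrightarrow> N * s m < d" by (auto simp: eventually_sequentially)
    have "norm (avg (s m) f x - f x) < e" if "M \<le> m" for m
    proof -
      have int: "integrable unit_cube (\<lambda>z. f (corner (s m) x + s m *\<^sub>R z))"
        by (intro integrable_unit_cube_continuous continuous_on_compose2[OF C1_continuous[OF f]] continuous_on_add continuous_on_const continuous_on_scaleR continuous_on_id) auto
      have "avg (s m) f x - f x = (\<integral>z. f (corner (s m) x + s m *\<^sub>R z) - f x \<partial>unit_cube)"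
        unfolding avg_def by (subst Bochner_Integration.integral_diff[OF int]) (auto simp: unit_cube.prob_space[simplified])
      also have "norm \<dots> \<le> (\<integral>z. norm (f (corner (s m) x + s m *\<^sub>R z) - f x) \<partial>unit_cube)"
        by (rule integral_norm_bound)
      also have "\<dots> \<le> (\<integral>z. e / 2 \<partial>(unit_cube :: 'a measure))"
      proof (rule integral_mono_AE)
        show "AE z in unit_cube. norm (f (corner (s m) x + s m *\<^sub>R z) - f x) \<le> e / 2"
          using AE_unit_cube
        proof eventually_elim
          case (elim z)
          from norm_nbhd[OF corner_in_nbhd[OF s0 elim], of m x] M[OF that]
          have "dist (corner (s m) x + s m *\<^sub>R z) x < d" by (simp add: dist_norm N_def)
          then show ?case using d(2) by (force simp: dist_norm)
        qed
      qed (use int in auto)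
      also have "\<dots> < e" using \<open>0 < e\<close> by (simp add: unit_cube.prob_space[simplified])
      finally show ?thesis .
    qed
    then show "\<exists>M. \<forall>m\<ge>M. norm (avg (s m) f x - f x) < e" by blast
  qed
  have "Lp_le r lborel (\<lambda>x. indicator A x * (f x - avg t f x)) (c * t powr \<alpha> * G * (1 / (1 - q)))"
  proof (rule Lp_le_Fatou[OF tele tendsto_const])
    show "AE x in lborel. (\<lambda>m. indicator A x * (avg (s m) f x - avg t f x)) \<longlonglongrightarrow> indicator A x * (f x - avg t f x)"
      by (intro always_eventually allI tendsto_mult tendsto_diff tendsto_const conv)
  qed (use p in auto)
  then show ?thesis by (simp add: Poincare_const_def c_def q_def \<alpha>_def mult_ac)
qed

lemma avg_diff:
  fixes f g :: "'a::euclidean_space \<Rightarrow> real"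
  assumes [measurable]: "f \<in> borel_measurable borel" "g \<in> borel_measurable borel"
    and t: "0 < t" and p: "1 \<le> p" and sub: "nbhd t x \<subseteq> A'"
    and F: "Lp_le p lborel (\<lambda>y. indicator A' y * f y) F" and G: "Lp_le p lborel (\<lambda>y. indicator A' y * g y) G"
  shows "avg t (\<lambda>x. f x - g x) x = avg t f x - avg t g x"
proof -
  have int: "integrable unit_cube (\<lambda>z. u (corner t x + t *\<^sub>R z))"
    if [measurable]: "u \<in> borel_measurable borel" and U: "Lp_le p lborel (\<lambda>y. indicator A' y * u y) U" for u :: "'a \<Rightarrow> real" and U
  proof -
    have "(\<integral>\<^sup>+z. ennreal (\<bar>u (corner t x + t *\<^sub>R z)\<bar> powr p) \<partial>unit_cube)
      \<le> ennreal (t powr (- real DIM('a))) * (\<integral>\<^sup>+y. indicator (nbhd t x) y * ennreal (\<bar>u y\<bar> powr p) \<partial>lborel)"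
      using t by (intro nn_integral_unit_cube_affine_le[of "\<lambda>y. ennreal (\<bar>u y\<bar> powr p)"])
        (auto simp: corner_in_nbhd)
    also have "\<dots> \<le> ennreal (t powr (- real DIM('a))) * (\<integral>\<^sup>+y. ennreal (\<bar>indicator A' y * u y\<bar> powr p) \<partial>lborel)"
      using sub by (intro mult_left_mono nn_integral_mono) (auto simp: indicator_def)
    also have "\<dots> \<le> ennreal (t powr (- real DIM('a))) * ennreal (U powr p)"
      by (intro mult_left_mono Lp_leD(3)[OF U]) auto
    also have "\<dots> < \<infinity>" by (simp add: ennreal_mult_less_top)
    finally have fin: "(\<integral>\<^sup>+z. ennreal (\<bar>u (corner t x + t *\<^sub>R z)\<bar> powr p) \<partial>unit_cube) < \<infinity>" .
    show ?thesis
    proof (rule integrableI_bounded)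
      have "ennreal (norm (u (corner t x + t *\<^sub>R z))) \<le> 1 + ennreal (\<bar>u (corner t x + t *\<^sub>R z)\<bar> powr p)" for z
      proof -
        have "y \<le> 1 + y powr p" if "0 \<le> y" for y :: real
          using powr_mono[of 1 p y] p that by (cases "y \<le> 1") (auto intro: add_increasing2 add_increasing)
        then have "ennreal (norm (u (corner t x + t *\<^sub>R z))) \<le> ennreal (1 + \<bar>u (corner t x + t *\<^sub>R z)\<bar> powr p)"
          by (intro ennreal_leI) simp
        then show ?thesis by simp
      qed
      then have "(\<integral>\<^sup>+z. ennreal (norm (u (corner t x + t *\<^sub>R z))) \<partial>unit_cube) \<le> (\<integral>\<^sup>+z. 1 + ennreal (\<bar>u (corner t x + t *\<^sub>R z)\<bar> powr p) \<partial>unit_cube)"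
        by (intro nn_integral_mono)
      also have "\<dots> = 1 + (\<integral>\<^sup>+z. ennreal (\<bar>u (corner t x + t *\<^sub>R z)\<bar> powr p) \<partial>unit_cube)"
        by (subst nn_integral_add) (auto simp: unit_cube.emeasure_space_1[simplified])
      finally show "(\<integral>\<^sup>+z. ennreal (norm (u (corner t x + t *\<^sub>R z))) \<partial>unit_cube) < \<infinity>" using fin
        by (simp add: less_top[symmetric] top_unique) (metis ennreal_add_eq_top ennreal_one_neq_top neq_top_trans)
    qed measurable
  qed
  show ?thesis
    unfolding avg_def by (intro Bochner_Integration.integral_diff int[OF _ F] int[OF _ G]) measurable
qed

section \<open>Local estimates for limits of test functions\<close>

lemma AE_pow_lborel_iff: "(AE x in pow_lborel q. P x) \<longleftrightarrow> (AE x in lborel. P x)"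
proof
  assume "AE x in pow_lborel q. P x"
  then have "AE x in lborel. 0 < ennreal (norm x powr (- q)) \<longrightarrow> P x"
    unfolding pow_lborel_def by (subst (asm) AE_density) auto
  with AE_lborel_singleton[of 0] show "AE x in lborel. P x"
    by eventually_elim (auto simp: ennreal_less_zero_iff)
qed (rule AE_pow_lborel)

lemma powr_le_max:
  fixes y :: real
  assumes "0 < lo" "lo \<le> y" "y \<le> hi"
  shows "y powr q \<le> max (lo powr q) (hi powr q)"
proof (cases "0 \<le> q")
  case True
  then have "y powr q \<le> hi powr q" using assms by (intro powr_mono2) auto
  then show ?thesis by simp
next
  case False
  then have "y powr q \<le> lo powr q" using assms by (intro powr_mono2') auto
  then show ?thesis by simp
qed

text \<open>On a region where the power weight is bounded below, weighted and plain norms compare; together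
  with the converse below this localises weighted norms.\<close>

lemma Lp_le_lborel_of_pow_lborel:
  fixes f :: "'a::euclidean_space \<Rightarrow> real"
  assumes f: "Lp_le p (pow_lborel q) f F" and A[measurable]: "A \<in> sets borel" and p: "0 < p" and a: "0 \<le> a"
    and w: "\<And>x. x \<in> A \<Longrightarrow> x \<noteq> 0 \<and> norm x powr q \<le> a powr p"
  shows "Lp_le p lborel (\<lambda>x. indicator A x * f x) (a * F)"
proof -
  have [measurable]: "f \<in> borel_measurable borel" using Lp_leD(1)[OF f] by (simp add: borel_measurable_pow_lborel)
  have "(\<integral>\<^sup>+x. ennreal (\<bar>indicator A x * f x\<bar> powr p) \<partial>lborel)
    \<le> (\<integral>\<^sup>+x. ennreal (a powr p) * (ennreal (norm x powr (- q)) * ennreal (\<bar>f x\<bar> powr p)) \<partial>lborel)"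
  proof (intro nn_integral_mono)
    fix x
    have "\<bar>f x\<bar> powr p \<le> a powr p * (norm x powr (- q) * \<bar>f x\<bar> powr p)" if "x \<in> A"
    proof -
      have "1 = norm x powr q * norm x powr (- q)" using w[OF that] by (simp add: powr_add[symmetric])
      also have "\<dots> \<le> a powr p * norm x powr (- q)" using w[OF that] by (intro mult_right_mono) auto
      finally show ?thesis using mult_right_mono[of 1 "a powr p * norm x powr (- q)" "\<bar>f x\<bar> powr p"] by (simp add: mult.assoc)
    qed
    then show "ennreal (\<bar>indicator A x * f x\<bar> powr p) \<le> ennreal (a powr p) * (ennreal (norm x powr (- q)) * ennreal (\<bar>f x\<bar> powr p))"
      using p by (auto simp: indicator_def ennreal_mult[symmetric] intro!: ennreal_leI)
  qed
  also have "\<dots> = ennreal (a powr p) * (\<integral>\<^sup>+x. ennreal (\<bar>f x\<bar> powr p) \<partial>pow_lborel q)"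
    by (subst nn_integral_cmult) (auto simp: nn_integral_pow_lborel)
  also have "\<dots> \<le> ennreal (a powr p) * ennreal (F powr p)"
    by (intro mult_left_mono Lp_leD(3)[OF f]) auto
  also have "\<dots> = ennreal ((a * F) powr p)" using Lp_leD(2)[OF f] a by (simp add: ennreal_mult powr_mult)
  finally show ?thesis using Lp_leD(2)[OF f] a by (auto simp: Lp_le_def)
qed

lemma Lp_le_pow_lborel_of_lborel:
  fixes f :: "'a::euclidean_space \<Rightarrow> real"
  assumes f: "Lp_le p lborel (\<lambda>x. indicator A x * f x) F" and p: "0 < p" and a: "0 \<le> a"
    and w: "\<And>x. x \<in> A \<Longrightarrow> norm x powr (- q) \<le> a powr p"
  shows "Lp_le p (pow_lborel q) (\<lambda>x. indicator A x * f x) (a * F)"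
proof -
  have [measurable]: "(\<lambda>x. indicator A x * f x) \<in> borel_measurable borel" using Lp_leD(1)[OF f] by simp
  have "(\<integral>\<^sup>+x. ennreal (\<bar>indicator A x * f x\<bar> powr p) \<partial>pow_lborel q)
    = (\<integral>\<^sup>+x. ennreal (norm x powr (- q)) * ennreal (\<bar>indicator A x * f x\<bar> powr p) \<partial>lborel)"
    by (rule nn_integral_pow_lborel) simp
  also have "\<dots> \<le> (\<integral>\<^sup>+x. ennreal (a powr p) * ennreal (\<bar>indicator A x * f x\<bar> powr p) \<partial>lborel)"
  proof (intro nn_integral_mono)
    fix x
    show "ennreal (norm x powr (- q)) * ennreal (\<bar>indicator A x * f x\<bar> powr p)
       \<le> ennreal (a powr p) * ennreal (\<bar>indicator A x * f x\<bar> powr p)"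
      using w[of x] p by (cases "x \<in> A") (auto intro!: mult_right_mono ennreal_leI)
  qed
  also have "\<dots> = ennreal (a powr p) * (\<integral>\<^sup>+x. ennreal (\<bar>indicator A x * f x\<bar> powr p) \<partial>lborel)"
    by (intro nn_integral_cmult) simp
  also have "\<dots> \<le> ennreal (a powr p) * ennreal (F powr p)"
    by (intro mult_left_mono Lp_leD(3)[OF f]) auto
  also have "\<dots> = ennreal ((a * F) powr p)" using Lp_leD(2)[OF f] a by (simp add: ennreal_mult powr_mult)
  finally show ?thesis using Lp_leD(2)[OF f] a by (auto simp: Lp_le_def)
qed

text \<open>A function has energy at most \<open>\<omega>\<close> if test functions with gradient norm arbitrarily little above
  \<open>\<omega>\<close> approximate it in the norm that Hardy's inequality controls. This needs no gradient of \<open>U\<close> and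
  is what remains, on the whole space, of membership in the completion \<open>W1p\<close>.\<close>

definition energy_le :: "real \<Rightarrow> real \<Rightarrow> ('a::euclidean_space \<Rightarrow> real) \<Rightarrow> real \<Rightarrow> bool" where
  "energy_le p \<mu> U \<omega> \<longleftrightarrow> U \<in> borel_measurable borel \<and> 0 \<le> \<omega> \<and>
     (\<forall>e>0. \<exists>\<phi>. C1c \<phi> \<and> Lp_le p (pow_lborel \<mu>) (\<lambda>x. norm (grad \<phi> x)) (\<omega> + e) \<and>
       Lp_le p (pow_lborel (p + \<mu>)) (\<lambda>x. \<phi> x - U x) e)"

lemma energy_leD:
  assumes "energy_le p \<mu> U \<omega>"
  shows "U \<in> borel_measurable borel" "0 \<le> \<omega>"
  using assms by (auto simp: energy_le_def)

lemma energy_leE: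
  assumes "energy_le p \<mu> U \<omega>" "0 < e"
  obtains \<phi> where "C1c \<phi>" "Lp_le p (pow_lborel \<mu>) (\<lambda>x. norm (grad \<phi> x)) (\<omega> + e)"
     "Lp_le p (pow_lborel (p + \<mu>)) (\<lambda>x. \<phi> x - U x) e"
  using assms unfolding energy_le_def by blast

lemma energy_le_weaken:
  assumes "energy_le p \<mu> U \<omega>" "\<omega> \<le> \<omega>'" "0 \<le> p"
  shows "energy_le p \<mu> U \<omega>'"
  unfolding energy_le_def
proof (intro conjI allI impI)
  fix e :: real assume "0 < e"
  then obtain \<phi> where "C1c \<phi>" "Lp_le p (pow_lborel \<mu>) (\<lambda>x. norm (grad \<phi> x)) (\<omega> + e)" "Lp_le p (pow_lborel (p + \<mu>)) (\<lambda>x. \<phi> x - U x) e"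
    using energy_leE[OF assms(1)] by blast
  then show "\<exists>\<phi>. C1c \<phi> \<and> Lp_le p (pow_lborel \<mu>) (\<lambda>x. norm (grad \<phi> x)) (\<omega>' + e) \<and> Lp_le p (pow_lborel (p + \<mu>)) (\<lambda>x. \<phi> x - U x) e"
    using assms by (intro exI[of _ \<phi>] conjI) (auto elim: Lp_le_weaken)
qed (use energy_leD[OF assms(1)] assms(2) in auto)

lemma energy_le_diff:
  assumes U: "energy_le p \<mu> U \<omega>" and V: "energy_le p \<mu> V \<eta>" and p: "1 \<le> p"
  shows "energy_le p \<mu> (\<lambda>x. U x - V x) (\<omega> + \<eta>)"
  unfolding energy_le_def
proof (intro conjI allI impI)
  note [measurable] = energy_leD(1)[OF U] energy_leD(1)[OF V]
  show "(\<lambda>x. U x - V x) \<in> borel_measurable borel" by measurable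
  show "0 \<le> \<omega> + \<eta>" using energy_leD(2)[OF U] energy_leD(2)[OF V] by simp
  fix e :: real assume "0 < e"
  then have e2: "0 < e / 2" by simp
  obtain \<phi> where \<phi>: "C1c \<phi>" "Lp_le p (pow_lborel \<mu>) (\<lambda>x. norm (grad \<phi> x)) (\<omega> + e/2)" "Lp_le p (pow_lborel (p + \<mu>)) (\<lambda>x. \<phi> x - U x) (e/2)"
    using energy_leE[OF U e2] by blast
  obtain \<psi> where \<psi>: "C1c \<psi>" "Lp_le p (pow_lborel \<mu>) (\<lambda>x. norm (grad \<psi> x)) (\<eta> + e/2)" "Lp_le p (pow_lborel (p + \<mu>)) (\<lambda>x. \<psi> x - V x) (e/2)"
    using energy_leE[OF V e2] by blast
  have 1: "C1 \<phi>" "C1 \<psi>" using \<phi>(1) \<psi>(1) by (auto simp: C1c_def)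
  note [measurable] = C1_grad_measurable[OF 1(1)] C1_grad_measurable[OF 1(2)]
  have "Lp_le p (pow_lborel \<mu>) (\<lambda>x. norm (grad \<phi> x) + norm (grad \<psi> x)) ((\<omega> + e/2) + (\<eta> + e/2))"
    by (intro Lp_le_add \<phi> \<psi> p)
  then have "Lp_le p (pow_lborel \<mu>) (\<lambda>x. norm (grad (\<lambda>x. \<phi> x - \<psi> x) x)) ((\<omega> + e/2) + (\<eta> + e/2))"
    using p by (rule_tac Lp_le_mono) (auto simp: C1_diff[OF 1] borel_measurable_pow_lborel intro!: always_eventually norm_triangle_ineq4)
  moreover have "Lp_le p (pow_lborel (p + \<mu>)) (\<lambda>x. (\<phi> x - U x) - (\<psi> x - V x)) (e/2 + e/2)"
    by (intro Lp_le_diff \<phi> \<psi> p)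
  ultimately show "\<exists>\<phi>. C1c \<phi> \<and> Lp_le p (pow_lborel \<mu>) (\<lambda>x. norm (grad \<phi> x)) (\<omega> + \<eta> + e) \<and> Lp_le p (pow_lborel (p + \<mu>)) (\<lambda>x. \<phi> x - (U x - V x)) e"
    by (intro exI[of _ "\<lambda>x. \<phi> x - \<psi> x"] conjI C1c_diff \<phi> \<psi>) (simp_all add: algebra_simps)
qed

definition Hardy_const :: "real \<Rightarrow> real \<Rightarrow> real \<Rightarrow> real" where
  "Hardy_const N p \<mu> = 1 / (1 - 2 powr ((p + \<mu> - N) / p))"

lemma Hardy_const_pos: "0 < p \<Longrightarrow> p + \<mu> < N \<Longrightarrow> 0 < Hardy_const N p \<mu>"
  by (auto simp: Hardy_const_def powr_less_one divide_neg_pos)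

lemma energy_le_Hardy:
  fixes U :: "'a::euclidean_space \<Rightarrow> real"
  assumes U: "energy_le p \<mu> U \<omega>" and p: "1 \<le> p" and \<mu>: "p + \<mu> < real DIM('a)"
  shows "Lp_le p (pow_lborel (p + \<mu>)) U (Hardy_const (real DIM('a)) p \<mu> * \<omega>)"
proof (rule Lp_le_closed)
  let ?H = "Hardy_const (real DIM('a)) p \<mu>"
  have H: "0 < ?H" using Hardy_const_pos p \<mu> by simp
  fix e :: real assume e: "0 < e"
  define d where "d = e / (?H + 1)"
  have "0 < d" using e H by (simp add: d_def)
  then obtain \<phi> where \<phi>: "C1c \<phi>" "Lp_le p (pow_lborel \<mu>) (\<lambda>x. norm (grad \<phi> x)) (\<omega> + d)" "Lp_le p (pow_lborel (p + \<mu>)) (\<lambda>x. \<phi> x - U x) d"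
    using energy_leE[OF U] by blast
  have "Lp_le p (pow_lborel (p + \<mu>)) \<phi> (?H * (\<omega> + d))"
    using Hardy[OF \<phi>(1) p \<mu> \<phi>(2)] by (simp add: Hardy_const_def)
  from Lp_le_diff[OF this \<phi>(3) p]
  have "Lp_le p (pow_lborel (p + \<mu>)) U (?H * (\<omega> + d) + d)" by simp
  also have "?H * (\<omega> + d) + d = ?H * \<omega> + d * (?H + 1)" by (simp add: algebra_simps)
  also have "d * (?H + 1) = e" using H by (simp add: d_def)
  finally show "Lp_le p (pow_lborel (p + \<mu>)) U (?H * \<omega> + e)" .
qed (use p in simp)

text \<open>The estimate of \<open>Lp_le_avg_error\<close> for limits of test functions. Hardy's inequality yields
  convergence in \<open>L\<^sup>p\<close> on \<open>A'\<close>, hence convergence of the means in \<open>L\<^sup>r\<close> on \<open>A\<close>. The means of \<open>U\<close> are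
  left as a hypothesis: sometimes they are bounded and sometimes they are small.\<close>

lemma energy_le_local:
  fixes U :: "'a::euclidean_space \<Rightarrow> real"
  defines "N \<equiv> real DIM('a)"
  assumes U: "energy_le p \<mu> U \<omega>" and p: "1 \<le> p" "p \<le> r" and \<mu>: "p + \<mu> < N"
    and \<alpha>: "0 < N / r + 1 - N / p"
    and A: "A \<in> sets borel" "A' \<in> sets borel" and t: "0 < t"
    and sub: "\<And>x. x \<in> A \<Longrightarrow> nbhd t x \<subseteq> A'"
    and a: "0 \<le> a" "\<And>x. x \<in> A' \<Longrightarrow> x \<noteq> 0 \<and> norm x powr \<mu> \<le> a powr p"
    and b: "0 \<le> b" "\<And>x. x \<in> A' \<Longrightarrow> norm x powr (p + \<mu>) \<le> b powr p"
    and e: "Lp_le r lborel (\<lambda>x. indicator A x * avg t U x) e"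
  shows "Lp_le r lborel (\<lambda>x. indicator A x * U x) (Poincare_const N p r * t powr (N / r + 1 - N / p) * (a * \<omega>) + e)"
proof -
  note [measurable] = energy_leD(1)[OF U] A
  let ?P = "Poincare_const N p r * t powr (N / r + 1 - N / p)"
  let ?c = "2 powr (N / r) * t powr (N / r - N / p)"
  have "\<forall>n. \<exists>\<phi>. C1c \<phi> \<and> Lp_le p (pow_lborel \<mu>) (\<lambda>x. norm (grad \<phi> x)) (\<omega> + (1/2)^n) \<and> Lp_le p (pow_lborel (p + \<mu>)) (\<lambda>x. \<phi> x - U x) ((1/2)^n)"
    using U by (auto simp: energy_le_def)
  then obtain \<phi> where \<phi>: "\<And>n. C1c (\<phi> n)" "\<And>n. Lp_le p (pow_lborel \<mu>) (\<lambda>x. norm (grad (\<phi> n) x)) (\<omega> + (1/2)^n)"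
     "\<And>n. Lp_le p (pow_lborel (p + \<mu>)) (\<lambda>x. \<phi> n x - U x) ((1/2)^n)" by metis
  have C1: "C1 (\<phi> n)" for n using \<phi>(1) by (simp add: C1c_def)
  note [measurable] = C1_measurable[OF C1]
  have UL: "Lp_le p lborel (\<lambda>x. indicator A' x * U x) (b * (Hardy_const N p \<mu> * \<omega>))"
    using energy_le_Hardy[OF U p(1)] \<mu> b a(2) p by (intro Lp_le_lborel_of_pow_lborel) (auto simp: N_def)
  have dL: "Lp_le p lborel (\<lambda>x. indicator A' x * (\<phi> n x - U x)) (b * (1/2)^n)" for n
    using b a(2) p by (intro Lp_le_lborel_of_pow_lborel[OF \<phi>(3)]) auto
  have \<phi>L: "Lp_le p lborel (\<lambda>x. indicator A' x * \<phi> n x) (b * (1/2)^n + b * (Hardy_const N p \<mu> * \<omega>))" for n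
    using Lp_le_add[OF dL UL p(1), of n] by (simp add: algebra_simps)
  have bound: "Lp_le r lborel (\<lambda>x. indicator A x * \<phi> n x) (?P * (a * (\<omega> + (1/2)^n)) + (?c * (b * (1/2)^n) + e))" for n
  proof -
    have "Lp_le p lborel (\<lambda>x. indicator A' x * norm (grad (\<phi> n) x)) (a * (\<omega> + (1/2)^n))"
      using a p by (intro Lp_le_lborel_of_pow_lborel[OF \<phi>(2)]) auto
    then have 1: "Lp_le r lborel (\<lambda>x. indicator A x * (\<phi> n x - avg t (\<phi> n) x)) (?P * (a * (\<omega> + (1/2)^n)))"
      unfolding N_def using \<alpha> A t p sub by (intro Lp_le_avg_error C1) (auto simp: N_def)
    have "Lp_le r lborel (\<lambda>x. indicator A x * avg t (\<lambda>x. \<phi> n x - U x) x) (?c * (b * (1/2)^n))"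
      unfolding N_def by (rule Lp_le_avg[OF _ A t p sub dL]) auto
    moreover have "indicator A x * avg t (\<lambda>x. \<phi> n x - U x) x = indicator A x * (avg t (\<phi> n) x - avg t U x)" for x
    proof (cases "x \<in> A")
      case True
      show ?thesis by (subst avg_diff[OF _ _ t p(1) sub[OF True] \<phi>L UL]) auto
    qed simp
    ultimately have 2: "Lp_le r lborel (\<lambda>x. indicator A x * (avg t (\<phi> n) x - avg t U x)) (?c * (b * (1/2)^n))" by simp
    have "Lp_le r lborel (\<lambda>x. indicator A x * (\<phi> n x - avg t (\<phi> n) x) + (indicator A x * (avg t (\<phi> n) x - avg t U x) + indicator A x * avg t U x))
      (?P * (a * (\<omega> + (1/2)^n)) + (?c * (b * (1/2)^n) + e))"
      using p by (intro Lp_le_add 1 2 e) auto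
    then show ?thesis by (simp add: algebra_simps)
  qed
  show ?thesis
  proof (rule Lp_le_Fatou[OF bound])
    show "(\<lambda>n. ?P * (a * (\<omega> + (1/2)^n)) + (?c * (b * (1/2)^n) + e)) \<longlonglongrightarrow> ?P * (a * \<omega>) + e"
    proof -
      have "(\<lambda>n. ?P * (a * (\<omega> + (1/2)^n)) + (?c * (b * (1/2)^n) + e)) \<longlonglongrightarrow> ?P * (a * (\<omega> + 0)) + (?c * (b * 0) + e)"
        by (intro tendsto_add tendsto_mult tendsto_const LIMSEQ_power_zero) auto
      then show ?thesis by simp
    qed
    have "AE x in lborel. (\<lambda>n. \<phi> n x) \<longlonglongrightarrow> U x"
      using Lp_le_fast_AE_tendsto[OF \<phi>(3) p(1)] by (simp add: AE_pow_lborel_iff)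
    then show "AE x in lborel. (\<lambda>n. indicator A x * \<phi> n x) \<longlonglongrightarrow> indicator A x * U x"
      by eventually_elim (rule tendsto_mult[OF tendsto_const])
  qed (use p in auto)
qed

definition annulus :: "real \<Rightarrow> 'a::euclidean_space set" where
  "annulus \<rho> = {x. \<rho> \<le> norm x \<and> norm x < 2 * \<rho>}"

lemma annulus_borel[measurable]: "annulus \<rho> \<in> sets borel"
  unfolding annulus_def by measurable

lemma annulus_powr_le:
  fixes \<rho> y q :: real
  assumes "0 < \<rho>" "\<rho> / 2 \<le> y" "y \<le> 3 * \<rho>"
  shows "y powr q \<le> 3 powr \<bar>q\<bar> * \<rho> powr q"
proof (cases "0 \<le> q")
  case True
  then have "y powr q \<le> (3 * \<rho>) powr q" using assms by (intro powr_mono2) auto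
  then show ?thesis using assms True by (simp add: powr_mult)
next
  case False
  then have "y powr q \<le> (\<rho> / 2) powr q" using assms by (intro powr_mono2') auto
  also have "\<dots> = 2 powr \<bar>q\<bar> * \<rho> powr q" using assms False by (simp add: powr_divide powr_minus field_simps)
  also have "\<dots> \<le> 3 powr \<bar>q\<bar> * \<rho> powr q" by (intro mult_right_mono powr_mono2) auto
  finally show ?thesis .
qed

text \<open>The mesh \<open>t\<close> remains free here; its choice relative to \<open>\<rho>\<close> distinguishes the behaviour near the
  origin from that near infinity.\<close>

lemma energy_le_annulus:
  fixes U :: "'a::euclidean_space \<Rightarrow> real"
  defines "N \<equiv> real DIM('a)"
  assumes U: "energy_le p \<mu> U \<omega>" and p: "1 \<le> p" "p \<le> r" and \<mu>: "p + \<mu> < N"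
    and \<alpha>: "0 < N / r + 1 - N / p"
    and \<rho>: "0 < \<rho>" and t: "0 < t" "2 * N * t \<le> \<rho>"
    and L: "Lp_le p lborel (\<lambda>x. indicator {x. \<rho> / 2 \<le> norm x \<and> norm x \<le> 3 * \<rho>} x * U x) L"
  shows "Lp_le r lborel (\<lambda>x. indicator (annulus \<rho>) x * U x)
    (Poincare_const N p r * t powr (N / r + 1 - N / p) * (3 powr (\<bar>\<mu>\<bar> / p) * \<rho> powr (\<mu> / p) * \<omega>)
     + 2 powr (N / r) * t powr (N / r - N / p) * L)"
  unfolding N_def
proof (rule energy_le_local[OF U p \<mu>[unfolded N_def] \<alpha>[unfolded N_def],
      where A'="{x::'a. \<rho> / 2 \<le> norm x \<and> norm x \<le> 3 * \<rho>}"
      and b="3 powr (\<bar>p + \<mu>\<bar> / p) * \<rho> powr ((p + \<mu>) / p)"])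
  let ?A' = "{x::'a. \<rho> / 2 \<le> norm x \<and> norm x \<le> 3 * \<rho>}"
  show "nbhd t x \<subseteq> ?A'" if x: "x \<in> annulus \<rho>" for x :: 'a
  proof
    fix y assume "y \<in> nbhd t x"
    then have "norm (y - x) \<le> \<rho> / 2" using norm_nbhd[of y t x] t by (simp add: N_def)
    then show "y \<in> ?A'" using x norm_triangle_ineq2[of x y] norm_triangle_ineq2[of y x]
      by (auto simp: annulus_def norm_minus_commute)
  qed
  show "?A' \<in> sets borel" by measurable
  then show "Lp_le r lborel (\<lambda>x. indicator (annulus \<rho>) x * avg t U x) (2 powr (real DIM('a) / r) * t powr (real DIM('a) / r - real DIM('a) / p) * L)"
    using \<open>\<And>x. x \<in> annulus \<rho> \<Longrightarrow> nbhd t x \<subseteq> ?A'\<close>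
    by (intro Lp_le_avg[OF energy_leD(1)[OF U] _ _ t(1) p _ L]) auto
  fix x :: 'a assume x: "x \<in> ?A'"
  have "3 powr \<bar>\<mu>\<bar> * \<rho> powr \<mu> = (3 powr (\<bar>\<mu>\<bar> / p) * \<rho> powr (\<mu> / p)) powr p"
    using p by (simp add: powr_mult powr_powr)
  then show "x \<noteq> 0 \<and> norm x powr \<mu> \<le> (3 powr (\<bar>\<mu>\<bar> / p) * \<rho> powr (\<mu> / p)) powr p"
    using annulus_powr_le[of \<rho> "norm x" \<mu>] x \<rho> by auto
  have "3 powr \<bar>p + \<mu>\<bar> * \<rho> powr (p + \<mu>) = (3 powr (\<bar>p + \<mu>\<bar> / p) * \<rho> powr ((p + \<mu>) / p)) powr p"
    using p by (simp add: powr_mult powr_powr)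
  then show "norm x powr (p + \<mu>) \<le> (3 powr (\<bar>p + \<mu>\<bar> / p) * \<rho> powr ((p + \<mu>) / p)) powr p"
    using annulus_powr_le[of \<rho> "norm x" "p + \<mu>"] x \<rho> by auto
qed (use t in auto)

lemma Lp_le_geometric_pieces:
  fixes A :: "nat \<Rightarrow> 'b set"
  assumes piece: "\<And>j. Lp_le r M (\<lambda>x. indicator (A j) x * f x) (K * q ^ j)"
    and f[measurable]: "f \<in> borel_measurable M" and A[measurable]: "\<And>j. A j \<in> sets M"
    and q: "0 \<le> q" "q < 1" and r: "1 \<le> r" and K: "0 \<le> K"
  shows "Lp_le r M (\<lambda>x. indicator (\<Union>j\<in>{J..}. A j) x * f x) (K * q ^ J / (1 - q))"
proof (rule Lp_le_Fatou[where f="\<lambda>m x. indicator (\<Union>j\<in>{J..<J+m}. A j) x * f x" and F="\<lambda>_. K * q ^ J / (1 - q)"])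
  show "Lp_le r M (\<lambda>x. indicator (\<Union>j\<in>{J..<J+m}. A j) x * f x) (K * q ^ J / (1 - q))" for m
  proof -
    have "Lp_le r M (\<lambda>x. \<Sum>j\<in>{J..<J+m}. \<bar>indicator (A j) x * f x\<bar>) (\<Sum>j\<in>{J..<J+m}. K * q ^ j)"
    proof (rule Lp_le_sum)
      show "Lp_le r M (\<lambda>x. \<bar>indicator (A j) x * f x\<bar>) (K * q ^ j)" for j
        using r by (intro Lp_le_mono[OF piece]) auto
    qed fact
    moreover have "(\<Sum>j\<in>{J..<J+m}. K * q ^ j) \<le> K * q ^ J / (1 - q)"
    proof -
      have "(\<Sum>j\<in>{J..<J+m}. K * q ^ j) = K * q ^ J * (\<Sum>j<m. q ^ j)"
        using sum.shift_bounds_nat_ivl[of "\<lambda>j. K * q ^ j" 0 J m]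
        by (simp add: sum_distrib_left atLeast0LessThan power_add mult_ac add.commute)
      also have "(\<Sum>j<m. q ^ j) \<le> (\<Sum>j. q ^ j)" using q by (intro sum_le_suminf summable_geometric) auto
      also have "(\<Sum>j. q ^ j) = 1 / (1 - q)" using q by (intro suminf_geometric) auto
      finally show ?thesis using K q by (simp add: mult_left_mono)
    qed
    ultimately have "Lp_le r M (\<lambda>x. \<Sum>j\<in>{J..<J+m}. \<bar>indicator (A j) x * f x\<bar>) (K * q ^ J / (1 - q))"
      using r by (auto intro: Lp_le_weaken)
    then show ?thesis
    proof (rule Lp_le_mono)
      show "AE x in M. \<bar>indicator (\<Union>j\<in>{J..<J+m}. A j) x * f x\<bar> \<le> \<bar>\<Sum>j\<in>{J..<J+m}. \<bar>indicator (A j) x * f x\<bar>\<bar>"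
      proof (intro always_eventually allI)
        fix x
        show "\<bar>indicator (\<Union>j\<in>{J..<J+m}. A j) x * f x\<bar> \<le> \<bar>\<Sum>j\<in>{J..<J+m}. \<bar>indicator (A j) x * f x\<bar>\<bar>"
        proof (cases "x \<in> (\<Union>j\<in>{J..<J+m}. A j)")
          case True
          then obtain i where i: "i \<in> {J..<J+m}" "x \<in> A i" by blast
          then have "\<bar>f x\<bar> \<le> (\<Sum>j\<in>{J..<J+m}. \<bar>indicator (A j) x * f x\<bar>)"
            using member_le_sum[OF i(1), of "\<lambda>j. \<bar>indicator (A j) x * f x\<bar>"] by simp
          then show ?thesis using True by simp
        qed simp
      qed
    qed (use r in auto)
  qed
  show "AE x in M. (\<lambda>m. indicator (\<Union>j\<in>{J..<J+m}. A j) x * f x) \<longlonglongrightarrow> indicator (\<Union>j\<in>{J..}. A j) x * f x"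
  proof (intro always_eventually allI)
    fix x
    show "(\<lambda>m. indicator (\<Union>j\<in>{J..<J+m}. A j) x * f x) \<longlonglongrightarrow> indicator (\<Union>j\<in>{J..}. A j) x * f x"
    proof (cases "x \<in> (\<Union>j\<in>{J..}. A j)")
      case True
      then obtain i where i: "i \<ge> J" "x \<in> A i" by auto
      have "\<forall>\<^sub>F m in sequentially. indicator (\<Union>j\<in>{J..<J+m}. A j) x * f x = indicator (\<Union>j\<in>{J..}. A j) x * f x"
        using eventually_ge_at_top[of "Suc i - J"]
      proof eventually_elim
        case (elim m)
        then have "x \<in> (\<Union>j\<in>{J..<J+m}. A j)" using i by (intro UN_I[of i]) auto
        then show ?case using True by simp
      qed
      then show ?thesis by (rule tendsto_eventually)
    next
      case False
      then have "x \<notin> (\<Union>j\<in>{J..<J+m}. A j)" for m by auto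
      then show ?thesis using False by simp
    qed
  qed
qed (use r in auto)

section \<open>Estimates near the origin and near infinity\<close>

text \<open>
  \<open>subcritical\<close> puts \<open>r\<close> below the Sobolev exponent, \<open>subcritical_origin\<close> below the weighted
  Hardy--Sobolev exponent, and \<open>decay_infinity\<close> is the lower bound on \<open>s\<close>, all solved for the powers of
  the radius in which they are used. The parameter \<open>d\<close> carries the type of the underlying space.
\<close>

locale exponents =
  fixes d :: "'a::euclidean_space itself" and N p r s \<mu> :: real
  assumes N_eq: "N = real DIM('a)"
    and p: "1 < p" "p \<le> r"
    and Hardy_range: "0 < p + \<mu>" "p + \<mu> < N"
    and subcritical: "N / p < N / r + 1"
    and subcritical_origin: "s / r < N / r + 1 - N / p + \<mu> / p"
    and decay_infinity: "(N / p - N / r) * max \<mu> 0 / p < s / r"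
begin

text \<open>The exponent of the mesh in the local estimate, and the decay rates of the weighted norm over an
  annulus near the origin and near infinity.\<close>

definition \<alpha> :: real where "\<alpha> = N / r + 1 - N / p"
definition \<beta> :: real where "\<beta> = \<alpha> + \<mu> / p - s / r"
definition \<gamma> :: real where "\<gamma> = s / r - (1 - \<alpha>) * max \<mu> 0 / p"

lemma N_pos: "0 < N" using N_eq by simp
lemma \<alpha>_pos: "0 < \<alpha>" using subcritical by (simp add: \<alpha>_def)
lemma \<beta>_pos: "0 < \<beta>" using subcritical_origin by (simp add: \<beta>_def \<alpha>_def)
lemma \<gamma>_pos: "0 < \<gamma>" using decay_infinity by (simp add: \<gamma>_def \<alpha>_def)
lemma r_gt_1: "1 < r" using p by simp

lemma Poincare_const_nonneg: "0 \<le> Poincare_const N p r"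
proof -
  have "2 powr (- \<alpha>) < 1" using \<alpha>_pos by (simp add: powr_less_one)
  then show ?thesis unfolding Poincare_const_def \<alpha>_def[symmetric] using N_pos by simp
qed

lemma annulus_bound:
  fixes U :: "'a \<Rightarrow> real"
  assumes U: "energy_le p \<mu> U \<omega>" and \<rho>: "0 < \<rho>" and t: "0 < t" "2 * N * t \<le> \<rho>"
    and L: "Lp_le p lborel (\<lambda>x. indicator {x. \<rho> / 2 \<le> norm x \<and> norm x \<le> 3 * \<rho>} x * U x) L"
  shows "Lp_le r (pow_lborel s) (\<lambda>x. indicator (annulus \<rho>) x * U x)
    (3 powr (\<bar>s\<bar> / r) * \<rho> powr (- s / r) * (Poincare_const N p r * t powr \<alpha> * (3 powr (\<bar>\<mu>\<bar> / p) * \<rho> powr (\<mu> / p) * \<omega>)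
     + 2 powr (N / r) * t powr (\<alpha> - 1) * L))"
proof (rule Lp_le_pow_lborel_of_lborel)
  show "Lp_le r lborel (\<lambda>x. indicator (annulus \<rho>) x * U x)
    (Poincare_const N p r * t powr \<alpha> * (3 powr (\<bar>\<mu>\<bar> / p) * \<rho> powr (\<mu> / p) * \<omega>)
     + 2 powr (N / r) * t powr (\<alpha> - 1) * L)"
    using energy_le_annulus[OF U _ p(2), folded N_eq, OF _ Hardy_range(2) _ \<rho> t L] p subcritical by (simp add: \<alpha>_def)
  fix x :: 'a assume "x \<in> annulus \<rho>"
  then have "norm x powr (- s) \<le> 3 powr \<bar>- s\<bar> * \<rho> powr (- s)"
    using \<rho> by (intro annulus_powr_le) (auto simp: annulus_def)
  also have "\<dots> = (3 powr (\<bar>s\<bar> / r) * \<rho> powr (- s / r)) powr r"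
    using r_gt_1 by (simp add: powr_mult powr_powr)
  finally show "norm x powr (- s) \<le> (3 powr (\<bar>s\<bar> / r) * \<rho> powr (- s / r)) powr r" .
qed (use r_gt_1 in auto)

text \<open>With a mesh proportional to \<open>\<rho>\<close>, both terms of the local estimate scale alike, and only the energy
  enters. The exponent \<open>\<beta>\<close> is positive, so the bound is useful near the origin; near infinity it still
  shows growth of at most polynomial order.\<close>

lemma annulus_bound_scale_invariant:
  obtains C where "0 \<le> C" "\<And>(U :: 'a \<Rightarrow> real) \<omega> \<rho>. energy_le p \<mu> U \<omega> \<Longrightarrow> 0 < \<rho> \<Longrightarrow>
    Lp_le r (pow_lborel s) (\<lambda>x. indicator (annulus \<rho>) x * U x) (C * \<omega> * \<rho> powr \<beta>)"
proof -
  define c where "c = 3 powr (\<bar>s\<bar> / r) * (Poincare_const N p r * (1 / (2 * N)) powr \<alpha> * 3 powr (\<bar>\<mu>\<bar> / p)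
    + 2 powr (N / r) * (1 / (2 * N)) powr (\<alpha> - 1) * 3 powr (\<bar>p + \<mu>\<bar> / p) * Hardy_const N p \<mu>)"
  have H: "0 < Hardy_const N p \<mu>" using Hardy_const_pos[of p \<mu> N] p Hardy_range by simp
  show thesis
  proof (rule that)
    show "0 \<le> c" unfolding c_def using Poincare_const_nonneg H by (intro mult_nonneg_nonneg add_nonneg_nonneg) auto
    fix U :: "'a \<Rightarrow> real" and \<omega> \<rho> :: real
    assume U: "energy_le p \<mu> U \<omega>" and \<rho>: "0 < \<rho>"
    define t where "t = \<rho> * (1 / (2 * N))"
    have t: "0 < t" "2 * N * t \<le> \<rho>" using \<rho> N_pos by (auto simp: t_def)
    have L: "Lp_le p lborel (\<lambda>x. indicator {x. \<rho> / 2 \<le> norm x \<and> norm x \<le> 3 * \<rho>} x * U x)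
      (3 powr (\<bar>p + \<mu>\<bar> / p) * \<rho> powr ((p + \<mu>) / p) * (Hardy_const N p \<mu> * \<omega>))"
    proof (rule Lp_le_lborel_of_pow_lborel[OF energy_le_Hardy[OF U, folded N_eq]])
      fix x :: 'a assume x: "x \<in> {x. \<rho> / 2 \<le> norm x \<and> norm x \<le> 3 * \<rho>}"
      then have "norm x powr (p + \<mu>) \<le> 3 powr \<bar>p + \<mu>\<bar> * \<rho> powr (p + \<mu>)"
        using \<rho> by (intro annulus_powr_le) auto
      also have "\<dots> = (3 powr (\<bar>p + \<mu>\<bar> / p) * \<rho> powr ((p + \<mu>) / p)) powr p"
        using p by (simp add: powr_mult powr_powr)
      finally show "x \<noteq> 0 \<and> norm x powr (p + \<mu>) \<le> (3 powr (\<bar>p + \<mu>\<bar> / p) * \<rho> powr ((p + \<mu>) / p)) powr p"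
        using x \<rho> by auto
    qed (use p Hardy_range in auto)
    have e: "\<rho> powr (- s / r) * (\<rho> powr \<alpha> * \<rho> powr (\<mu> / p)) = \<rho> powr \<beta>"
      "\<rho> powr (- s / r) * (\<rho> powr (\<alpha> - 1) * \<rho> powr ((p + \<mu>) / p)) = \<rho> powr \<beta>"
      unfolding powr_add[symmetric] using p by (simp_all add: \<beta>_def add_divide_distrib algebra_simps)
    have tp: "t powr q = \<rho> powr q * (1 / (2 * N)) powr q" for q
      unfolding t_def using \<rho> N_pos by (intro powr_mult)
    have "3 powr (\<bar>s\<bar> / r) * \<rho> powr (- s / r) * (Poincare_const N p r * t powr \<alpha> * (3 powr (\<bar>\<mu>\<bar> / p) * \<rho> powr (\<mu> / p) * \<omega>)
     + 2 powr (N / r) * t powr (\<alpha> - 1) * (3 powr (\<bar>p + \<mu>\<bar> / p) * \<rho> powr ((p + \<mu>) / p) * (Hardy_const N p \<mu> * \<omega>)))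
     = 3 powr (\<bar>s\<bar> / r) * (Poincare_const N p r * (1 / (2 * N)) powr \<alpha> * 3 powr (\<bar>\<mu>\<bar> / p) * \<omega> * (\<rho> powr (- s / r) * (\<rho> powr \<alpha> * \<rho> powr (\<mu> / p)))
    + 2 powr (N / r) * (1 / (2 * N)) powr (\<alpha> - 1) * 3 powr (\<bar>p + \<mu>\<bar> / p) * Hardy_const N p \<mu> * \<omega> * (\<rho> powr (- s / r) * (\<rho> powr (\<alpha> - 1) * \<rho> powr ((p + \<mu>) / p))))"
      unfolding tp by (simp only: distrib_left mult_ac)
    also have "\<dots> = c * \<omega> * \<rho> powr \<beta>"
      unfolding e c_def by (simp only: distrib_left distrib_right mult_ac)
    finally show "Lp_le r (pow_lborel s) (\<lambda>x. indicator (annulus \<rho>) x * U x) (c * \<omega> * \<rho> powr \<beta>)"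
      using annulus_bound[OF U \<rho> t L] by simp
  qed
qed

text \<open>For \<open>\<mu> > 0\<close> the mesh shrinks like \<open>\<rho> powr (- \<mu> / p)\<close>, which balances the growing bound on the
  gradient against the loss in the means; for \<open>\<mu> \<le> 0\<close> it is constant. The \<open>L\<^sup>p\<close> norm takes the place
  of Hardy's inequality.\<close>

lemma annulus_bound_far:
  obtains C where "0 \<le> C" "\<And>(U :: 'a \<Rightarrow> real) \<omega> L \<rho>. energy_le p \<mu> U \<omega> \<Longrightarrow> Lp_le p lborel U L \<Longrightarrow> 1 \<le> \<rho> \<Longrightarrow>
    Lp_le r (pow_lborel s) (\<lambda>x. indicator (annulus \<rho>) x * U x) (C * (\<omega> + L) * \<rho> powr (- \<gamma>))"
proof -
  define m where "m = max \<mu> 0"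
  define c1 where "c1 = 3 powr (\<bar>s\<bar> / r) * (Poincare_const N p r * (1 / (2 * N)) powr \<alpha> * 3 powr (\<bar>\<mu>\<bar> / p))"
  define c2 where "c2 = 3 powr (\<bar>s\<bar> / r) * (2 powr (N / r) * (1 / (2 * N)) powr (\<alpha> - 1))"
  have c: "0 \<le> c1" "0 \<le> c2" unfolding c1_def c2_def using Poincare_const_nonneg by auto
  show thesis
  proof (rule that)
    show "0 \<le> c1 + c2" using c by simp
    fix U :: "'a \<Rightarrow> real" and \<omega> L \<rho> :: real
    assume U: "energy_le p \<mu> U \<omega>" and L: "Lp_le p lborel U L" and \<rho>: "1 \<le> \<rho>"
    define t where "t = \<rho> powr (- m / p) * (1 / (2 * N))"
    have t0: "0 < t" using \<rho> N_pos by (auto simp: t_def)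
    have "\<rho> powr (- m / p) \<le> 1" using \<rho> p powr_mono[of "- m / p" 0 \<rho>] by (simp add: m_def)
    then have t: "2 * N * t \<le> \<rho>" using \<rho> N_pos by (simp add: t_def)
    have L': "Lp_le p lborel (\<lambda>x. indicator {x. \<rho> / 2 \<le> norm x \<and> norm x \<le> 3 * \<rho>} x * U x) L"
      using p Lp_leD(1)[OF L] by (intro Lp_le_mono[OF L]) (auto simp: indicator_def)
    have tp: "t powr q = \<rho> powr (- m / p * q) * (1 / (2 * N)) powr q" for q
      by (simp only: t_def powr_mult powr_powr)
    have e1: "\<rho> powr (- s / r) * (\<rho> powr (- m / p * \<alpha>) * \<rho> powr (\<mu> / p)) \<le> \<rho> powr (- \<gamma>)"
    proof -
      have "- s / r + (- m / p * \<alpha> + \<mu> / p) \<le> - \<gamma>"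
        using p by (simp add: \<gamma>_def m_def[symmetric] field_simps) (simp add: m_def)
      then show ?thesis unfolding powr_add[symmetric] using \<rho> by (intro powr_mono)
    qed
    have e2: "\<rho> powr (- s / r) * \<rho> powr (- m / p * (\<alpha> - 1)) = \<rho> powr (- \<gamma>)"
    proof -
      have "- s / r + - m / p * (\<alpha> - 1) = - \<gamma>"
        unfolding \<gamma>_def m_def[symmetric] by (simp add: diff_divide_distrib algebra_simps)
      then show ?thesis unfolding powr_add[symmetric] by simp
    qed
    have \<omega>: "0 \<le> \<omega>" "0 \<le> L" using energy_leD(2)[OF U] Lp_leD(2)[OF L] by auto
    have "3 powr (\<bar>s\<bar> / r) * \<rho> powr (- s / r) * (Poincare_const N p r * t powr \<alpha> * (3 powr (\<bar>\<mu>\<bar> / p) * \<rho> powr (\<mu> / p) * \<omega>)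
     + 2 powr (N / r) * t powr (\<alpha> - 1) * L)
     = c1 * \<omega> * (\<rho> powr (- s / r) * (\<rho> powr (- m / p * \<alpha>) * \<rho> powr (\<mu> / p))) + c2 * L * (\<rho> powr (- s / r) * \<rho> powr (- m / p * (\<alpha> - 1)))"
      unfolding tp c1_def c2_def by (simp only: distrib_left mult_ac)
    also have "\<dots> \<le> c1 * \<omega> * \<rho> powr (- \<gamma>) + c2 * L * \<rho> powr (- \<gamma>)"
      unfolding e2 using c \<omega> by (intro add_mono mult_left_mono e1) auto
    also have "\<dots> \<le> (c1 + c2) * (\<omega> + L) * \<rho> powr (- \<gamma>)"
      using c \<omega> by (simp add: algebra_simps)
    finally show "Lp_le r (pow_lborel s) (\<lambda>x. indicator (annulus \<rho>) x * U x) ((c1 + c2) * (\<omega> + L) * \<rho> powr (- \<gamma>))"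
      using Lp_le_weaken[OF annulus_bound[OF U _ t0 t L']] \<rho> r_gt_1 by simp
  qed
qed

lemma punctured_ball_annuli:
  "{x::'a. x \<noteq> 0 \<and> norm x < 1 / 2 ^ J} = (\<Union>j\<in>{J..}. annulus (1 / 2 ^ Suc j))"
proof (intro set_eqI iffI)
  fix x :: 'a assume x: "x \<in> {x. x \<noteq> 0 \<and> norm x < 1 / 2 ^ J}"
  have "\<exists>j. 1 / 2 ^ Suc j \<le> norm x"
  proof -
    have "(\<lambda>j. 1 / 2 ^ Suc j) \<longlonglongrightarrow> (0::real)" by real_asymp
    then have "\<forall>\<^sub>F j in sequentially. 1 / 2 ^ Suc j < norm x" using x by (intro order_tendstoD(2)) auto
    then show ?thesis by (auto simp: eventually_sequentially intro: less_imp_le)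
  qed
  define j where "j = (LEAST j. 1 / 2 ^ Suc j \<le> norm x)"
  have j: "1 / 2 ^ Suc j \<le> norm x" unfolding j_def using \<open>\<exists>j. _\<close> by (rule LeastI_ex)
  have lt: "norm x < 1 / 2 ^ j"
  proof (cases j)
    case 0
    then show ?thesis using x less_le_trans[of "norm x" "1 / 2 ^ J" 1] by simp
  next
    case (Suc i)
    then have "\<not> 1 / 2 ^ Suc i \<le> norm x" unfolding j_def by (intro not_less_Least) simp
    then show ?thesis using Suc by simp
  qed
  have "J \<le> j"
  proof (rule ccontr)
    assume "\<not> J \<le> j"
    then have "(1::real) / 2 ^ J \<le> 1 / 2 ^ Suc j" by (intro divide_left_mono power_increasing) auto
    then show False using j x by simp
  qed
  then show "x \<in> (\<Union>j\<in>{J..}. annulus (1 / 2 ^ Suc j))" using j lt by (auto simp: annulus_def)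
next
  fix x :: 'a assume "x \<in> (\<Union>j\<in>{J..}. annulus (1 / 2 ^ Suc j))"
  then obtain j where j: "J \<le> j" "1 / 2 ^ Suc j \<le> norm x" "norm x < 1 / 2 ^ j" by (auto simp: annulus_def)
  have "(1::real) / 2 ^ j \<le> 1 / 2 ^ J" using j(1) by (intro divide_left_mono power_increasing) auto
  moreover have "0 < norm x" using j(2) by (rule less_le_trans[rotated]) simp
  ultimately show "x \<in> {x. x \<noteq> 0 \<and> norm x < 1 / 2 ^ J}" using j(3) by auto
qed

lemma exterior_annuli:
  "{x::'a. 2 ^ J \<le> norm x} = (\<Union>j\<in>{J..}. annulus (2 ^ j))"
proof (intro set_eqI iffI)
  fix x :: 'a assume x: "x \<in> {x. 2 ^ J \<le> norm x}"
  obtain j where j0: "norm x < 2 ^ Suc j"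
    using real_arch_pow[of 2 "norm x"] by (metis less_trans one_less_numeral_iff power_strict_increasing_iff lessI semiring_norm(76) real_arch_pow)
  define i where "i = (LEAST j. norm x < 2 ^ Suc j)"
  have i: "norm x < 2 ^ Suc i" unfolding i_def using j0 by (rule LeastI)
  have le: "2 ^ i \<le> norm x"
  proof (cases i)
    case 0
    then show ?thesis using x order_trans[of 1 "2 ^ J" "norm x"] by simp
  next
    case (Suc k)
    then have "\<not> norm x < 2 ^ Suc k" unfolding i_def by (intro not_less_Least) simp
    then show ?thesis using Suc by simp
  qed
  have "J \<le> i"
  proof (rule ccontr)
    assume "\<not> J \<le> i"
    then have "(2::real) ^ Suc i \<le> 2 ^ J" by (intro power_increasing) auto
    then show False using i x by simp
  qed
  then show "x \<in> (\<Union>j\<in>{J..}. annulus (2 ^ j))" using i le by (auto simp: annulus_def)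
next
  fix x :: 'a assume "x \<in> (\<Union>j\<in>{J..}. annulus (2 ^ j))"
  then obtain j where j: "J \<le> j" "2 ^ j \<le> norm x" by (auto simp: annulus_def)
  then have "(2::real) ^ J \<le> 2 ^ j" by (intro power_increasing) auto
  then show "x \<in> {x. 2 ^ J \<le> norm x}" using order_trans j(2) by blast
qed

lemma two_power_powr: "(2 ^ j) powr e = (2 powr e) ^ j" "(1 / 2 ^ j) powr e = (2 powr (- e)) ^ j" for e :: real and j :: nat
proof -
  have "(2 ^ j) powr e = 2 powr (real j * e)" by (simp add: powr_realpow[symmetric] powr_powr)
  then show 1: "(2 ^ j) powr e = (2 powr e) ^ j" by (simp add: powr_powr mult.commute flip: powr_realpow)
  show "(1 / 2 ^ j) powr e = (2 powr (- e)) ^ j"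
    unfolding powr_divide 1 by (simp add: powr_minus divide_inverse power_inverse)
qed

lemma bound_near_origin:
  obtains C q where "0 \<le> C" "0 \<le> q" "q < 1"
    "\<And>(U :: 'a \<Rightarrow> real) \<omega> J. energy_le p \<mu> U \<omega> \<Longrightarrow>
      Lp_le r (pow_lborel s) (\<lambda>x. indicator {x. norm x < 1 / 2 ^ J} x * U x) (C * \<omega> * q ^ J)"
proof -
  obtain C where C: "0 \<le> C" "\<And>(U :: 'a \<Rightarrow> real) \<omega> \<rho>. energy_le p \<mu> U \<omega> \<Longrightarrow> 0 < \<rho> \<Longrightarrow>
    Lp_le r (pow_lborel s) (\<lambda>x. indicator (annulus \<rho>) x * U x) (C * \<omega> * \<rho> powr \<beta>)"
    using annulus_bound_scale_invariant by blast
  \<comment> \<open>The annulus of inner radius \<open>1 / 2 ^ Suc j\<close> contributes a multiple of \<open>q ^ Suc j\<close>.\<close>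
  define q where "q = 2 powr (- \<beta>)"
  have q: "0 < q" "q < 1" using \<beta>_pos by (auto simp: q_def powr_less_one)
  show thesis
  proof (rule that)
    show "0 \<le> C * q / (1 - q)" "0 \<le> q" "q < 1" using C q by auto
    fix U :: "'a \<Rightarrow> real" and \<omega> J assume U: "energy_le p \<mu> U \<omega>"
    note [measurable] = energy_leD(1)[OF U]
    have "Lp_le r (pow_lborel s) (\<lambda>x. indicator (annulus (1 / 2 ^ Suc j)) x * U x) ((C * \<omega> * q) * q ^ j)" for j
      using C(2)[OF U, of "1 / 2 ^ Suc j"] unfolding two_power_powr(2) q_def by (simp add: mult_ac)
    then have "Lp_le r (pow_lborel s) (\<lambda>x. indicator (\<Union>j\<in>{J..}. annulus (1 / 2 ^ Suc j)) x * U x) ((C * \<omega> * q) * q ^ J / (1 - q))"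
      using q r_gt_1 C energy_leD(2)[OF U] by (intro Lp_le_geometric_pieces) auto
    then have "Lp_le r (pow_lborel s) (\<lambda>x. indicator {x. x \<noteq> 0 \<and> norm x < 1 / 2 ^ J} x * U x) (C * q / (1 - q) * \<omega> * q ^ J)"
      unfolding punctured_ball_annuli by (simp add: mult_ac)
    then show "Lp_le r (pow_lborel s) (\<lambda>x. indicator {x. norm x < 1 / 2 ^ J} x * U x) (C * q / (1 - q) * \<omega> * q ^ J)"
    proof (rule Lp_le_mono)
      show "AE x in pow_lborel s. \<bar>indicator {x. norm x < 1 / 2 ^ J} x * U x\<bar> \<le> \<bar>indicator {x. x \<noteq> 0 \<and> norm x < 1 / 2 ^ J} x * U x\<bar>"
        using AE_pow_lborel_nonzero by eventually_elim (auto simp: indicator_def)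
    qed (use r_gt_1 in auto)
  qed
qed

lemma bound_near_infinity:
  obtains C q where "0 \<le> C" "0 \<le> q" "q < 1"
    "\<And>(U :: 'a \<Rightarrow> real) \<omega> L J. energy_le p \<mu> U \<omega> \<Longrightarrow> Lp_le p lborel U L \<Longrightarrow>
      Lp_le r (pow_lborel s) (\<lambda>x. indicator {x. 2 ^ J \<le> norm x} x * U x) (C * (\<omega> + L) * q ^ J)"
proof -
  obtain C where C: "0 \<le> C" "\<And>(U :: 'a \<Rightarrow> real) \<omega> L \<rho>. energy_le p \<mu> U \<omega> \<Longrightarrow> Lp_le p lborel U L \<Longrightarrow> 1 \<le> \<rho> \<Longrightarrow>
    Lp_le r (pow_lborel s) (\<lambda>x. indicator (annulus \<rho>) x * U x) (C * (\<omega> + L) * \<rho> powr (- \<gamma>))"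
    using annulus_bound_far by blast
  define q where "q = 2 powr (- \<gamma>)"
  have q: "0 < q" "q < 1" using \<gamma>_pos by (auto simp: q_def powr_less_one)
  show thesis
  proof (rule that)
    show "0 \<le> C / (1 - q)" "0 \<le> q" "q < 1" using C q by auto
    fix U :: "'a \<Rightarrow> real" and \<omega> L J assume U: "energy_le p \<mu> U \<omega>" and L: "Lp_le p lborel U L"
    note [measurable] = energy_leD(1)[OF U]
    have "Lp_le r (pow_lborel s) (\<lambda>x. indicator (annulus (2 ^ j)) x * U x) ((C * (\<omega> + L)) * q ^ j)" for j
      using C(2)[OF U L, of "2 ^ j"] unfolding two_power_powr(1) q_def by simp
    then have "Lp_le r (pow_lborel s) (\<lambda>x. indicator (\<Union>j\<in>{J..}. annulus (2 ^ j)) x * U x) ((C * (\<omega> + L)) * q ^ J / (1 - q))"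
      using q r_gt_1 C energy_leD(2)[OF U] Lp_leD(2)[OF L] by (intro Lp_le_geometric_pieces) auto
    then show "Lp_le r (pow_lborel s) (\<lambda>x. indicator {x. 2 ^ J \<le> norm x} x * U x) (C / (1 - q) * (\<omega> + L) * q ^ J)"
      unfolding exterior_annuli by (simp add: mult_ac)
  qed
qed

lemma embedding_bound:
  obtains C where "0 \<le> C" "\<And>(U :: 'a \<Rightarrow> real) \<omega> L. energy_le p \<mu> U \<omega> \<Longrightarrow> Lp_le p lborel U L \<Longrightarrow>
      Lp_le r (pow_lborel s) U (C * (\<omega> + L))"
proof -
  obtain C q where C: "0 \<le> C" "\<And>(U :: 'a \<Rightarrow> real) \<omega> J. energy_le p \<mu> U \<omega> \<Longrightarrow>
      Lp_le r (pow_lborel s) (\<lambda>x. indicator {x. norm x < 1 / 2 ^ J} x * U x) (C * \<omega> * q ^ J)"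
    using bound_near_origin by metis
  obtain D q' where D: "0 \<le> D" "\<And>(U :: 'a \<Rightarrow> real) \<omega> L J. energy_le p \<mu> U \<omega> \<Longrightarrow> Lp_le p lborel U L \<Longrightarrow>
      Lp_le r (pow_lborel s) (\<lambda>x. indicator {x. 2 ^ J \<le> norm x} x * U x) (D * (\<omega> + L) * q' ^ J)"
    using bound_near_infinity by metis
  show thesis
  proof (rule that)
    show "0 \<le> C + D" using C D by simp
    fix U :: "'a \<Rightarrow> real" and \<omega> L assume U: "energy_le p \<mu> U \<omega>" and L: "Lp_le p lborel U L"
    have "Lp_le r (pow_lborel s) (\<lambda>x. indicator {x. norm x < 1 / 2 ^ 0} x * U x + indicator {x. 2 ^ 0 \<le> norm x} x * U x)
      (C * \<omega> * q ^ 0 + D * (\<omega> + L) * q' ^ 0)"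
      using r_gt_1 by (intro Lp_le_add C(2)[OF U] D(2)[OF U L]) auto
    moreover have "(\<lambda>x. indicator {x. norm x < 1 / 2 ^ 0} x * U x + indicator {x. 2 ^ 0 \<le> norm x} x * U x) = U"
      by (auto simp: fun_eq_iff indicator_def)
    ultimately have bound: "Lp_le r (pow_lborel s) U (C * \<omega> + D * (\<omega> + L))" by simp
    have "C * \<omega> + D * (\<omega> + L) \<le> (C + D) * (\<omega> + L)"
      using C D Lp_leD(2)[OF L] by (simp add: algebra_simps)
    from Lp_le_weaken[OF bound this] show "Lp_le r (pow_lborel s) U ((C + D) * (\<omega> + L))" using r_gt_1 by simp
  qed
qed

text \<open>Completing the square in \<open>c * y\<^sup>2 - e * y\<close> after \<open>ln y \<le> y\<close>.\<close>

lemma gaussian_decay: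
  fixes c e y :: real
  assumes c: "0 < c" and e: "0 \<le> e" and y: "1 \<le> y"
  shows "exp (- c * y\<^sup>2) \<le> exp (e\<^sup>2 / (4 * c)) * y powr (- e)"
proof -
  have "e * ln y \<le> e * y" using e y ln_bound[of y] by (intro mult_left_mono) auto
  also have "e * y \<le> e\<^sup>2 / (4 * c) + c * y\<^sup>2"
  proof -
    have "0 \<le> (2 * c * y - e)\<^sup>2" by simp
    then show ?thesis using c by (simp add: field_simps power2_eq_square)
  qed
  finally have "- c * y\<^sup>2 \<le> e\<^sup>2 / (4 * c) - e * ln y" by simp
  then have "exp (- c * y\<^sup>2) \<le> exp (e\<^sup>2 / (4 * c) - e * ln y)" by simp
  also have "\<dots> = exp (e\<^sup>2 / (4 * c)) * y powr (- e)" using y by (simp add: powr_def exp_diff exp_minus field_simps)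
  finally show ?thesis .
qed

text \<open>The Gaussian beats the polynomial growth in \<open>annulus_bound_scale_invariant\<close>, so the product is
  controlled by the energy alone, without any \<open>L\<^sup>p\<close> bound. This is why approximation in the gradient
  norm suffices after damping.\<close>

lemma gaussian_damped_bound:
  assumes c: "0 < c"
  obtains C where "0 \<le> C" "\<And>(U :: 'a \<Rightarrow> real) \<omega>. energy_le p \<mu> U \<omega> \<Longrightarrow>
      Lp_le r (pow_lborel s) (\<lambda>x. exp (- c * (norm x)\<^sup>2) * U x) (C * \<omega>)"
proof -
  obtain B q where B: "0 \<le> B" "\<And>(U :: 'a \<Rightarrow> real) \<omega> J. energy_le p \<mu> U \<omega> \<Longrightarrow>
      Lp_le r (pow_lborel s) (\<lambda>x. indicator {x. norm x < 1 / 2 ^ J} x * U x) (B * \<omega> * q ^ J)"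
    using bound_near_origin by metis
  obtain D where D: "0 \<le> D" "\<And>(U :: 'a \<Rightarrow> real) \<omega> \<rho>. energy_le p \<mu> U \<omega> \<Longrightarrow> 0 < \<rho> \<Longrightarrow>
    Lp_le r (pow_lborel s) (\<lambda>x. indicator (annulus \<rho>) x * U x) (D * \<omega> * \<rho> powr \<beta>)"
    using annulus_bound_scale_invariant by blast
  \<comment> \<open>One power more than \<open>\<beta>\<close>, so that the annuli contribute \<open>(1/2) ^ j\<close>.\<close>
  define K where "K = exp ((\<beta> + 1)\<^sup>2 / (4 * c))"
  have K: "0 < K" by (simp add: K_def)
  show thesis
  proof (rule that)
    show "0 \<le> B + K * D * 2" using B D K by simp
    fix U :: "'a \<Rightarrow> real" and \<omega> assume U: "energy_le p \<mu> U \<omega>"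
    note [measurable] = energy_leD(1)[OF U]
    define V where "V x = exp (- c * (norm x)\<^sup>2) * U x" for x
    have [measurable]: "V \<in> borel_measurable borel" unfolding V_def by measurable
    have near: "Lp_le r (pow_lborel s) (\<lambda>x. indicator {x. norm x < 1} x * V x) (B * \<omega>)"
    proof (rule Lp_le_mono)
      show "Lp_le r (pow_lborel s) (\<lambda>x. indicator {x. norm x < 1 / 2 ^ 0} x * U x) (B * \<omega>)"
        using B(2)[OF U, of 0] by simp
      show "AE x in pow_lborel s. \<bar>indicator {x. norm x < 1} x * V x\<bar> \<le> \<bar>indicator {x. norm x < 1 / 2 ^ 0} x * U x\<bar>"
        using c by (intro always_eventually allI) (auto simp: V_def abs_mult indicator_def intro!: mult_left_le_one_le)
    qed (use r_gt_1 in auto)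
    have pieces: "Lp_le r (pow_lborel s) (\<lambda>x. indicator (annulus (2 ^ j)) x * V x) ((K * D * \<omega>) * (1/2) ^ j)" for j
    proof -
      define k where "k = K * (2 ^ j) powr (- (\<beta> + 1))"
      have k0: "0 \<le> k" using K by (simp add: k_def)
      have "Lp_le r (pow_lborel s) (\<lambda>x. k * (indicator (annulus (2 ^ j)) x * U x)) (\<bar>k\<bar> * (D * \<omega> * (2 ^ j) powr \<beta>))"
        by (intro Lp_le_scale D U) simp
      also have "\<bar>k\<bar> * (D * \<omega> * (2 ^ j) powr \<beta>) = (K * D * \<omega>) * ((2 ^ j) powr (- (\<beta> + 1)) * (2 ^ j) powr \<beta>)"
        unfolding k_def using K by (simp add: abs_mult)
      also have "((2 ^ j) powr (- (\<beta> + 1)) * (2 ^ j) powr \<beta>) = (1/2::real) ^ j"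
        unfolding powr_add[symmetric] by (simp add: powr_minus power_one_over inverse_eq_divide)
      finally show ?thesis
      proof (rule Lp_le_mono)
        show "AE x in pow_lborel s. \<bar>indicator (annulus (2 ^ j)) x * V x\<bar> \<le> \<bar>k * (indicator (annulus (2 ^ j)) x * U x)\<bar>"
        proof (intro always_eventually allI)
          fix x :: 'a
          have "exp (- c * (norm x)\<^sup>2) \<le> k" if "x \<in> annulus (2 ^ j)"
          proof -
            have x: "2 ^ j \<le> norm x" using that by (simp add: annulus_def)
            then have x1: "1 \<le> norm x" by (rule order_trans[rotated]) simp
            have "exp (- c * (norm x)\<^sup>2) \<le> K * norm x powr (- (\<beta> + 1))"
              unfolding K_def using c \<beta>_pos x1 by (intro gaussian_decay) auto
            also have "\<dots> \<le> k" unfolding k_def using K x \<beta>_pos by (intro mult_left_mono powr_mono2') auto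
            finally show ?thesis .
          qed
          then show "\<bar>indicator (annulus (2 ^ j)) x * V x\<bar> \<le> \<bar>k * (indicator (annulus (2 ^ j)) x * U x)\<bar>"
            using k0 by (auto simp: V_def abs_mult indicator_def intro!: mult_right_mono)
        qed
      qed (use r_gt_1 in auto)
    qed
    have far: "Lp_le r (pow_lborel s) (\<lambda>x. indicator {x. 1 \<le> norm x} x * V x) (K * D * \<omega> * 2)"
      using Lp_le_geometric_pieces[OF pieces, of 0] K D energy_leD(2)[OF U] r_gt_1 exterior_annuli[of 0] by simp
    have "Lp_le r (pow_lborel s) (\<lambda>x. indicator {x. norm x < 1} x * V x + indicator {x. 1 \<le> norm x} x * V x) (B * \<omega> + K * D * \<omega> * 2)"
      using r_gt_1 by (intro Lp_le_add near far) auto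
    moreover have "(\<lambda>x. indicator {x. norm x < 1} x * V x + indicator {x. 1 \<le> norm x} x * V x) = V"
      by (auto simp: fun_eq_iff indicator_def)
    moreover have "B * \<omega> + K * D * \<omega> * 2 = (B + K * D * 2) * \<omega>" by (simp add: algebra_simps)
    ultimately show "Lp_le r (pow_lborel s) (\<lambda>x. exp (- c * (norm x)\<^sup>2) * U x) ((B + K * D * 2) * \<omega>)"
      unfolding V_def[symmetric] by simp
  qed
qed

end

section \<open>Compactness and density\<close>

lemma Lp_le_dominated:
  assumes f: "\<And>n. f n \<in> borel_measurable M" and g: "Lp_le p M g G" and le: "\<And>n. AE x in M. \<bar>f n x\<bar> \<le> \<bar>g x\<bar>"
    and lim: "AE x in M. (\<lambda>n. f n x) \<longlonglongrightarrow> 0" and p: "0 < p" and e: "0 < e"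
  shows "\<exists>K. \<forall>n\<ge>K. Lp_le p M (f n) e"
proof -
  note [measurable] = f Lp_leD(1)[OF g]
  have "(\<lambda>n. \<integral>\<^sup>+x. ennreal (\<bar>f n x\<bar> powr p) \<partial>M) \<longlonglongrightarrow> (\<integral>\<^sup>+x. 0 \<partial>M)"
  proof (rule nn_integral_dominated_convergence[where w="\<lambda>x. ennreal (\<bar>g x\<bar> powr p)"])
    show "AE x in M. ennreal (\<bar>f n x\<bar> powr p) \<le> ennreal (\<bar>g x\<bar> powr p)" for n
      using le[of n] by eventually_elim (use p in \<open>auto intro!: ennreal_leI powr_mono2\<close>)
    show "(\<integral>\<^sup>+x. ennreal (\<bar>g x\<bar> powr p) \<partial>M) < \<infinity>"
      using Lp_leD(3)[OF g] by (metis ennreal_less_top infinity_ennreal_def le_less_trans)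
    show "AE x in M. (\<lambda>n. ennreal (\<bar>f n x\<bar> powr p)) \<longlonglongrightarrow> 0"
      using lim
    proof eventually_elim
      case (elim x)
      have "(\<lambda>n. \<bar>f n x\<bar> powr p) \<longlonglongrightarrow> \<bar>0\<bar> powr p"
        using p by (intro tendsto_powr2 tendsto_rabs elim tendsto_const) auto
      then show ?case using tendsto_ennrealI by fastforce
    qed
  qed measurable
  then have "\<forall>\<^sub>F n in sequentially. (\<integral>\<^sup>+x. ennreal (\<bar>f n x\<bar> powr p) \<partial>M) < ennreal (e powr p)"
    using e by (intro order_tendstoD(2)) (auto simp: ennreal_less_zero_iff)
  then obtain K where "\<And>n. n \<ge> K \<Longrightarrow> (\<integral>\<^sup>+x. ennreal (\<bar>f n x\<bar> powr p) \<partial>M) < ennreal (e powr p)"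
    by (auto simp: eventually_sequentially)
  then show ?thesis using e by (intro exI[of _ K]) (auto simp: Lp_le_def intro: less_imp_le)
qed

lemma abs_avg_le:
  fixes f :: "'a::euclidean_space \<Rightarrow> real"
  assumes f: "Lp_le p lborel f F" and t: "0 < t" and p: "1 \<le> p"
  shows "\<bar>avg t f x\<bar> \<le> t powr (- real DIM('a) / p) * F"
proof -
  have [measurable]: "f \<in> borel_measurable borel" using Lp_leD(1)[OF f] by simp
  have "(\<integral>\<^sup>+y. indicator (nbhd t x) y * ennreal (\<bar>f y\<bar> powr p) \<partial>lborel) \<le> ennreal (F powr p)"
    by (rule order_trans[OF nn_integral_mono Lp_leD(3)[OF f]]) (auto simp: indicator_def)
  then have "ennreal (\<bar>avg t f x\<bar> powr p) \<le> ennreal (t powr (- real DIM('a))) * ennreal (F powr p)"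
    using avg_powr_le[of f t p x] t p by (meson \<open>f \<in> borel_measurable borel\<close> mult_left_mono order_trans zero_le)
  also have "\<dots> = ennreal ((t powr (- real DIM('a) / p) * F) powr p)"
    using p Lp_leD(2)[OF f] by (simp add: ennreal_mult powr_mult powr_powr)
  finally have "\<bar>avg t f x\<bar> powr p \<le> (t powr (- real DIM('a) / p) * F) powr p" by simp
  then show ?thesis
    using p Lp_leD(2)[OF f] powr_less_mono2[of p "t powr (- real DIM('a) / p) * F" "\<bar>avg t f x\<bar>"] by (meson le_less_trans mult_nonneg_nonneg not_less powr_ge_zero order_less_le_trans zero_less_one)
qed

text \<open>Every grid cell has interior points, hence contains a member of a dense set: countably many base
  points represent all cells of a grid.\<close>

lemma corner_dense:
  fixes x :: "'a::euclidean_space"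
  assumes D: "\<And>X :: 'a set. open X \<Longrightarrow> X \<noteq> {} \<Longrightarrow> \<exists>d\<in>D. d \<in> X" and t: "0 < t"
  obtains d where "d \<in> D" "corner t d = corner t x"
proof -
  have "box (corner t x) (corner t x + t *\<^sub>R One) \<noteq> {}"
    using t by (simp add: box_ne_empty inner_simps)
  then obtain d where d: "d \<in> D" "d \<in> box (corner t x) (corner t x + t *\<^sub>R One)"
    using D[OF open_box] by blast
  have "corner t d = corner t x"
  proof (rule euclidean_eqI)
    fix b :: 'a assume b: "b \<in> Basis"
    have "t * of_int \<lfloor>x \<bullet> b / t\<rfloor> < d \<bullet> b" "d \<bullet> b < t * of_int \<lfloor>x \<bullet> b / t\<rfloor> + t"
      using d(2) b by (auto simp: mem_box corner_inner inner_simps)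
    then have "\<lfloor>d \<bullet> b / t\<rfloor> = \<lfloor>x \<bullet> b / t\<rfloor>"
      using t by (intro floor_unique) (simp_all add: pos_le_divide_eq pos_divide_less_eq algebra_simps)
    then show "corner t d \<bullet> b = corner t x \<bullet> b" using b by (simp add: corner_inner)
  qed
  then show thesis using d(1) that by blast
qed

lemma avg_convergent_subsequence:
  fixes U :: "nat \<Rightarrow> 'a::euclidean_space \<Rightarrow> real"
  assumes U: "\<And>n. Lp_le p lborel (U n) L" and p: "1 \<le> p"
  obtains k where "strict_mono (k :: nat \<Rightarrow> nat)" "\<And>m x. convergent (\<lambda>n. avg (1 / 2 ^ m) (U (k n)) x)"
proof -
  obtain D :: "'a set" where D: "countable D" "\<And>X. open X \<Longrightarrow> X \<noteq> {} \<Longrightarrow> \<exists>d\<in>D. d \<in> X"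
    using countable_dense_exists by blast
  define c where "c m = (1 / 2 ^ m) powr (- real DIM('a) / p)" for m :: nat
  have c: "0 < c m" for m by (simp add: c_def)
  \<comment> \<open>Dividing by \<open>c m\<close> makes the bound uniform over all meshes.\<close>
  define f where "f n z = avg (1 / 2 ^ fst z) (U n) (snd z) / c (fst z)" for n and z :: "nat \<times> 'a"
  have "norm (f n z) \<le> L" for n z
  proof -
    have "\<bar>avg (1 / 2 ^ fst z) (U n) (snd z)\<bar> \<le> c (fst z) * L"
      unfolding c_def by (rule abs_avg_le[OF U _ p]) simp
    then show ?thesis using c[of "fst z"] by (simp add: f_def pos_divide_le_eq mult.commute)
  qed
  moreover have "countable (UNIV \<times> D :: (nat \<times> 'a) set)" using D by auto
  ultimately obtain k where k: "strict_mono (k :: nat \<Rightarrow> nat)" "\<And>z. z \<in> UNIV \<times> D \<Longrightarrow> \<exists>l. (\<lambda>n. f (k n) z) \<longlonglongrightarrow> l"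
    using function_convergent_subsequence[of "UNIV \<times> D" f L] by blast
  have "convergent (\<lambda>n. avg (1 / 2 ^ m) (U (k n)) x)" for m x
  proof -
    obtain d where d: "d \<in> D" "corner (1 / 2 ^ m) d = corner (1 / 2 ^ m) x"
      using corner_dense[OF D(2), of "1 / 2 ^ m" x] by auto
    obtain l where "(\<lambda>n. f (k n) (m, d)) \<longlonglongrightarrow> l" using k(2)[of "(m, d)"] d by auto
    then have "(\<lambda>n. c m * f (k n) (m, d)) \<longlonglongrightarrow> c m * l" by (intro tendsto_mult tendsto_const)
    moreover have "c m * f (k n) (m, d) = avg (1 / 2 ^ m) (U (k n)) x" for n
      using c[of m] d(2) by (simp add: f_def avg_def)
    ultimately show ?thesis by (auto simp: convergent_def)
  qed
  then show thesis using k(1) that by blast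
qed

context exponents
begin

text \<open>The part of the space where \<open>norm x\<close> lies between \<open>1 / 2 ^ J\<close> and \<open>2 ^ J\<close> carries all but
  \<open>2 * e / 3\<close> of the norm of a difference of two members. There the mesh \<open>\<tau>\<close> is chosen so small that
  replacing a difference by its means costs at most \<open>e / 6\<close>, and the means converge boundedly.\<close>

lemma compactness:
  fixes U :: "nat \<Rightarrow> 'a \<Rightarrow> real"
  assumes U: "\<And>n. energy_le p \<mu> (U n) B" and L: "\<And>n. Lp_le p lborel (U n) L"
  obtains k where "strict_mono (k :: nat \<Rightarrow> nat)"
    "\<And>e. 0 < e \<Longrightarrow> \<exists>M::nat. \<forall>m\<ge>M. \<forall>n\<ge>M. Lp_le r (pow_lborel s) (\<lambda>x. U (k m) x - U (k n) x) e"
proof -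
  have p1: "1 \<le> p" and r1: "1 \<le> r" using p by auto
  obtain k where k: "strict_mono (k :: nat \<Rightarrow> nat)" "\<And>m x. convergent (\<lambda>n. avg (1 / 2 ^ m) (U (k n)) x)"
    by (rule avg_convergent_subsequence[of p U L, OF L p1]) (rule that)
  obtain C1 q1 where C1: "0 \<le> C1" "0 \<le> q1" "q1 < 1" "\<And>(U :: 'a \<Rightarrow> real) \<omega> J. energy_le p \<mu> U \<omega> \<Longrightarrow>
      Lp_le r (pow_lborel s) (\<lambda>x. indicator {x. norm x < 1 / 2 ^ J} x * U x) (C1 * \<omega> * q1 ^ J)"
    by (rule bound_near_origin) (rule that)
  obtain C2 q2 where C2: "0 \<le> C2" "0 \<le> q2" "q2 < 1" "\<And>(U :: 'a \<Rightarrow> real) \<omega> L J. energy_le p \<mu> U \<omega> \<Longrightarrow> Lp_le p lborel U L \<Longrightarrow>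
      Lp_le r (pow_lborel s) (\<lambda>x. indicator {x. 2 ^ J \<le> norm x} x * U x) (C2 * (\<omega> + L) * q2 ^ J)"
    by (rule bound_near_infinity) (rule that)
  note meas[measurable] = energy_leD(1)[OF U]
  define V where "V m n x = U (k m) x - U (k n) x" for m n x
  have VW: "energy_le p \<mu> (V m n) (B + B)" for m n
    unfolding V_def by (intro energy_le_diff U p1)
  have VL: "Lp_le p lborel (V m n) (L + L)" for m n
    unfolding V_def by (intro Lp_le_diff L p1)
  have main: "\<exists>M::nat. \<forall>m\<ge>M. \<forall>n\<ge>M. Lp_le r (pow_lborel s) (V m n) e" if e: "0 < e" for e
  proof -
    have lim: "(\<lambda>J. C1 * (B + B) * q1 ^ J) \<longlonglongrightarrow> C1 * (B + B) * 0" "(\<lambda>J. C2 * ((B + B) + (L + L)) * q2 ^ J) \<longlonglongrightarrow> C2 * ((B + B) + (L + L)) * 0"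
      using C1 C2 by (intro tendsto_mult tendsto_const LIMSEQ_power_zero, simp)+
    have "\<forall>\<^sub>F J in sequentially. C1 * (B + B) * q1 ^ J < e / 3"
      by (rule order_tendstoD(2)[OF lim(1)]) (use e in simp)
    moreover have "\<forall>\<^sub>F J in sequentially. C2 * ((B + B) + (L + L)) * q2 ^ J < e / 3"
      by (rule order_tendstoD(2)[OF lim(2)]) (use e in simp)
    ultimately have "\<forall>\<^sub>F J in sequentially. C1 * (B + B) * q1 ^ J < e / 3 \<and> C2 * ((B + B) + (L + L)) * q2 ^ J < e / 3"
      by (rule eventually_conj)
    then obtain J where J: "C1 * (B + B) * q1 ^ J < e / 3" "C2 * ((B + B) + (L + L)) * q2 ^ J < e / 3"
      by (auto simp: eventually_sequentially)
    define lo hi where "lo = (1::real) / 2 ^ J" and "hi = (2::real) ^ J"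
    have lohi: "0 < lo" "lo \<le> 1" "1 \<le> hi" by (auto simp: lo_def hi_def divide_le_eq_1)
    define A A' where "A = {x::'a. lo \<le> norm x \<and> norm x < hi}" and "A' = {x::'a. lo / 2 \<le> norm x \<and> norm x \<le> 2 * hi}"
    have [measurable]: "A \<in> sets borel" "A' \<in> sets borel" unfolding A_def A'_def by measurable
    define a where "a = (max ((lo / 2) powr \<mu>) ((2 * hi) powr \<mu>)) powr (1 / p)"
    define b where "b = (max ((lo / 2) powr (p + \<mu>)) ((2 * hi) powr (p + \<mu>))) powr (1 / p)"
    define w where "w = (max (lo powr (- s)) (hi powr (- s))) powr (1 / r)"
    have ap: "a powr p = max ((lo / 2) powr \<mu>) ((2 * hi) powr \<mu>)" "b powr p = max ((lo / 2) powr (p + \<mu>)) ((2 * hi) powr (p + \<mu>))"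
      "w powr r = max (lo powr (- s)) (hi powr (- s))"
      unfolding a_def b_def w_def using p by (simp_all add: powr_powr le_max_iff_disj)
    have abw: "0 \<le> a" "0 \<le> b" "0 \<le> w" by (auto simp: a_def b_def w_def)
    define t where "t m = (1::real) / 2 ^ m" for m :: nat
    have "(\<lambda>m. N * t m) \<longlonglongrightarrow> 0" unfolding t_def by real_asymp
    then have 1: "\<forall>\<^sub>F m in sequentially. N * t m < lo / 2" using lohi by (intro order_tendstoD(2)) auto
    have "t m powr \<alpha> = (2 powr (- \<alpha>)) ^ m" for m unfolding t_def by (rule two_power_powr)
    then have "(\<lambda>m. w * (Poincare_const N p r * t m powr \<alpha> * (a * (B + B)))) \<longlonglongrightarrow> w * (Poincare_const N p r * 0 * (a * (B + B)))"
      using \<alpha>_pos by (simp only:) (intro tendsto_mult tendsto_const LIMSEQ_power_zero, simp add: powr_less_one)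
    then have 2: "\<forall>\<^sub>F m in sequentially. w * (Poincare_const N p r * t m powr \<alpha> * (a * (B + B))) < e / 6"
      using e by (intro order_tendstoD(2)) auto
    from eventually_conj[OF 1 2] obtain m0 where m0: "N * t m0 < lo / 2" "w * (Poincare_const N p r * t m0 powr \<alpha> * (a * (B + B))) < e / 6"
      by (auto simp: eventually_sequentially)
    define \<tau> where "\<tau> = t m0"
    have \<tau>: "0 < \<tau>" by (simp add: \<tau>_def t_def)
    define E where "E n = avg \<tau> (U (k n))" for n
    define E0 where "E0 x = lim (\<lambda>n. E n x)" for x
    have [measurable]: "E n \<in> borel_measurable borel" for n unfolding E_def by measurable
    have [measurable]: "E0 \<in> borel_measurable borel" unfolding E0_def by measurable
    have El: "(\<lambda>n. E n x) \<longlonglongrightarrow> E0 x" for x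
      using k(2)[of m0 x] by (simp add: E0_def E_def \<tau>_def t_def convergent_LIMSEQ_iff)
    define K where "K = \<tau> powr (- N / p) * L"
    have EK: "\<bar>E n x\<bar> \<le> K" for n x
      unfolding E_def K_def N_eq using abs_avg_le[OF L \<tau> p1] .
    have lK: "\<bar>E0 x\<bar> \<le> K" for x
      by (rule LIMSEQ_le_const2[OF tendsto_rabs[OF El]]) (use EK in auto)
    define \<delta> where "\<delta> = e / (6 * (w + 1))"
    have \<delta>: "0 < \<delta>" using e abw by (simp add: \<delta>_def)
    have "\<exists>M. \<forall>n\<ge>M. Lp_le r lborel (\<lambda>x. indicator A x * (E n x - E0 x)) (\<delta> / 2)"
    proof (rule Lp_le_dominated)
      show "Lp_le r lborel (\<lambda>x. indicator A x * (2 * K)) (((2 * \<bar>K\<bar>) powr r * measure lborel (ball (0::'a) hi)) powr (1 / r))"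
      proof -
        have "(\<integral>\<^sup>+x. ennreal (\<bar>indicator A x * (2 * K)\<bar> powr r) \<partial>lborel) \<le> (\<integral>\<^sup>+x. ennreal ((2 * \<bar>K\<bar>) powr r) * indicator (ball (0::'a) hi) x \<partial>lborel)"
          using r_gt_1 by (intro nn_integral_mono) (auto simp: indicator_def A_def abs_mult)
        also have "\<dots> = ennreal ((2 * \<bar>K\<bar>) powr r) * emeasure lborel (ball (0::'a) hi)"
          by (intro nn_integral_cmult_indicator) auto
        also have "\<dots> = ennreal ((2 * \<bar>K\<bar>) powr r * measure lborel (ball (0::'a) hi))"
          using emeasure_lborel_ball_finite[of "0::'a" hi]
          by (subst emeasure_eq_ennreal_measure) (auto simp: ennreal_mult top.not_eq_extremum)
        finally show ?thesis
          using r_gt_1 by (auto simp: Lp_le_def powr_powr)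
      qed
      show "AE x in lborel. \<bar>indicator A x * (E n x - E0 x)\<bar> \<le> \<bar>indicator A x * (2 * K)\<bar>" for n
      proof (intro always_eventually allI)
        fix x
        have "\<bar>E n x - E0 x\<bar> \<le> 2 * K" using EK[of n x] lK[of x] by linarith
        then show "\<bar>indicator A x * (E n x - E0 x)\<bar> \<le> \<bar>indicator A x * (2 * K)\<bar>" by (auto simp: indicator_def)
      qed
      show "AE x in lborel. (\<lambda>n. indicator A x * (E n x - E0 x)) \<longlonglongrightarrow> 0"
      proof (intro always_eventually allI)
        fix x
        have "(\<lambda>n. indicator A x * (E n x - E0 x)) \<longlonglongrightarrow> indicator A x * (E0 x - E0 x)"
          by (intro tendsto_mult tendsto_diff tendsto_const El)
        then show "(\<lambda>n. indicator A x * (E n x - E0 x)) \<longlonglongrightarrow> 0" by simp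
      qed
    qed (use r_gt_1 \<delta> in auto)
    then obtain M where M: "\<And>n. n \<ge> M \<Longrightarrow> Lp_le r lborel (\<lambda>x. indicator A x * (E n x - E0 x)) (\<delta> / 2)" by blast
    have "Lp_le r (pow_lborel s) (V m n) e" if mn: "m \<ge> M" "n \<ge> M" for m n
    proof -
      have "Lp_le r lborel (\<lambda>x. indicator A x * (E m x - E0 x) - indicator A x * (E n x - E0 x)) (\<delta> / 2 + \<delta> / 2)"
        by (intro Lp_le_diff M mn r1)
      moreover have "indicator A x * (E m x - E0 x) - indicator A x * (E n x - E0 x) = indicator A x * avg \<tau> (V m n) x" for x
      proof -
        have UL: "Lp_le p lborel (\<lambda>y. indicator UNIV y * U j y) L" for j using L by simp
        have "avg \<tau> (V m n) x = E m x - E n x"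
          unfolding V_def E_def by (rule avg_diff[OF meas meas \<tau> p1 subset_UNIV UL UL])
        then show ?thesis by (simp add: right_diff_distrib)
      qed
      ultimately have avgV: "Lp_le r lborel (\<lambda>x. indicator A x * avg \<tau> (V m n) x) \<delta>" by simp
      have "Lp_le r lborel (\<lambda>x. indicator A x * V m n x) (Poincare_const N p r * \<tau> powr (N / r + 1 - N / p) * (a * (B + B)) + \<delta>)"
      proof (rule energy_le_local[OF VW p1 p(2), folded N_eq, OF Hardy_range(2), where A'=A' and b=b])
        show "nbhd \<tau> x \<subseteq> A'" if x: "x \<in> A" for x
        proof
          fix y assume "y \<in> nbhd \<tau> x"
          then have "norm (y - x) \<le> lo / 2" using norm_nbhd[of y \<tau> x] m0(1) by (simp add: N_eq \<tau>_def)
          then show "y \<in> A'" using x lohi norm_triangle_ineq2[of x y] norm_triangle_ineq2[of y x]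
            by (auto simp: A_def A'_def norm_minus_commute)
        qed
        show "x \<noteq> 0 \<and> norm x powr \<mu> \<le> a powr p" if "x \<in> A'" for x
          using that lohi unfolding ap by (auto simp: A'_def intro!: powr_le_max)
        show "norm x powr (p + \<mu>) \<le> b powr p" if "x \<in> A'" for x
          using that lohi unfolding ap by (auto simp: A'_def intro!: powr_le_max)
      qed (use \<tau> abw avgV subcritical in auto)
      then have "Lp_le r (pow_lborel s) (\<lambda>x. indicator A x * V m n x) (w * (Poincare_const N p r * \<tau> powr (N / r + 1 - N / p) * (a * (B + B)) + \<delta>))"
      proof (rule Lp_le_pow_lborel_of_lborel)
        show "norm x powr (- s) \<le> w powr r" if "x \<in> A" for x
          using that lohi unfolding ap by (auto simp: A_def intro!: powr_le_max)
      qed (use r_gt_1 abw in auto)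
      moreover have "w * (Poincare_const N p r * \<tau> powr (N / r + 1 - N / p) * (a * (B + B)) + \<delta>) \<le> e / 3"
      proof -
        have "w * \<delta> \<le> (w + 1) * \<delta>" using \<delta> by (intro mult_right_mono) auto
        also have "\<dots> = e / 6" using abw by (simp add: \<delta>_def field_simps)
        finally show ?thesis using m0(2) unfolding \<tau>_def[symmetric] \<alpha>_def distrib_left by linarith
      qed
      ultimately have mid: "Lp_le r (pow_lborel s) (\<lambda>x. indicator A x * V m n x) (e / 3)"
        by (rule Lp_le_weaken) (use r_gt_1 in auto)
      have near: "Lp_le r (pow_lborel s) (\<lambda>x. indicator {x. norm x < 1 / 2 ^ J} x * V m n x) (e / 3)"
        using J(1) r_gt_1 by (intro Lp_le_weaken[OF C1(4)[OF VW]]) auto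
      have far: "Lp_le r (pow_lborel s) (\<lambda>x. indicator {x. 2 ^ J \<le> norm x} x * V m n x) (e / 3)"
        using J(2) r_gt_1 by (intro Lp_le_weaken[OF C2(4)[OF VW VL]]) auto
      have "Lp_le r (pow_lborel s) (\<lambda>x. indicator {x. norm x < 1 / 2 ^ J} x * V m n x + (indicator A x * V m n x + indicator {x. 2 ^ J \<le> norm x} x * V m n x)) (e / 3 + (e / 3 + e / 3))"
        by (intro Lp_le_add near mid far r1)
      moreover have "(\<lambda>x. indicator {x. norm x < 1 / 2 ^ J} x * V m n x + (indicator A x * V m n x + indicator {x. 2 ^ J \<le> norm x} x * V m n x)) = V m n"
      proof
        fix x
        have "lo \<le> hi" using lohi by linarith
        then show "indicator {x. norm x < 1 / 2 ^ J} x * V m n x + (indicator A x * V m n x + indicator {x. 2 ^ J \<le> norm x} x * V m n x) = V m n x"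
          by (auto simp: A_def indicator_def lo_def hi_def)
      qed
      ultimately show ?thesis by simp
    qed
    then show ?thesis by blast
  qed
  show thesis
    using that[OF k(1)] main unfolding V_def by blast
qed

text \<open>First damp \<open>U\<close> by a wide Gaussian (dominated convergence, as the norm of \<open>U\<close> is finite), then, with the
  Gaussian fixed, replace \<open>U\<close> by a test function \<open>\<phi>\<close> such that \<open>\<phi> - U\<close> has small energy.\<close>

lemma gaussian_approximation:
  fixes U :: "'a \<Rightarrow> real"
  assumes U: "energy_le p \<mu> U \<omega>" and L: "Lp_le p lborel U L"
    and dense: "\<And>e. 0 < e \<Longrightarrow> \<exists>\<phi>\<in>T. energy_le p \<mu> (\<lambda>x. \<phi> x - U x) e"
    and T: "\<And>\<phi> c. \<phi> \<in> T \<Longrightarrow> 0 < c \<Longrightarrow> (\<lambda>x. exp (- c * (norm x)\<^sup>2) * \<phi> x) \<in> T" and e: "0 < e"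
  shows "\<exists>\<psi>\<in>T. Lp_le r (pow_lborel s) (\<lambda>x. \<psi> x - U x) e"
proof -
  note [measurable] = energy_leD(1)[OF U]
  obtain C where C: "Lp_le r (pow_lborel s) U C" using embedding_bound U L by metis
  define c where "c n = inverse (real (Suc n))" for n
  have c0: "c \<longlonglongrightarrow> 0" unfolding c_def by (rule LIMSEQ_inverse_real_of_nat)
  have "\<exists>K. \<forall>n\<ge>K. Lp_le r (pow_lborel s) (\<lambda>x. exp (- c n * (norm x)\<^sup>2) * U x - U x) (e / 2)"
  proof (rule Lp_le_dominated[OF _ C])
    show "AE x in pow_lborel s. \<bar>exp (- c n * (norm x)\<^sup>2) * U x - U x\<bar> \<le> \<bar>U x\<bar>" for n
    proof (intro always_eventually allI)
      fix x :: 'a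
      have "\<bar>exp (- c n * (norm x)\<^sup>2) - 1\<bar> \<le> 1" by (simp add: c_def abs_le_iff)
      then have "\<bar>exp (- c n * (norm x)\<^sup>2) - 1\<bar> * \<bar>U x\<bar> \<le> 1 * \<bar>U x\<bar>" by (intro mult_right_mono) auto
      then show "\<bar>exp (- c n * (norm x)\<^sup>2) * U x - U x\<bar> \<le> \<bar>U x\<bar>" by (simp add: abs_mult[symmetric] left_diff_distrib)
    qed
    show "AE x in pow_lborel s. (\<lambda>n. exp (- c n * (norm x)\<^sup>2) * U x - U x) \<longlonglongrightarrow> 0"
    proof (intro always_eventually allI)
      fix x :: 'a
      have "(\<lambda>n. exp (- c n * (norm x)\<^sup>2) * U x - U x) \<longlonglongrightarrow> exp (- 0 * (norm x)\<^sup>2) * U x - U x"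
        by (intro tendsto_intros c0)
      then show "(\<lambda>n. exp (- c n * (norm x)\<^sup>2) * U x - U x) \<longlonglongrightarrow> 0" by simp
    qed
  qed (use r_gt_1 e in auto)
  then obtain n where n: "Lp_le r (pow_lborel s) (\<lambda>x. exp (- c n * (norm x)\<^sup>2) * U x - U x) (e / 2)" by blast
  have cn: "0 < c n" by (simp add: c_def)
  obtain D where D: "0 \<le> D" "\<And>(U :: 'a \<Rightarrow> real) \<omega>. energy_le p \<mu> U \<omega> \<Longrightarrow>
      Lp_le r (pow_lborel s) (\<lambda>x. exp (- c n * (norm x)\<^sup>2) * U x) (D * \<omega>)"
    using gaussian_damped_bound[OF cn] by blast
  define d where "d = e / (2 * (D + 1))"
  have d: "0 < d" using e D by (simp add: d_def)
  obtain \<phi> where \<phi>: "\<phi> \<in> T" "energy_le p \<mu> (\<lambda>x. \<phi> x - U x) d" using dense[OF d] by blast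
  have "D * d \<le> (D + 1) * d" using d by (intro mult_right_mono) auto
  also have "\<dots> = e / 2" using D by (simp add: d_def field_simps)
  finally have "Lp_le r (pow_lborel s) (\<lambda>x. exp (- c n * (norm x)\<^sup>2) * (\<phi> x - U x)) (e / 2)"
    using r_gt_1 Lp_le_weaken[OF D(2)[OF \<phi>(2)]] by simp
  from Lp_le_add[OF this n] have "Lp_le r (pow_lborel s) (\<lambda>x. exp (- c n * (norm x)\<^sup>2) * \<phi> x - U x) e"
    using r_gt_1 by (simp add: algebra_simps)
  then show ?thesis by (rule bexI[OF _ T[OF \<phi>(1) cn]])
qed

end

section \<open>Test functions\<close>

lemma Ck_Suc_imp: "Ck (Suc k) f \<Longrightarrow> Ck k f"
proof (induction k arbitrary: f)
  case 0
  then show ?case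
    by (auto intro!: continuous_at_imp_continuous_on differentiable_imp_continuous_within)
next
  case (Suc k)
  then show ?case by (metis Ck.simps(2))
qed

lemma frechet_eqI: "(f has_derivative D) (at x) \<Longrightarrow> frechet_derivative f (at x) v = D v"
  by (metis frechet_derivative_at)

lemma Ck_SucI:
  assumes "\<And>x. (f has_derivative D x) (at x)" "\<And>v. Ck k (\<lambda>x. D x v)"
  shows "Ck (Suc k) f"
  using assms by (auto simp: frechet_eqI[OF assms(1)] differentiable_def)

lemma Ck_SucD:
  assumes "Ck (Suc k) f"
  shows "(f has_derivative frechet_derivative f (at x)) (at x)" "Ck k (\<lambda>x. frechet_derivative f (at x) v)"
  using assms by (auto simp: frechet_derivative_works[symmetric])

lemma Ck_const: "Ck k (\<lambda>_. c)"
proof (induction k arbitrary: c)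
  case (Suc k)
  show ?case by (rule Ck_SucI[where D="\<lambda>x v. 0"]) (auto intro: Suc)
qed simp

lemma Ck_add: "Ck k f \<Longrightarrow> Ck k g \<Longrightarrow> Ck k (\<lambda>x. f x + g x)"
proof (induction k arbitrary: f g)
  case 0
  then show ?case by (simp add: continuous_on_add)
next
  case (Suc k)
  show ?case
    by (rule Ck_SucI[OF has_derivative_add[OF Ck_SucD(1)[OF Suc.prems(1)] Ck_SucD(1)[OF Suc.prems(2)]]])
      (intro Suc.IH Ck_SucD(2) Suc.prems)
qed

lemma Ck_mult: "Ck k f \<Longrightarrow> Ck k g \<Longrightarrow> Ck k (\<lambda>x. f x * g x)"
proof (induction k arbitrary: f g)
  case 0
  then show ?case by (simp add: continuous_on_mult)
next
  case (Suc k)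
  show ?case
    by (rule Ck_SucI[OF has_derivative_mult[OF Ck_SucD(1)[OF Suc.prems(1)] Ck_SucD(1)[OF Suc.prems(2)]]])
      (intro Ck_add Suc.IH Ck_SucD(2) Suc.prems Ck_Suc_imp[OF Suc.prems(1)] Ck_Suc_imp[OF Suc.prems(2)])
qed

lemma Ck_inner: "Ck k (\<lambda>x. x \<bullet> v)"
proof (cases k)
  case (Suc j)
  show ?thesis unfolding Suc
    by (rule Ck_SucI[where D="\<lambda>x h. h \<bullet> v"]) (auto intro!: derivative_eq_intros Ck_const)
qed (simp add: continuous_on_inner)

lemma Ck_gaussian: "Ck k (\<lambda>x::'a::euclidean_space. exp (- c * (norm x)\<^sup>2))"
proof (induction k)
  case 0
  show ?case by (auto intro!: continuous_intros)
next
  case (Suc k)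
  show ?case
  proof (rule Ck_SucI)
    show "((\<lambda>x::'a. exp (- c * (norm x)\<^sup>2)) has_derivative (\<lambda>v. (- 2 * c) * (x \<bullet> v) * exp (- c * (norm x)\<^sup>2))) (at x)" for x
      unfolding power2_norm_eq_inner
      by (auto intro!: derivative_eq_intros simp: inner_commute algebra_simps)
    show "Ck k (\<lambda>x. (- 2 * c) * (x \<bullet> v) * exp (- c * (norm x)\<^sup>2))" for v :: 'a
      by (intro Ck_mult Ck_const Ck_inner Suc)
  qed
qed

lemma C0_inf_C1c:
  assumes "f \<in> C0_inf \<Omega>"
  shows "C1c f"
proof -
  have Ck: "Ck (Suc 0) f" using assms by (auto simp: C0_inf_def simp del: Ck.simps)
  let ?D = "\<lambda>x. \<Sum>b\<in>Basis. frechet_derivative f (at x) b *\<^sub>R b"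
  have der: "GDERIV f x :> ?D x" for x
  proof -
    have d: "(f has_derivative frechet_derivative f (at x)) (at x)" by (rule Ck_SucD[OF Ck])
    then have "linear (frechet_derivative f (at x))" by (rule has_derivative_linear)
    then have "frechet_derivative f (at x) h = h \<bullet> ?D x" for h
      by (subst euclidean_representation[of h, symmetric])
        (simp add: linear_sum linear_cmul inner_sum_right inner_sum_left mult.commute)
    then show ?thesis using d unfolding gderiv_def by (metis (no_types, lifting) ext)
  qed
  have cont: "continuous_on UNIV ?D"
    using Ck_SucD(2)[OF Ck] by (intro continuous_on_sum continuous_on_scaleR continuous_on_const) auto
  have "C1 f" by (rule C1I(1)[OF der cont])
  moreover have "bounded {x. f x \<noteq> 0}"
    using assms by (auto simp: C0_inf_def dest: compact_imp_bounded intro: bounded_subset closure_subset)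
  then obtain R where "\<And>x. f x \<noteq> 0 \<Longrightarrow> norm x \<le> R" by (auto simp: bounded_iff)
  then have "\<forall>x. R + 1 \<le> norm x \<longrightarrow> f x = 0" by (meson add_le_cancel_left dual_order.trans not_one_le_zero add_le_same_cancel1)
  ultimately show ?thesis by (auto simp: C1c_def)
qed

lemma C0_infI_support:
  assumes "\<And>k. Ck k f" "{x. f x \<noteq> 0} \<subseteq> {x. g x \<noteq> 0} \<union> {x. h x \<noteq> 0}" "g \<in> C0_inf \<Omega>" "h \<in> C0_inf \<Omega>"
  shows "f \<in> C0_inf \<Omega>"
proof -
  have sub: "closure {x. f x \<noteq> 0} \<subseteq> closure {x. g x \<noteq> 0} \<union> closure {x. h x \<noteq> 0}"
    using closure_mono[OF assms(2)] by (simp add: closure_Un)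
  have "compact (closure {x. g x \<noteq> 0} \<union> closure {x. h x \<noteq> 0})" using assms by (auto simp: C0_inf_def)
  with sub have "compact (closure {x. f x \<noteq> 0})"
    by (meson bounded_subset closed_closure compact_eq_bounded_closed)
  then show ?thesis using assms sub by (auto simp: C0_inf_def)
qed

lemma C0_inf_diff:
  assumes "f \<in> C0_inf \<Omega>" "g \<in> C0_inf \<Omega>"
  shows "(\<lambda>x. f x - g x) \<in> C0_inf \<Omega>"
proof (rule C0_infI_support[OF _ _ assms])
  have "Ck k (\<lambda>x. f x + (- 1) * g x)" for k
    using assms by (intro Ck_add Ck_mult Ck_const) (auto simp: C0_inf_def)
  then show "Ck k (\<lambda>x. f x - g x)" for k by simp
qed auto

lemma C0_inf_gaussian_mult:
  assumes "f \<in> C0_inf \<Omega>"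
  shows "(\<lambda>x. exp (- c * (norm x)\<^sup>2) * f x) \<in> C0_inf \<Omega>"
proof (rule C0_infI_support[OF _ _ assms assms])
  show "Ck k (\<lambda>x. exp (- c * (norm x)\<^sup>2) * f x)" for k
    using assms by (intro Ck_mult Ck_gaussian) (auto simp: C0_inf_def)
qed auto

text \<open>The complement of the support is open and contains the complement of \<open>\<Omega>\<close>.\<close>

lemma C0_inf_outside:
  assumes f: "f \<in> C0_inf \<Omega>" and x: "x \<notin> \<Omega>"
  shows "f x = 0" "grad f x = 0"
proof -
  let ?S = "- closure {x. f x \<noteq> 0}"
  have xS: "x \<in> ?S" using f x by (auto simp: C0_inf_def)
  have z: "f y = 0" if "y \<in> ?S" for y using that closure_subset[of "{x. f x \<noteq> 0}"] by blast
  show "f x = 0" by (rule z[OF xS])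
  have "(f has_derivative (\<lambda>_. 0)) (at x)"
  proof (rule has_derivative_transform_within_open[OF has_derivative_const])
    show "open ?S" by (rule open_Compl[OF closed_closure])
    show "x \<in> ?S" by (rule xS)
    show "0 = f y" if "y \<in> ?S" for y using z[OF that] by simp
  qed
  then have "GDERIV f x :> 0" by (simp add: gderiv_def)
  then show "grad f x = 0" by (rule grad_eqI)
qed

section \<open>The completions as function spaces\<close>

lemma AE_lebesgue_on_iff:
  fixes \<Omega> :: "'a::euclidean_space set"
  assumes "open \<Omega>"
  shows "(AE x in lebesgue_on \<Omega>. P x) \<longleftrightarrow> (AE x in lborel. x \<in> \<Omega> \<longrightarrow> P x)"
  using assms by (subst AE_restrict_space_iff) (auto simp: AE_completion_iff)

lemma lebesgue_on_integral_eq: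
  fixes f :: "'a::euclidean_space \<Rightarrow> real"
  assumes \<Omega>: "open \<Omega>" and f[measurable]: "f \<in> borel_measurable borel" and zero: "\<And>x. x \<notin> \<Omega> \<Longrightarrow> f x = 0" and nn: "\<And>x. 0 \<le> f x"
  shows "(LINT x|lebesgue_on \<Omega>. f x) = enn2real (\<integral>\<^sup>+x. ennreal (f x) \<partial>lborel)"
proof -
  have "(LINT x|lebesgue_on \<Omega>. f x) = (LINT x|lebesgue. indicator \<Omega> x *\<^sub>R f x)"
    using \<Omega> by (intro integral_restrict_space) auto
  also have "(\<lambda>x. indicator \<Omega> x *\<^sub>R f x) = f" using zero by (auto simp: fun_eq_iff indicator_def)
  also have "(LINT x|lebesgue. f x) = (LINT x|lborel. f x)" by (rule integral_completion) simp
  also have "\<dots> = enn2real (\<integral>\<^sup>+x. ennreal (f x) \<partial>lborel)"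
    using nn by (intro integral_eq_nn_integral) auto
  finally show ?thesis .
qed

lemma weighted_integral_eq:
  fixes f :: "'a::euclidean_space \<Rightarrow> real"
  assumes \<Omega>: "open \<Omega>" and f[measurable]: "f \<in> borel_measurable borel" and zero: "\<And>x. x \<notin> \<Omega> \<Longrightarrow> f x = 0"
  shows "(LINT x|lebesgue_on \<Omega>. \<bar>f x\<bar> powr p / norm x powr q) = enn2real (\<integral>\<^sup>+x. ennreal (\<bar>f x\<bar> powr p) \<partial>pow_lborel q)"
proof -
  have "(LINT x|lebesgue_on \<Omega>. \<bar>f x\<bar> powr p / norm x powr q) = enn2real (\<integral>\<^sup>+x. ennreal (\<bar>f x\<bar> powr p / norm x powr q) \<partial>lborel)"
    using zero by (intro lebesgue_on_integral_eq[OF \<Omega>]) auto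
  also have "(\<integral>\<^sup>+x. ennreal (\<bar>f x\<bar> powr p / norm x powr q) \<partial>lborel) = (\<integral>\<^sup>+x. ennreal (\<bar>f x\<bar> powr p) \<partial>pow_lborel q)"
    by (subst nn_integral_pow_lborel) (auto simp: ennreal_mult[symmetric] powr_minus divide_inverse mult.commute intro!: nn_integral_cong)
  finally show ?thesis .
qed

text \<open>The norm as a real number. It is meaningful only when some bound \<open>Lp_le p M f F\<close> holds.\<close>

definition Lp_value :: "real \<Rightarrow> 'a measure \<Rightarrow> ('a \<Rightarrow> real) \<Rightarrow> real" where
  "Lp_value p M f = enn2real (\<integral>\<^sup>+x. ennreal (\<bar>f x\<bar> powr p) \<partial>M) powr (1 / p)"

lemma Lp_value_nonneg: "0 \<le> Lp_value p M f" by (simp add: Lp_value_def)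

lemma Lp_value_le:
  assumes f: "Lp_le p M f F" and p: "0 < p"
  shows "Lp_value p M f \<le> F"
proof -
  have "enn2real (\<integral>\<^sup>+x. ennreal (\<bar>f x\<bar> powr p) \<partial>M) \<le> F powr p"
    using Lp_leD(3)[OF f] by (metis enn2real_leI powr_ge_zero)
  then have "Lp_value p M f \<le> (F powr p) powr (1 / p)"
    unfolding Lp_value_def using p by (intro powr_mono2) auto
  then show ?thesis using p Lp_leD(2)[OF f] by (simp add: powr_powr)
qed

lemma Lp_le_Lp_value:
  assumes f: "Lp_le p M f F" and p: "0 < p"
  shows "Lp_le p M f (Lp_value p M f)"
proof -
  have "(\<integral>\<^sup>+x. ennreal (\<bar>f x\<bar> powr p) \<partial>M) < \<infinity>"
    using Lp_leD(3)[OF f] by (metis ennreal_less_top infinity_ennreal_def le_less_trans)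
  then have "(\<integral>\<^sup>+x. ennreal (\<bar>f x\<bar> powr p) \<partial>M) = ennreal (Lp_value p M f powr p)"
    unfolding Lp_value_def using p by (simp add: powr_powr)
  then show ?thesis using Lp_leD(1)[OF f] Lp_value_nonneg[of p M f] by (simp add: Lp_le_def)
qed

lemma Lp_value_diff_le:
  assumes f: "Lp_le p M f F" and g: "Lp_le p M g G" and d: "Lp_le p M (\<lambda>x. f x - g x) e" and p: "1 \<le> p"
  shows "\<bar>Lp_value p M f - Lp_value p M g\<bar> \<le> e"
proof -
  have "Lp_le p M f (e + Lp_value p M g)" "Lp_le p M g (Lp_value p M f + e)"
    using Lp_le_add[OF d Lp_le_Lp_value[OF g] p] Lp_le_diff[OF Lp_le_Lp_value[OF f] d p] p by auto
  then have "Lp_value p M f \<le> e + Lp_value p M g" "Lp_value p M g \<le> Lp_value p M f + e"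
    using p by (auto intro: Lp_value_le)
  then show ?thesis by linarith
qed

lemma weighted_norm_eq:
  fixes \<phi> :: "'a::euclidean_space \<Rightarrow> real"
  assumes "open \<Omega>" "\<phi> \<in> C0_inf \<Omega>"
  shows "weighted_norm r s \<Omega> \<phi> = Lp_value r (pow_lborel s) \<phi>"
  unfolding weighted_norm_def Lp_value_def using assms C0_inf_C1c[OF assms(2)]
  by (subst weighted_integral_eq) (auto simp: C1c_def C0_inf_outside C1_measurable)

lemma grad_norm_eq:
  fixes \<phi> :: "'a::euclidean_space \<Rightarrow> real"
  assumes "open \<Omega>" "\<phi> \<in> C0_inf \<Omega>"
  shows "grad_norm p \<mu> \<Omega> \<phi> = Lp_value p (pow_lborel \<mu>) (\<lambda>x. norm (grad \<phi> x))"
proof -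
  have [measurable]: "grad \<phi> \<in> borel_measurable borel"
    using C0_inf_C1c[OF assms(2)] by (auto simp: C1c_def intro: C1_grad_measurable)
  show ?thesis
    unfolding grad_norm_def Lp_value_def using assms
      weighted_integral_eq[OF assms(1), of "\<lambda>x. norm (grad \<phi> x)" p \<mu>]
    by (simp add: C0_inf_outside)
qed

text \<open>The pointwise limit of the extended test functions is a Borel function on the whole space. It replaces
  \<open>u\<close>, which is only given almost everywhere on \<open>\<Omega>\<close>.\<close>

lemma approximates_representative:
  fixes \<Omega> :: "'a::euclidean_space set"
  assumes \<Omega>: "open \<Omega>" and ap: "approximates \<Omega> nrm \<phi> u"
  obtains U where "U \<in> borel_measurable borel" "\<And>x. x \<notin> \<Omega> \<Longrightarrow> U x = 0"
    "AE x in lborel. x \<in> \<Omega> \<longrightarrow> U x = u x" "AE x in lborel. (\<lambda>n. \<phi> n x) \<longlonglongrightarrow> U x"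
proof
  let ?U = "\<lambda>x. lim (\<lambda>n. \<phi> n x)"
  have \<phi>: "\<phi> n \<in> C0_inf \<Omega>" for n using ap by (simp add: approximates_def)
  have [measurable]: "\<phi> n \<in> borel_measurable borel" for n
    using C0_inf_C1c[OF \<phi>] by (auto simp: C1c_def intro: C1_measurable)
  show "?U \<in> borel_measurable borel" by measurable
  show out: "?U x = 0" if "x \<notin> \<Omega>" for x using C0_inf_outside(1)[OF \<phi> that] by simp
  have AE: "AE x in lborel. x \<in> \<Omega> \<longrightarrow> (\<lambda>n. \<phi> n x) \<longlonglongrightarrow> u x"
    using ap AE_lebesgue_on_iff[OF \<Omega>] by (simp add: approximates_def)
  then show "AE x in lborel. x \<in> \<Omega> \<longrightarrow> ?U x = u x"
    by eventually_elim (auto intro: limI)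
  show "AE x in lborel. (\<lambda>n. \<phi> n x) \<longlonglongrightarrow> ?U x"
    using AE
  proof eventually_elim
    case (elim x)
    show ?case
    proof (cases "x \<in> \<Omega>")
      case True
      then show ?thesis using elim by (auto simp: limI)
    next
      case False
      then show ?thesis using C0_inf_outside(1)[OF \<phi> False] by simp
    qed
  qed
qed

lemma representative_unique:
  assumes "AE x in lborel. x \<in> \<Omega> \<longrightarrow> U x = u x" "AE x in lborel. x \<in> \<Omega> \<longrightarrow> U' x = u x"
    "\<And>x. x \<notin> \<Omega> \<Longrightarrow> U x = 0" "\<And>x. x \<notin> \<Omega> \<Longrightarrow> U' x = 0"
  shows "AE x in lborel. U x = U' x"
  using assms(1,2) by eventually_elim (metis assms(3,4))

text \<open>For any approximating sequence, Fatou's lemma turns the Cauchy property into convergence to \<open>U\<close> in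
  norm, so the limit of the norms is the norm of \<open>U\<close> and the definite description in
  \<open>completion_norm\<close> denotes it.\<close>

lemma weighted_Lr_representative:
  fixes \<Omega> :: "'a::euclidean_space set"
  assumes \<Omega>: "open \<Omega>" and r: "1 \<le> r" and s: "s < real DIM('a)"
    and U: "U \<in> borel_measurable borel" "\<And>x. x \<notin> \<Omega> \<Longrightarrow> U x = 0" "AE x in lborel. x \<in> \<Omega> \<longrightarrow> U x = u x"
    and dense: "\<And>e. 0 < e \<Longrightarrow> \<exists>\<psi>\<in>C0_inf \<Omega>. Lp_le r (pow_lborel s) (\<lambda>x. \<psi> x - U x) e"
  shows "u \<in> weighted_Lr r s \<Omega>" "weighted_Lr_norm r s \<Omega> u = Lp_value r (pow_lborel s) U"
proof -
  have r0: "0 < r" using r by simp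
  have fin: "\<exists>F. Lp_le r (pow_lborel s) \<phi> F" if "\<phi> \<in> C0_inf \<Omega>" for \<phi>
    using C1c_Lp_le[OF C0_inf_C1c[OF that] s r0] by blast
  have "\<forall>n. \<exists>\<psi>\<in>C0_inf \<Omega>. Lp_le r (pow_lborel s) (\<lambda>x. \<psi> x - U x) ((1/2)^n)" using dense by simp
  then obtain \<psi> where \<psi>: "\<And>n. \<psi> n \<in> C0_inf \<Omega>" "\<And>n. Lp_le r (pow_lborel s) (\<lambda>x. \<psi> n x - U x) ((1/2)^n)" by metis
  have half: "(\<lambda>n. (1/2::real)^n) \<longlonglongrightarrow> 0" by (intro LIMSEQ_power_zero) simp
  have UF: "\<exists>F. Lp_le r (pow_lborel s) U F"
  proof -
    obtain F where "Lp_le r (pow_lborel s) (\<psi> 0) F" using fin \<psi>(1) by blast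
    from Lp_le_diff[OF this \<psi>(2)[of 0] r] show ?thesis by auto
  qed
  then obtain F where F: "Lp_le r (pow_lborel s) U F" by blast
  have apx: "approximates \<Omega> (weighted_norm r s \<Omega>) \<psi> u"
    unfolding approximates_def
  proof (intro conjI allI)
    show "\<psi> n \<in> C0_inf \<Omega>" for n by fact
    show "norm_Cauchy (weighted_norm r s \<Omega>) \<psi>"
      unfolding norm_Cauchy_def
    proof (intro allI impI)
      fix e :: real assume "0 < e"
      then have "\<forall>\<^sub>F n in sequentially. (1/2::real)^n < e / 2" by (intro order_tendstoD(2)[OF half]) simp
      then obtain M where M: "\<And>n. n \<ge> M \<Longrightarrow> (1/2::real)^n < e / 2" by (auto simp: eventually_sequentially)
      have "weighted_norm r s \<Omega> (\<lambda>x. \<psi> m x - \<psi> n x) < e" if "m \<ge> M" "n \<ge> M" for m n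
      proof -
        have "Lp_le r (pow_lborel s) (\<lambda>x. \<psi> m x - \<psi> n x) ((1/2)^m + (1/2)^n)"
          using Lp_le_diff[OF \<psi>(2)[of m] \<psi>(2)[of n] r] by simp
        then have "weighted_norm r s \<Omega> (\<lambda>x. \<psi> m x - \<psi> n x) \<le> (1/2)^m + (1/2)^n"
          using weighted_norm_eq[OF \<Omega> C0_inf_diff[OF \<psi>(1) \<psi>(1)]] Lp_value_le r0 by simp
        then show ?thesis using M[OF that(1)] M[OF that(2)] by linarith
      qed
      then show "\<exists>M. \<forall>m\<ge>M. \<forall>n\<ge>M. weighted_norm r s \<Omega> (\<lambda>x. \<psi> m x - \<psi> n x) < e" by blast
    qed
    have "AE x in lborel. (\<lambda>n. \<psi> n x) \<longlonglongrightarrow> U x"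
      using Lp_le_fast_AE_tendsto[OF \<psi>(2) r] by (simp add: AE_pow_lborel_iff)
    then have "AE x in lborel. x \<in> \<Omega> \<longrightarrow> (\<lambda>n. \<psi> n x) \<longlonglongrightarrow> u x"
      using U(3) by eventually_elim auto
    then show "AE x in lebesgue_on \<Omega>. (\<lambda>n. \<psi> n x) \<longlonglongrightarrow> u x" using AE_lebesgue_on_iff[OF \<Omega>] by blast
  qed
  then show "u \<in> weighted_Lr r s \<Omega>" by (auto simp: weighted_Lr_def completion_def)
  have conv: "(\<lambda>n. weighted_norm r s \<Omega> (\<phi> n)) \<longlonglongrightarrow> Lp_value r (pow_lborel s) U"
    if ap: "approximates \<Omega> (weighted_norm r s \<Omega>) \<phi> u" for \<phi>
  proof (rule LIMSEQ_I)
    have \<phi>: "\<phi> n \<in> C0_inf \<Omega>" for n using ap by (simp add: approximates_def)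
    obtain V where V: "V \<in> borel_measurable borel" "\<And>x. x \<notin> \<Omega> \<Longrightarrow> V x = 0"
      "AE x in lborel. x \<in> \<Omega> \<longrightarrow> V x = u x" "AE x in lborel. (\<lambda>n. \<phi> n x) \<longlonglongrightarrow> V x"
      using approximates_representative[OF \<Omega> ap] by blast
    have "AE x in lborel. V x = U x" by (rule representative_unique[OF V(3) U(3) V(2) U(2)])
    then have lim: "AE x in lborel. (\<lambda>n. \<phi> n x) \<longlonglongrightarrow> U x" using V(4) by eventually_elim simp
    fix e :: real assume e: "0 < e"
    then have "\<exists>M. \<forall>m\<ge>M. \<forall>n\<ge>M. weighted_norm r s \<Omega> (\<lambda>x. \<phi> m x - \<phi> n x) < e / 2"
      using ap half_gt_zero unfolding approximates_def norm_Cauchy_def by blast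
    then obtain M where M: "\<And>m n. m \<ge> M \<Longrightarrow> n \<ge> M \<Longrightarrow> weighted_norm r s \<Omega> (\<lambda>x. \<phi> m x - \<phi> n x) < e / 2" by blast
    have MLp: "Lp_le r (pow_lborel s) (\<lambda>x. \<phi> m x - \<phi> n x) (e / 2)" if "m \<ge> M" "n \<ge> M" for m n
    proof -
      obtain G where G: "Lp_le r (pow_lborel s) (\<lambda>x. \<phi> m x - \<phi> n x) G" using fin[OF C0_inf_diff[OF \<phi> \<phi>]] by blast
      show ?thesis
        using Lp_le_weaken[OF Lp_le_Lp_value[OF G r0]] M[OF that] weighted_norm_eq[OF \<Omega> C0_inf_diff[OF \<phi> \<phi>], of r s m n] r0 by simp
    qed
    have "norm (weighted_norm r s \<Omega> (\<phi> n) - Lp_value r (pow_lborel s) U) < e" if n: "n \<ge> M" for n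
    proof -
      have "Lp_le r (pow_lborel s) (\<lambda>x. \<phi> n x - U x) (e / 2)"
      proof (rule Lp_le_Fatou[where f="\<lambda>m x. \<phi> n x - \<phi> (m + M) x" and F="\<lambda>_. e / 2"])
        show "Lp_le r (pow_lborel s) (\<lambda>x. \<phi> n x - \<phi> (m + M) x) (e / 2)" for m using n by (intro MLp) auto
        show "AE x in pow_lborel s. (\<lambda>m. \<phi> n x - \<phi> (m + M) x) \<longlonglongrightarrow> \<phi> n x - U x"
          unfolding AE_pow_lborel_iff using lim
          by eventually_elim (rule tendsto_diff[OF tendsto_const LIMSEQ_ignore_initial_segment])
        show "(\<lambda>x. \<phi> n x - U x) \<in> borel_measurable (pow_lborel s)"
          unfolding borel_measurable_pow_lborel using C0_inf_C1c[OF \<phi>[of n]]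
          by (intro borel_measurable_diff C1_measurable U(1)) (simp add: C1c_def)
      qed (use r0 in auto)
      moreover obtain G where "Lp_le r (pow_lborel s) (\<phi> n) G" using fin \<phi> by blast
      ultimately have "\<bar>Lp_value r (pow_lborel s) (\<phi> n) - Lp_value r (pow_lborel s) U\<bar> \<le> e / 2" using F r by (intro Lp_value_diff_le) auto
      then show ?thesis using e weighted_norm_eq[OF \<Omega> \<phi>] by simp
    qed
    then show "\<exists>M. \<forall>n\<ge>M. norm (weighted_norm r s \<Omega> (\<phi> n) - Lp_value r (pow_lborel s) U) < e" by blast
  qed
  show "weighted_Lr_norm r s \<Omega> u = Lp_value r (pow_lborel s) U"
    unfolding weighted_Lr_norm_def completion_norm_def
  proof (rule the_equality)
    show "\<exists>\<phi>. approximates \<Omega> (weighted_norm r s \<Omega>) \<phi> u \<and> (\<lambda>n. weighted_norm r s \<Omega> (\<phi> n)) \<longlonglongrightarrow> Lp_value r (pow_lborel s) U"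
      using apx conv by blast
    show "l = Lp_value r (pow_lborel s) U"
      if "\<exists>\<phi>. approximates \<Omega> (weighted_norm r s \<Omega>) \<phi> u \<and> (\<lambda>n. weighted_norm r s \<Omega> (\<phi> n)) \<longlonglongrightarrow> l" for l
      using that conv LIMSEQ_unique by blast
  qed
qed

text \<open>The limit of the gradient norms must be shown to be the same for any two sequences \<open>\<phi>\<close> and
  \<open>\<psi>\<close> that represent \<open>u\<close>. Their difference \<open>\<zeta>\<close> tends to zero almost everywhere and is Cauchy, and
  lower semicontinuity along \<open>\<zeta> m - \<zeta> n\<close> as \<open>n\<close> grows makes the gradient norm of \<open>\<zeta> m\<close> small.\<close>

lemma W1p_representative:
  fixes \<Omega> :: "'a::euclidean_space set"
  assumes \<Omega>: "open \<Omega>" and p: "1 \<le> p" and \<mu>: "p + \<mu> < real DIM('a)"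
    and u: "u \<in> W1p p \<mu> \<Omega>"
  obtains U where "\<And>x. x \<notin> \<Omega> \<Longrightarrow> U x = 0" "AE x in lborel. x \<in> \<Omega> \<longrightarrow> U x = u x"
    "energy_le p \<mu> U (W1p_norm p \<mu> \<Omega> u)"
    "\<And>e. 0 < e \<Longrightarrow> \<exists>\<phi>\<in>C0_inf \<Omega>. energy_le p \<mu> (\<lambda>x. \<phi> x - U x) e"
proof -
  let ?nrm = "grad_norm p \<mu> \<Omega>"
  let ?H = "Hardy_const (real DIM('a)) p \<mu>"
  have p0: "0 < p" and \<mu>N: "\<mu> < real DIM('a)" using p \<mu> by auto
  have H: "0 < ?H" using Hardy_const_pos p0 \<mu> .
  have C1: "C1 \<phi>" if "\<phi> \<in> C0_inf \<Omega>" for \<phi> using C0_inf_C1c[OF that] by (simp add: C1c_def)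
  have grad_Lp: "Lp_le p (pow_lborel \<mu>) (\<lambda>x. norm (grad \<phi> x)) (?nrm \<phi>)" if "\<phi> \<in> C0_inf \<Omega>" for \<phi>
    using C1c_grad_Lp_le[OF C0_inf_C1c[OF that] \<mu>N p0] Lp_le_Lp_value p0 grad_norm_eq[OF \<Omega> that] by metis
  have norm_diff: "\<bar>?nrm \<phi> - ?nrm \<psi>\<bar> \<le> e"
    if \<phi>: "\<phi> \<in> C0_inf \<Omega>" and \<psi>: "\<psi> \<in> C0_inf \<Omega>" and e: "Lp_le p (pow_lborel \<mu>) (\<lambda>x. norm (grad (\<lambda>x. \<phi> x - \<psi> x) x)) e" for \<phi> \<psi> e
  proof -
    note [measurable] = C1_grad_measurable[OF C1[OF \<phi>]] C1_grad_measurable[OF C1[OF \<psi>]]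
    have "Lp_le p (pow_lborel \<mu>) (\<lambda>x. norm (grad \<phi> x) - norm (grad \<psi> x)) e"
      using p0 by (intro Lp_le_mono[OF e])
        (auto simp: C1_diff(2)[OF C1[OF \<phi>] C1[OF \<psi>]] borel_measurable_pow_lborel intro!: always_eventually norm_triangle_ineq3)
    then show ?thesis
      unfolding grad_norm_eq[OF \<Omega> \<phi>] grad_norm_eq[OF \<Omega> \<psi>] by (rule Lp_value_diff_le[OF grad_Lp[OF \<phi>] grad_Lp[OF \<psi>] _ p])
  qed
  have cauchy: "\<exists>M. \<forall>m\<ge>M. \<forall>n\<ge>M. Lp_le p (pow_lborel \<mu>) (\<lambda>x. norm (grad (\<lambda>x. \<phi> m x - \<phi> n x) x)) e"
    if ap: "approximates \<Omega> ?nrm \<phi> u" and e: "0 < e" for \<phi> e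
  proof -
    have \<phi>: "\<phi> n \<in> C0_inf \<Omega>" for n using ap by (simp add: approximates_def)
    obtain M where M: "\<And>m n. m \<ge> M \<Longrightarrow> n \<ge> M \<Longrightarrow> ?nrm (\<lambda>x. \<phi> m x - \<phi> n x) < e"
      using ap e unfolding approximates_def norm_Cauchy_def by blast
    have "Lp_le p (pow_lborel \<mu>) (\<lambda>x. norm (grad (\<lambda>x. \<phi> m x - \<phi> n x) x)) e" if "m \<ge> M" "n \<ge> M" for m n
      using Lp_le_weaken[OF grad_Lp[OF C0_inf_diff[OF \<phi>[of m] \<phi>[of n]]]] M[OF that] p0 by simp
    then show ?thesis by blast
  qed
  obtain \<phi> where ap: "approximates \<Omega> ?nrm \<phi> u" using u by (auto simp: W1p_def completion_def)
  have \<phi>: "\<phi> n \<in> C0_inf \<Omega>" for n using ap by (simp add: approximates_def)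
  note \<phi>m = C1_measurable[OF C1[OF \<phi>]]
  obtain U where U: "U \<in> borel_measurable borel" "\<And>x. x \<notin> \<Omega> \<Longrightarrow> U x = 0"
    "AE x in lborel. x \<in> \<Omega> \<longrightarrow> U x = u x" "AE x in lborel. (\<lambda>n. \<phi> n x) \<longlonglongrightarrow> U x"
    using approximates_representative[OF \<Omega> ap] by blast
  note [measurable] = \<phi>m U(1)
  have near: "\<exists>M. \<forall>n\<ge>M. Lp_le p (pow_lborel (p + \<mu>)) (\<lambda>x. \<phi> n x - U x) e" if e: "0 < e" for e
  proof -
    have "0 < e / ?H" using e H by simp
    from cauchy[OF ap this] obtain M where M: "\<And>m n. m \<ge> M \<Longrightarrow> n \<ge> M \<Longrightarrow>
      Lp_le p (pow_lborel \<mu>) (\<lambda>x. norm (grad (\<lambda>x. \<phi> m x - \<phi> n x) x)) (e / ?H)" by blast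
    have "Lp_le p (pow_lborel (p + \<mu>)) (\<lambda>x. \<phi> n x - U x) e" if n: "n \<ge> M" for n
    proof (rule Lp_le_Fatou[where f="\<lambda>m x. \<phi> n x - \<phi> (m + M) x" and F="\<lambda>_. e"])
      show "Lp_le p (pow_lborel (p + \<mu>)) (\<lambda>x. \<phi> n x - \<phi> (m + M) x) e" for m
      proof -
        have "Lp_le p (pow_lborel (p + \<mu>)) (\<lambda>x. \<phi> n x - \<phi> (m + M) x) ((e / ?H) / (1 - 2 powr ((p + \<mu> - real DIM('a)) / p)))"
          using n by (intro Hardy[OF C0_inf_C1c[OF C0_inf_diff[OF \<phi> \<phi>]] p \<mu>] M) auto
        also have "(e / ?H) / (1 - 2 powr ((p + \<mu> - real DIM('a)) / p)) = e"
        proof -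
          define c where "c = 1 - 2 powr ((p + \<mu> - real DIM('a)) / p)"
          have "?H = 1 / c" by (simp add: Hardy_const_def c_def)
          moreover from this H have "c \<noteq> 0" by auto
          ultimately show ?thesis unfolding c_def[symmetric] by simp
        qed
        finally show ?thesis .
      qed
      show "AE x in pow_lborel (p + \<mu>). (\<lambda>m. \<phi> n x - \<phi> (m + M) x) \<longlonglongrightarrow> \<phi> n x - U x"
        unfolding AE_pow_lborel_iff using U(4)
        by eventually_elim (rule tendsto_diff[OF tendsto_const LIMSEQ_ignore_initial_segment])
    qed (use p0 in auto)
    then show ?thesis by blast
  qed
  have "Cauchy (\<lambda>n. ?nrm (\<phi> n))"
  proof (rule metric_CauchyI)
    fix e :: real assume "0 < e"
    then have "0 < e / 2" by simp
    from cauchy[OF ap this] obtain M where M: "\<And>m n. m \<ge> M \<Longrightarrow> n \<ge> M \<Longrightarrow>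
      Lp_le p (pow_lborel \<mu>) (\<lambda>x. norm (grad (\<lambda>x. \<phi> m x - \<phi> n x) x)) (e / 2)" by blast
    have "dist (?nrm (\<phi> m)) (?nrm (\<phi> n)) < e" if "m \<ge> M" "n \<ge> M" for m n
      using norm_diff[OF \<phi> \<phi> M[OF that]] \<open>0 < e\<close> by (simp add: dist_real_def)
    then show "\<exists>M. \<forall>m\<ge>M. \<forall>n\<ge>M. dist (?nrm (\<phi> m)) (?nrm (\<phi> n)) < e" by blast
  qed
  then obtain \<omega> where \<omega>: "(\<lambda>n. ?nrm (\<phi> n)) \<longlonglongrightarrow> \<omega>" by (auto simp: Cauchy_convergent_iff convergent_def)
  have unique: "l = \<omega>" if ap': "approximates \<Omega> ?nrm \<psi> u" and l: "(\<lambda>n. ?nrm (\<psi> n)) \<longlonglongrightarrow> l" for \<psi> l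
  proof -
    have \<psi>: "\<psi> n \<in> C0_inf \<Omega>" for n using ap' by (simp add: approximates_def)
    obtain V where V: "V \<in> borel_measurable borel" "\<And>x. x \<notin> \<Omega> \<Longrightarrow> V x = 0"
      "AE x in lborel. x \<in> \<Omega> \<longrightarrow> V x = u x" "AE x in lborel. (\<lambda>n. \<psi> n x) \<longlonglongrightarrow> V x"
      using approximates_representative[OF \<Omega> ap'] by blast
    have "AE x in lborel. V x = U x" by (rule representative_unique[OF V(3) U(3) V(2) U(2)])
    then have lim: "AE x in lborel. (\<lambda>n. \<phi> n x - \<psi> n x) \<longlonglongrightarrow> 0"
      using V(4) U(4)
    proof eventually_elim
      case (elim x)
      then show ?case using tendsto_diff[OF elim(3) elim(2)] by simp
    qed
    let ?K = "real DIM('a) * 2 powr (\<bar>\<mu>\<bar> / p)"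
    have "\<bar>\<omega> - l\<bar> \<le> 0 + e" if e: "0 < e" for e
    proof -
      define d where "d = e / (?K * 2)"
      have d: "0 < d" using e by (simp add: d_def)
      from cauchy[OF ap d] obtain M where M: "\<And>m n. m \<ge> M \<Longrightarrow> n \<ge> M \<Longrightarrow>
        Lp_le p (pow_lborel \<mu>) (\<lambda>x. norm (grad (\<lambda>x. \<phi> m x - \<phi> n x) x)) d" by blast
      from cauchy[OF ap' d] obtain M' where M': "\<And>m n. m \<ge> M' \<Longrightarrow> n \<ge> M' \<Longrightarrow>
        Lp_le p (pow_lborel \<mu>) (\<lambda>x. norm (grad (\<lambda>x. \<psi> m x - \<psi> n x) x)) d" by blast
      define \<zeta> where "\<zeta> n x = \<phi> n x - \<psi> n x" for n x
      have \<zeta>: "\<zeta> n \<in> C0_inf \<Omega>" for n unfolding \<zeta>_def by (intro C0_inf_diff \<phi> \<psi>)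
      have \<zeta>d: "Lp_le p (pow_lborel \<mu>) (\<lambda>x. norm (grad (\<lambda>x. \<zeta> m x - \<zeta> n x) x)) (d + d)"
        if "m \<ge> M" "n \<ge> M" "m \<ge> M'" "n \<ge> M'" for m n
      proof -
        let ?f = "\<lambda>x. \<phi> m x - \<phi> n x" and ?g = "\<lambda>x. \<psi> m x - \<psi> n x"
        have C: "C1 ?f" "C1 ?g" by (intro C1 C0_inf_diff \<phi> \<psi>)+
        note [measurable] = C1_grad_measurable[OF C(1)] C1_grad_measurable[OF C(2)]
        have "(\<lambda>x. \<zeta> m x - \<zeta> n x) = (\<lambda>x. ?f x - ?g x)" by (auto simp: \<zeta>_def)
        then have eq: "grad (\<lambda>x. \<zeta> m x - \<zeta> n x) = (\<lambda>x. grad ?f x - grad ?g x)" using C1_diff(2)[OF C] by simp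
        have "Lp_le p (pow_lborel \<mu>) (\<lambda>x. norm (grad ?f x) + norm (grad ?g x)) (d + d)"
          using that by (intro Lp_le_add M M' p)
        then show ?thesis unfolding eq
          using p0 by (rule_tac Lp_le_mono) (auto simp: borel_measurable_pow_lborel intro!: always_eventually norm_triangle_ineq4)
      qed
      have grad_\<zeta>: "Lp_le p (pow_lborel \<mu>) (\<lambda>x. norm (grad (\<zeta> m) x)) (real DIM('a) * (2 powr (\<bar>\<mu>\<bar> / p) * (d + d)))"
        if m: "m \<ge> M" "m \<ge> M'" for m
      proof (rule grad_lower_semicontinuous[where \<psi>="\<lambda>n x. \<zeta> m x - \<zeta> (n + max M M') x"])
        show "C1 (\<zeta> m)" "C1 (\<lambda>x. \<zeta> m x - \<zeta> (n + max M M') x)" for n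
          by (intro C1 C0_inf_diff \<zeta>)+
        show "AE x in lborel. (\<lambda>n. \<zeta> m x - \<zeta> (n + max M M') x) \<longlonglongrightarrow> \<zeta> m x"
          using lim
        proof eventually_elim
          case (elim x)
          have "(\<lambda>n. \<zeta> m x - \<zeta> (n + max M M') x) \<longlonglongrightarrow> \<zeta> m x - 0"
            unfolding \<zeta>_def by (rule tendsto_diff[OF tendsto_const LIMSEQ_ignore_initial_segment[OF elim]])
          then show ?case by simp
        qed
        show "Lp_le p (pow_lborel \<mu>) (\<lambda>x. norm (grad (\<lambda>x. \<zeta> m x - \<zeta> (n + max M M') x) x)) (d + d)" for n
          using m by (intro \<zeta>d) auto
      qed fact
      have e': "real DIM('a) * (2 powr (\<bar>\<mu>\<bar> / p) * (d + d)) = e" by (simp add: d_def)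
      have "\<bar>?nrm (\<phi> m) - ?nrm (\<psi> m)\<bar> \<le> e" if m: "m \<ge> max M M'" for m
        using norm_diff[OF \<phi> \<psi>, of m m e] grad_\<zeta>[of m] m unfolding e' \<zeta>_def by simp
      moreover have "(\<lambda>m. \<bar>?nrm (\<phi> m) - ?nrm (\<psi> m)\<bar>) \<longlonglongrightarrow> \<bar>\<omega> - l\<bar>"
        by (intro tendsto_rabs tendsto_diff \<omega> l)
      ultimately have "\<bar>\<omega> - l\<bar> \<le> e" by (intro LIMSEQ_le_const2 exI[of _ "max M M'"]) auto
      then show ?thesis by simp
    qed
    then have "\<bar>\<omega> - l\<bar> \<le> 0" by (rule field_le_epsilon)
    then show ?thesis by simp
  qed
  have norm_eq: "W1p_norm p \<mu> \<Omega> u = \<omega>"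
    unfolding W1p_norm_def completion_norm_def using ap \<omega> unique by (intro the_equality) blast+
  show thesis
  proof (rule that[OF U(2,3)])
    show "energy_le p \<mu> U (W1p_norm p \<mu> \<Omega> u)"
      unfolding energy_le_def norm_eq
    proof (intro conjI allI impI)
      show "0 \<le> \<omega>"
        by (rule LIMSEQ_le_const[OF \<omega>]) (simp add: grad_norm_def)
      fix e :: real assume e: "0 < e"
      from near[OF e] obtain M where M: "\<And>n. n \<ge> M \<Longrightarrow> Lp_le p (pow_lborel (p + \<mu>)) (\<lambda>x. \<phi> n x - U x) e" by blast
      have "\<forall>\<^sub>F n in sequentially. ?nrm (\<phi> n) < \<omega> + e" using e by (intro order_tendstoD(2)[OF \<omega>]) simp
      then obtain M' where M': "\<And>n. n \<ge> M' \<Longrightarrow> ?nrm (\<phi> n) < \<omega> + e" by (auto simp: eventually_sequentially)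
      have "Lp_le p (pow_lborel \<mu>) (\<lambda>x. norm (grad (\<phi> (max M M')) x)) (\<omega> + e)"
        using Lp_le_weaken[OF grad_Lp[OF \<phi>[of "max M M'"]]] M'[of "max M M'"] p0 by simp
      then show "\<exists>\<phi>. C1c \<phi> \<and> Lp_le p (pow_lborel \<mu>) (\<lambda>x. norm (grad \<phi> x)) (\<omega> + e) \<and> Lp_le p (pow_lborel (p + \<mu>)) (\<lambda>x. \<phi> x - U x) e"
        using C0_inf_C1c[OF \<phi>] M[of "max M M'"] by auto
    qed fact
    fix e :: real assume e: "0 < e"
    from cauchy[OF ap e] obtain M where M: "\<And>m n. m \<ge> M \<Longrightarrow> n \<ge> M \<Longrightarrow>
        Lp_le p (pow_lborel \<mu>) (\<lambda>x. norm (grad (\<lambda>x. \<phi> m x - \<phi> n x) x)) e" by blast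
    have "energy_le p \<mu> (\<lambda>x. \<phi> M x - U x) e"
      unfolding energy_le_def
    proof (intro conjI allI impI)
      show "(\<lambda>x. \<phi> M x - U x) \<in> borel_measurable borel" by measurable
      show "0 \<le> e" using e by simp
      fix e' :: real assume e': "0 < e'"
      from near[OF e'] obtain M' where M': "\<And>n. n \<ge> M' \<Longrightarrow> Lp_le p (pow_lborel (p + \<mu>)) (\<lambda>x. \<phi> n x - U x) e'" by blast
      let ?n = "max M M'"
      have "Lp_le p (pow_lborel \<mu>) (\<lambda>x. norm (grad (\<lambda>x. \<phi> M x - \<phi> ?n x) x)) (e + e')"
        using Lp_le_weaken[OF M[of M ?n]] e' p0 by simp
      moreover have "Lp_le p (pow_lborel (p + \<mu>)) (\<lambda>x. (\<phi> M x - \<phi> ?n x) - (\<phi> M x - U x)) e'"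
        using M'[of ?n] Lp_le_minus_commute[of p "pow_lborel (p + \<mu>)" "\<phi> ?n" U e'] by simp
      ultimately show "\<exists>\<psi>. C1c \<psi> \<and> Lp_le p (pow_lborel \<mu>) (\<lambda>x. norm (grad \<psi> x)) (e + e') \<and> Lp_le p (pow_lborel (p + \<mu>)) (\<lambda>x. \<psi> x - (\<phi> M x - U x)) e'"
        using C0_inf_C1c[OF C0_inf_diff[OF \<phi>[of M] \<phi>[of ?n]]] by blast
    qed
    then show "\<exists>\<phi>\<in>C0_inf \<Omega>. energy_le p \<mu> (\<lambda>x. \<phi> x - U x) e" using \<phi> by blast
  qed
qed

lemma Lp_representative:
  fixes \<Omega> :: "'a::euclidean_space set"
  assumes \<Omega>: "open \<Omega>" and p: "0 < p" and u: "u \<in> Lp p \<Omega>"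
    and U: "U \<in> borel_measurable borel" "\<And>x. x \<notin> \<Omega> \<Longrightarrow> U x = 0" "AE x in lborel. x \<in> \<Omega> \<longrightarrow> U x = u x"
  shows "Lp_le p lborel U (Lp_norm p \<Omega> u)"
proof -
  have u': "u \<in> borel_measurable (lebesgue_on \<Omega>)" "integrable (lebesgue_on \<Omega>) (\<lambda>x. \<bar>u x\<bar> powr p)"
    using u by (auto simp: Lp_def)
  have Um: "U \<in> borel_measurable (lebesgue_on \<Omega>)"
    using U(1) by (intro measurable_restrict_space1 measurable_completion) simp
  have AE: "AE x in lebesgue_on \<Omega>. \<bar>u x\<bar> powr p = \<bar>U x\<bar> powr p"
    unfolding AE_lebesgue_on_iff[OF \<Omega>] using U(3) by eventually_elim auto
  have int: "integrable (lebesgue_on \<Omega>) (\<lambda>x. \<bar>U x\<bar> powr p)"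
    using u' Um AE by (subst integrable_cong_AE[symmetric]) auto
  have "(\<integral>\<^sup>+x. ennreal (\<bar>U x\<bar> powr p) \<partial>lebesgue_on \<Omega>) = (\<integral>\<^sup>+x. ennreal (\<bar>U x\<bar> powr p) \<partial>lborel)"
  proof -
    have "(\<integral>\<^sup>+x. ennreal (\<bar>U x\<bar> powr p) \<partial>lebesgue_on \<Omega>) = (\<integral>\<^sup>+x. ennreal (\<bar>U x\<bar> powr p) * indicator \<Omega> x \<partial>lebesgue)"
      using \<Omega> by (intro nn_integral_restrict_space) auto
    also have "\<dots> = (\<integral>\<^sup>+x. ennreal (\<bar>U x\<bar> powr p) \<partial>lebesgue)"
      using U(2) by (intro nn_integral_cong) (auto simp: indicator_def)
    also have "\<dots> = (\<integral>\<^sup>+x. ennreal (\<bar>U x\<bar> powr p) \<partial>lborel)"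
      by (rule nn_integral_completion)
    finally show ?thesis .
  qed
  moreover have "(\<integral>\<^sup>+x. ennreal (\<bar>U x\<bar> powr p) \<partial>lebesgue_on \<Omega>) = ennreal (LINT x|lebesgue_on \<Omega>. \<bar>U x\<bar> powr p)"
    by (rule nn_integral_eq_integral[OF int]) auto
  moreover have "(LINT x|lebesgue_on \<Omega>. \<bar>U x\<bar> powr p) = (LINT x|lebesgue_on \<Omega>. \<bar>u x\<bar> powr p)"
    using u' Um AE by (intro integral_cong_AE) (auto elim!: eventually_mono)
  moreover have "0 \<le> (LINT x|lebesgue_on \<Omega>. \<bar>u x\<bar> powr p)" by (intro integral_nonneg_AE) auto
  ultimately show ?thesis
    using U(1) p by (simp add: Lp_le_def Lp_norm_def powr_powr)
qed

section \<open>The compact embedding\<close>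

text \<open>Continuity constant: \<open>\<omega> + L \<le> (1 + 1 / lam) * (\<omega> + lam * L)\<close>. The limit of the subsequence exists by
  completeness of the weighted Lebesgue space and is cut off outside \<open>\<Omega>\<close>; it lies in the completion
  because members of the subsequence approximate it and have test functions nearby.\<close>

lemma (in exponents) compact_embedding_weighted:
  fixes \<Omega> :: "'a set"
  assumes \<Omega>: "open \<Omega>" and lam: "0 < lam" and s: "s < N"
  shows "compact_embedding
           (W1p p \<mu> \<Omega> \<inter> Lp p \<Omega>) (\<lambda>u. W1p_norm p \<mu> \<Omega> u + lam * Lp_norm p \<Omega> u)
           (weighted_Lr r s \<Omega>) (weighted_Lr_norm r s \<Omega>)"
proof -
  let ?X = "W1p p \<mu> \<Omega> \<inter> Lp p \<Omega>"
  have p1: "1 \<le> p" "0 < p" and r1: "1 \<le> r" "0 < r" using p by auto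
  have s': "s < real DIM('a)" using s N_eq by simp
  have "\<forall>u\<in>?X. \<exists>U. U \<in> borel_measurable borel \<and> (\<forall>x. x \<notin> \<Omega> \<longrightarrow> U x = 0) \<and> (AE x in lborel. x \<in> \<Omega> \<longrightarrow> U x = u x)
    \<and> energy_le p \<mu> U (W1p_norm p \<mu> \<Omega> u) \<and> Lp_le p lborel U (Lp_norm p \<Omega> u)
    \<and> (\<forall>e>0. \<exists>\<psi>\<in>C0_inf \<Omega>. Lp_le r (pow_lborel s) (\<lambda>x. \<psi> x - U x) e)"
  proof
    fix u assume u: "u \<in> ?X"
    obtain U where U: "\<And>x. x \<notin> \<Omega> \<Longrightarrow> U x = 0" "AE x in lborel. x \<in> \<Omega> \<longrightarrow> U x = u x"
      "energy_le p \<mu> U (W1p_norm p \<mu> \<Omega> u)"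
      "\<And>e. 0 < e \<Longrightarrow> \<exists>\<phi>\<in>C0_inf \<Omega>. energy_le p \<mu> (\<lambda>x. \<phi> x - U x) e"
      using W1p_representative[OF \<Omega> p1(1) Hardy_range(2)[unfolded N_eq]] u by blast
    have L: "Lp_le p lborel U (Lp_norm p \<Omega> u)"
      using u by (intro Lp_representative[OF \<Omega> p1(2) _ energy_leD(1)[OF U(3)] U(1,2)]) auto
    have "\<exists>\<psi>\<in>C0_inf \<Omega>. Lp_le r (pow_lborel s) (\<lambda>x. \<psi> x - U x) e" if "0 < e" for e
      by (rule gaussian_approximation[OF U(3) L U(4) C0_inf_gaussian_mult that])
    then show "\<exists>U. U \<in> borel_measurable borel \<and> (\<forall>x. x \<notin> \<Omega> \<longrightarrow> U x = 0) \<and> (AE x in lborel. x \<in> \<Omega> \<longrightarrow> U x = u x)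
    \<and> energy_le p \<mu> U (W1p_norm p \<mu> \<Omega> u) \<and> Lp_le p lborel U (Lp_norm p \<Omega> u)
    \<and> (\<forall>e>0. \<exists>\<psi>\<in>C0_inf \<Omega>. Lp_le r (pow_lborel s) (\<lambda>x. \<psi> x - U x) e)"
      using U L energy_leD(1)[OF U(3)] by blast
  qed
  from bchoice[OF this] obtain R where R: "\<And>u. u \<in> ?X \<Longrightarrow> R u \<in> borel_measurable borel"
    "\<And>u x. u \<in> ?X \<Longrightarrow> x \<notin> \<Omega> \<Longrightarrow> R u x = 0"
    "\<And>u. u \<in> ?X \<Longrightarrow> AE x in lborel. x \<in> \<Omega> \<longrightarrow> R u x = u x"
    "\<And>u. u \<in> ?X \<Longrightarrow> energy_le p \<mu> (R u) (W1p_norm p \<mu> \<Omega> u)"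
    "\<And>u. u \<in> ?X \<Longrightarrow> Lp_le p lborel (R u) (Lp_norm p \<Omega> u)"
    "\<And>u e. u \<in> ?X \<Longrightarrow> 0 < e \<Longrightarrow> \<exists>\<psi>\<in>C0_inf \<Omega>. Lp_le r (pow_lborel s) (\<lambda>x. \<psi> x - R u x) e"
    by blast
  show ?thesis
    unfolding compact_embedding_def
  proof (intro conjI allI impI)
    show "?X \<subseteq> weighted_Lr r s \<Omega>"
      using weighted_Lr_representative(1)[OF \<Omega> r1(1) s' R(1,2,3,6)] by blast
    obtain C where C: "0 \<le> C" "\<And>(U :: 'a \<Rightarrow> real) \<omega> L. energy_le p \<mu> U \<omega> \<Longrightarrow> Lp_le p lborel U L \<Longrightarrow> Lp_le r (pow_lborel s) U (C * (\<omega> + L))"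
      by (rule embedding_bound) (rule that)
    show "\<exists>C. \<forall>u\<in>?X. weighted_Lr_norm r s \<Omega> u \<le> C * (W1p_norm p \<mu> \<Omega> u + lam * Lp_norm p \<Omega> u)"
    proof (intro exI ballI)
      fix u assume u: "u \<in> ?X"
      let ?w = "W1p_norm p \<mu> \<Omega> u" and ?l = "Lp_norm p \<Omega> u"
      have nn: "0 \<le> ?w" "0 \<le> ?l" using energy_leD(2)[OF R(4)[OF u]] Lp_leD(2)[OF R(5)[OF u]] .
      have "weighted_Lr_norm r s \<Omega> u = Lp_value r (pow_lborel s) (R u)"
        by (rule weighted_Lr_representative(2)[OF \<Omega> r1(1) s' R(1,2,3,6)[OF u]])
      also have "\<dots> \<le> C * (?w + ?l)"
        by (rule Lp_value_le[OF C(2)[OF R(4,5)[OF u]] r1(2)])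
      also have "?w + ?l \<le> (1 + 1 / lam) * (?w + lam * ?l)"
        using nn lam by (simp add: field_simps)
      finally show "weighted_Lr_norm r s \<Omega> u \<le> C * (1 + 1 / lam) * (?w + lam * ?l)"
        using C(1) by (simp add: mult_left_mono mult.assoc)
    qed
    fix u :: "nat \<Rightarrow> 'a \<Rightarrow> real" and B :: real
    assume "\<forall>n. u n \<in> ?X \<and> W1p_norm p \<mu> \<Omega> (u n) + lam * Lp_norm p \<Omega> (u n) \<le> B"
    then have u: "u n \<in> ?X" and B: "W1p_norm p \<mu> \<Omega> (u n) + lam * Lp_norm p \<Omega> (u n) \<le> B" for n by auto
    have nn: "0 \<le> W1p_norm p \<mu> \<Omega> (u n)" "0 \<le> Lp_norm p \<Omega> (u n)" for n
      using energy_leD(2)[OF R(4)[OF u]] Lp_leD(2)[OF R(5)[OF u]] .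
    have "energy_le p \<mu> (R (u n)) B" for n
      using B[of n] nn[of n] lam p1 by (intro energy_le_weaken[OF R(4)[OF u]]) (auto intro: order_trans[rotated])
    moreover have "Lp_le p lborel (R (u n)) (B / lam)" for n
    proof (rule Lp_le_weaken[OF R(5)[OF u]])
      show "Lp_norm p \<Omega> (u n) \<le> B / lam"
        using B[of n] nn[of n] lam by (simp add: pos_le_divide_eq mult.commute)
    qed (use p1 in simp)
    ultimately obtain k where k: "strict_mono (k :: nat \<Rightarrow> nat)"
      "\<And>e. 0 < e \<Longrightarrow> \<exists>M::nat. \<forall>m\<ge>M. \<forall>n\<ge>M. Lp_le r (pow_lborel s) (\<lambda>x. R (u (k m)) x - R (u (k n)) x) e"
      using compactness[of "\<lambda>n. R (u n)" B "B / lam"] by blast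
    have meas: "R (u (k n)) \<in> borel_measurable (pow_lborel s)" for n
      using R(1)[OF u] by (simp add: borel_measurable_pow_lborel)
    obtain W where W: "W \<in> borel_measurable (pow_lborel s)"
      "\<And>e. 0 < e \<Longrightarrow> \<exists>M::nat. \<forall>n\<ge>M. Lp_le r (pow_lborel s) (\<lambda>x. R (u (k n)) x - W x) e"
      using Lp_le_complete[OF k(2) meas r1(1)] by blast
    define v where "v x = indicator \<Omega> x * W x" for x
    have [measurable]: "W \<in> borel_measurable borel" "\<Omega> \<in> sets borel"
      using W(1) \<Omega> by (auto simp: borel_measurable_pow_lborel)
    have vm: "v \<in> borel_measurable borel" unfolding v_def by measurable
    have v0: "v x = 0" if "x \<notin> \<Omega>" for x using that by (simp add: v_def)
    have vlim: "\<exists>M. \<forall>n\<ge>M. Lp_le r (pow_lborel s) (\<lambda>x. R (u (k n)) x - v x) e" if e: "0 < e" for e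
    proof -
      obtain M where M: "\<And>n. n \<ge> M \<Longrightarrow> Lp_le r (pow_lborel s) (\<lambda>x. R (u (k n)) x - W x) e" using W(2)[OF e] by blast
      have "Lp_le r (pow_lborel s) (\<lambda>x. R (u (k n)) x - v x) e" if "n \<ge> M" for n
      proof (rule Lp_le_mono[OF M[OF that]])
        show "(\<lambda>x. R (u (k n)) x - v x) \<in> borel_measurable (pow_lborel s)"
          using vm R(1)[OF u] by (simp add: borel_measurable_pow_lborel)
        show "AE x in pow_lborel s. \<bar>R (u (k n)) x - v x\<bar> \<le> \<bar>R (u (k n)) x - W x\<bar>"
        proof (intro always_eventually allI)
          fix x
          show "\<bar>R (u (k n)) x - v x\<bar> \<le> \<bar>R (u (k n)) x - W x\<bar>"
            using R(2)[OF u[of "k n"], of x] by (cases "x \<in> \<Omega>") (auto simp: v_def)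
        qed
      qed (use r1 in auto)
      then show ?thesis by blast
    qed
    have vdense: "\<exists>\<psi>\<in>C0_inf \<Omega>. Lp_le r (pow_lborel s) (\<lambda>x. \<psi> x - v x) e" if e: "0 < e" for e
    proof -
      have e2: "0 < e / 2" using e by simp
      obtain n where n: "Lp_le r (pow_lborel s) (\<lambda>x. R (u (k n)) x - v x) (e / 2)" using vlim[OF e2] by blast
      obtain \<psi> where \<psi>: "\<psi> \<in> C0_inf \<Omega>" "Lp_le r (pow_lborel s) (\<lambda>x. \<psi> x - R (u (k n)) x) (e / 2)" using R(6)[OF u e2] by blast
      from Lp_le_triangle[OF \<psi>(2) n r1(1)] \<psi>(1) show ?thesis by auto
    qed
    have v: "v \<in> weighted_Lr r s \<Omega>"
      by (rule weighted_Lr_representative(1)[OF \<Omega> r1(1) s' vm v0 _ vdense]) auto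
    have norm_diff: "weighted_Lr_norm r s \<Omega> (\<lambda>x. u (k n) x - v x) = Lp_value r (pow_lborel s) (\<lambda>x. R (u (k n)) x - v x)" for n
    proof (rule weighted_Lr_representative(2)[OF \<Omega> r1(1) s'])
      show "(\<lambda>x. R (u (k n)) x - v x) \<in> borel_measurable borel" using vm R(1)[OF u] by simp
      show "R (u (k n)) x - v x = 0" if "x \<notin> \<Omega>" for x using R(2)[OF u that] v0[OF that] by simp
      show "AE x in lborel. x \<in> \<Omega> \<longrightarrow> R (u (k n)) x - v x = u (k n) x - v x"
        using R(3)[OF u] by eventually_elim auto
      fix e :: real assume "0 < e"
      then have e2: "0 < e / 2" by simp
      obtain \<psi> where \<psi>: "\<psi> \<in> C0_inf \<Omega>" "Lp_le r (pow_lborel s) (\<lambda>x. \<psi> x - R (u (k n)) x) (e / 2)" using R(6)[OF u e2] by blast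
      obtain \<psi>' where \<psi>': "\<psi>' \<in> C0_inf \<Omega>" "Lp_le r (pow_lborel s) (\<lambda>x. \<psi>' x - v x) (e / 2)" using vdense[OF e2] by blast
      have "Lp_le r (pow_lborel s) (\<lambda>x. (\<psi> x - \<psi>' x) - (R (u (k n)) x - v x)) e"
        using Lp_le_diff[OF \<psi>(2) \<psi>'(2) r1(1)] by (simp add: algebra_simps)
      then show "\<exists>\<psi>\<in>C0_inf \<Omega>. Lp_le r (pow_lborel s) (\<lambda>x. \<psi> x - (R (u (k n)) x - v x)) e"
        by (rule bexI[OF _ C0_inf_diff[OF \<psi>(1) \<psi>'(1)]])
    qed
    have "(\<lambda>n. weighted_Lr_norm r s \<Omega> (\<lambda>x. u (k n) x - v x)) \<longlonglongrightarrow> 0"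
    proof (rule LIMSEQ_I)
      fix e :: real assume "0 < e"
      then have e2: "0 < e / 2" by simp
      obtain M where M: "\<And>n. n \<ge> M \<Longrightarrow> Lp_le r (pow_lborel s) (\<lambda>x. R (u (k n)) x - v x) (e / 2)" using vlim[OF e2] by blast
      have "norm (weighted_Lr_norm r s \<Omega> (\<lambda>x. u (k n) x - v x) - 0) < e" if "n \<ge> M" for n
        using Lp_value_le[OF M[OF that] r1(2)] Lp_value_nonneg[of r "pow_lborel s" "\<lambda>x. R (u (k n)) x - v x"] \<open>0 < e\<close>
        unfolding norm_diff by simp
      then show "\<exists>M. \<forall>n\<ge>M. norm (weighted_Lr_norm r s \<Omega> (\<lambda>x. u (k n) x - v x) - 0) < e" by blast
    qed
    then show "\<exists>k v. strict_mono k \<and> v \<in> weighted_Lr r s \<Omega> \<and> (\<lambda>n. weighted_Lr_norm r s \<Omega> (\<lambda>x. u (k n) x - v x)) \<longlonglongrightarrow> 0"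
      using k(1) v by blast
  qed
qed

text \<open>The three cases enter the analysis only through these inequalities. For \<open>\<mu> \<le> 0\<close> the
  Hardy--Sobolev bound on \<open>r\<close> already lies below the Sobolev exponent; for \<open>\<mu> > 0\<close> the minimum in the
  hypothesis provides this.\<close>

lemma exponent_conditions:
  fixes N p r s \<mu> :: real
  assumes p: "1 < p" "p < N"
    and cases: "(\<mu> = 0 \<and> 0 < s \<and> s < p \<and> p < N \<and>
            p \<le> r \<and> r < p * (N - s) / (N - p))
       \<or> (\<mu> > 0 \<and> N * \<mu> * (r - p) / p\<^sup>2 < s \<and> s < \<mu> + p \<and> \<mu> + p < N \<and>
            p \<le> r \<and> r < min (p * N / (N - p)) (p * (N - s) / (N - \<mu> - p)))
       \<or> (\<mu> < 0 \<and> 0 < s \<and> s < \<mu> + p \<and> \<mu> + p < N \<and>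
            p \<le> r \<and> r < p * (N - s) / (N - \<mu> - p))"
  shows "p \<le> r" "0 < p + \<mu>" "p + \<mu> < N" "N / p < N / r + 1" "s / r < N / r + 1 - N / p + \<mu> / p"
    "(N / p - N / r) * max \<mu> 0 / p < s / r" "s < N"
proof -
  show pr: "p \<le> r" using cases by auto
  have r0: "0 < r" using pr p by simp
  show \<mu>p: "0 < p + \<mu>" "p + \<mu> < N" "s < N" using cases p by auto
  have "0 \<le> N * \<mu> * (r - p) / p\<^sup>2" if "0 < \<mu>" using that pr p by (intro divide_nonneg_nonneg mult_nonneg_nonneg) auto
  then have s0: "0 < s" using cases by auto
  have origin: "r * (N - \<mu> - p) < p * (N - s)"
    using cases \<mu>p by (auto simp: pos_less_divide_eq)
  have sub: "r * (N - p) < p * N"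
  proof (cases "0 < \<mu>")
    case True
    then show ?thesis using cases p by (auto simp: pos_less_divide_eq)
  next
    case False
    have "r * (N - p) * (N - \<mu> - p) < p * (N - s) * (N - p)"
      using mult_strict_right_mono[OF origin, of "N - p"] p by (simp add: mult_ac)
    also have "\<dots> \<le> p * N * (N - \<mu> - p)"
    proof -
      have "0 \<le> s * (N - p)" "N * \<mu> \<le> 0" using s0 p False by (auto simp: mult_nonneg_nonpos)
      then have "(N - s) * (N - p) \<le> N * (N - \<mu> - p)" by (simp add: algebra_simps)
      then show ?thesis using p by (simp add: mult.assoc mult_left_mono)
    qed
    finally show ?thesis using \<mu>p by (simp add: mult_less_cancel_right)
  qed
  show "N / p < N / r + 1" using sub p r0 by (simp add: field_simps)
  show "s / r < N / r + 1 - N / p + \<mu> / p" using origin p r0 by (simp add: field_simps)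
  show "(N / p - N / r) * max \<mu> 0 / p < s / r"
  proof (cases "0 < \<mu>")
    case True
    have "(N / p - N / r) * \<mu> / p = N * \<mu> * (r - p) / p\<^sup>2 / r"
      using p r0 by (simp add: field_simps power2_eq_square)
    also have "\<dots> < s / r" using True cases r0 by (intro divide_strict_right_mono) auto
    finally show ?thesis using True by simp
  next
    case False
    then show ?thesis using s0 r0 by (simp add: max_def)
  qed
qed

theorem corollary3p1:
  fixes \<Omega> :: "(real ^ 'n) set"
    and N p r s \<mu> lam :: real
  assumes "N = real CARD('n)" and "N \<ge> 2"
    and "lipschitz_domain \<Omega>"
    and "lam > 0"
    and "1 < p" and "p < N"
    and "(\<mu> = 0 \<and> 0 < s \<and> s < p \<and> p < N \<and>
            p \<le> r \<and> r < p * (N - s) / (N - p))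
       \<or> (\<mu> > 0 \<and> N * \<mu> * (r - p) / p\<^sup>2 < s \<and> s < \<mu> + p \<and> \<mu> + p < N \<and>
            p \<le> r \<and> r < min (p * N / (N - p)) (p * (N - s) / (N - \<mu> - p)))
       \<or> (\<mu> < 0 \<and> 0 < s \<and> s < \<mu> + p \<and> \<mu> + p < N \<and>
            p \<le> r \<and> r < p * (N - s) / (N - \<mu> - p))"
  shows "compact_embedding
           (W1p p \<mu> \<Omega> \<inter> Lp p \<Omega>) (\<lambda>u. W1p_norm p \<mu> \<Omega> u + lam * Lp_norm p \<Omega> u)
           (weighted_Lr r s \<Omega>) (weighted_Lr_norm r s \<Omega>)"
proof -
  note ex = exponent_conditions[OF assms(5-7)]
  interpret exponents "TYPE(real ^ 'n)" N p r s \<mu>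
    using assms(1,5) ex by unfold_locales simp_all
  show ?thesis
    using assms(3,4) ex by (intro compact_embedding_weighted) (auto simp: lipschitz_domain_def)
qed

end
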